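(* Let $X$ be a ball Banach function space on $\mathbb{R}^n$, $\gamma\in(0,\infty)$, $p\in[1,\infty)$, and $q\in(0,\infty)$ with $n(\frac1p-\frac1q)<1$. Assume that $X^{1/p}$ is a ball Banach function space and that the Hardy--Littlewood maximal operator $\mathcal{M}$ is bounded on $(X^{1/p})'$ with operator norm $\|\mathcal{M}\|_{(X^{1/p})'\to(X^{1/p})'}$. Then there exists a positive constant $C$, depending only on $p,q,\gamma,n$ and $\|\mathcal{M}\|_{(X^{1/p})'\to(X^{1/p})'}$, such that for every $f\in C^1(\mathbb{R}^n)$ with $|\nabla f|\in C_{\mathrm c}(\mathbb{R}^n)$, $$\sup_{\lambda>0}\lambda\left\|\left[\int_{\mathbb{R}^n}\mathbf{1}_{E_{\lambda,\gamma/q}[f]}(\cdot,y)|\cdot-y|^{\gamma-n}dy\right]^{1/q}\right\|_X\le C\|\,|\nabla f|\,\|_X,$$ and $C$ is continuous with respect to $\|\mathcal{M}\|_{(X^{1/p})'\to(X^{1/p})'}$ and increases as it increases.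
   Context: A quasi-Banach space $X$ of measurable functions on $\mathbb{R}^n$ with quasi-norm defined on all measurable functions is a ball quasi-Banach function space if: $\|f\|_X=0$ implies $f=0$ a.e.; $|g|\le|f|$ a.e. implies $\|g\|_X\le\|f\|_X$; $0\le f_m\uparrow f$ a.e. implies $\|f_m\|_X\uparrow\|f\|_X$; $\mathbf{1}_B\in X$ for every ball $B$. It is a ball Banach function space if moreover the triangle inequality holds and for every ball $B$ there is $C_B$ with $\int_B|f|\le C_B\|f\|_X$. For $t>0$, $X^t:=\{f:|f|^t\in X\}$ with $\|f\|_{X^t}:=\|\,|f|^t\|_X^{1/t}$. Associate space: $Y':=\{f:\|f\|_{Y'}:=\sup_{\|g\|_Y=1}\|fg\|_{L^1}<\infty\}$. $\mathcal{M}$ is the Hardy--Littlewood maximal operator; bounded on $Y$ with least constant $\|\mathcal{M}\|_{Y\to Y}$. $E_{\lambda,\beta}[f]:=\{(x,y):x\ne y,\ |f(x)-f(y)|/|x-y|^{1+\beta}>\lambda\}$. *)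

theory Defs
  imports "HOL-Analysis.Analysis"
begin

text \<open>Functions on R^n are modelled as real-valued functions on a Euclidean space 'a
  (n = DIM('a)). A (quasi-)norm on measurable functions is a map into [0,\<infinity>].\<close>

type_synonym 'a fnorm = "('a \<Rightarrow> real) \<Rightarrow> ennreal"

definition enn_powr :: "ennreal \<Rightarrow> real \<Rightarrow> ennreal" where
  "enn_powr a t = (if a = top then top else ennreal (enn2real a powr t))"

text \<open>Extension of a norm to [0,\<infinity>]-valued functions: infinite on a set of positive
  measure means infinite norm.\<close>
definition Xe :: "'a::euclidean_space fnorm \<Rightarrow> ('a \<Rightarrow> ennreal) \<Rightarrow> ennreal" where
  "Xe X g = (if AE x in lebesgue. g x < top then X (\<lambda>x. enn2real (g x)) else top)"

definition quasi_Banach_fs :: "'a::euclidean_space fnorm \<Rightarrow> bool" where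
  "quasi_Banach_fs X \<longleftrightarrow>
     (\<forall>f \<in> borel_measurable lebesgue. \<forall>c::real. X (\<lambda>x. c * f x) = ennreal \<bar>c\<bar> * X f) \<and>
     (\<exists>K::real. K \<ge> 1 \<and> (\<forall>f \<in> borel_measurable lebesgue. \<forall>g \<in> borel_measurable lebesgue.
        X (\<lambda>x. f x + g x) \<le> ennreal K * (X f + X g))) \<and>
     (\<forall>F::nat \<Rightarrow> 'a \<Rightarrow> real.
        (\<forall>k. F k \<in> borel_measurable lebesgue \<and> X (F k) < top) \<and>
        (\<forall>e>0. \<exists>N. \<forall>m\<ge>N. \<forall>k\<ge>N. X (\<lambda>x. F m x - F k x) < ennreal e) \<longrightarrow>
        (\<exists>f \<in> borel_measurable lebesgue. X f < top \<and>
           (\<lambda>k. X (\<lambda>x. F k x - f x)) \<longlonglongrightarrow> 0))"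

definition ball_quasi_Banach_fs :: "'a::euclidean_space fnorm \<Rightarrow> bool" where
  "ball_quasi_Banach_fs X \<longleftrightarrow> quasi_Banach_fs X \<and>
     (\<forall>f \<in> borel_measurable lebesgue. X f = 0 \<longrightarrow> (AE x in lebesgue. f x = 0)) \<and>
     (\<forall>f \<in> borel_measurable lebesgue. \<forall>g \<in> borel_measurable lebesgue.
        (AE x in lebesgue. \<bar>g x\<bar> \<le> \<bar>f x\<bar>) \<longrightarrow> X g \<le> X f) \<and>
     (\<forall>F::nat \<Rightarrow> 'a \<Rightarrow> real. \<forall>f.
        (\<forall>m. F m \<in> borel_measurable lebesgue) \<and> f \<in> borel_measurable lebesgue \<and>
        (AE x in lebesgue. (\<forall>m. 0 \<le> F m x \<and> F m x \<le> F (Suc m) x) \<and>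
            (\<lambda>m. F m x) \<longlonglongrightarrow> f x) \<longrightarrow>
        (\<lambda>m. X (F m)) \<longlonglongrightarrow> X f) \<and>
     (\<forall>c r. 0 < r \<longrightarrow> X (indicator (ball c r)) < top)"

definition ball_Banach_fs :: "'a::euclidean_space fnorm \<Rightarrow> bool" where
  "ball_Banach_fs X \<longleftrightarrow> ball_quasi_Banach_fs X \<and>
     (\<forall>f \<in> borel_measurable lebesgue. \<forall>g \<in> borel_measurable lebesgue.
        X (\<lambda>x. f x + g x) \<le> X f + X g) \<and>
     (\<forall>c r. 0 < r \<longrightarrow> (\<exists>C::real. 0 \<le> C \<and> (\<forall>f \<in> borel_measurable lebesgue.
        (\<integral>\<^sup>+ x \<in> ball c r. ennreal \<bar>f x\<bar> \<partial>lebesgue) \<le> ennreal C * X f)))"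

definition Xpow :: "'a::euclidean_space fnorm \<Rightarrow> real \<Rightarrow> 'a fnorm" where
  "Xpow X t f = enn_powr (X (\<lambda>x. \<bar>f x\<bar> powr t)) (1 / t)"

definition assoc :: "'a::euclidean_space fnorm \<Rightarrow> 'a fnorm" where
  "assoc Y f = (SUP g \<in> {g \<in> borel_measurable lebesgue. Y g = 1}.
                  \<integral>\<^sup>+ x. ennreal \<bar>f x * g x\<bar> \<partial>lebesgue)"

definition maxop :: "('a::euclidean_space \<Rightarrow> real) \<Rightarrow> 'a \<Rightarrow> ennreal" where
  "maxop f x = (SUP cr \<in> {(c, r). 0 < r \<and> x \<in> ball c r}.
      (\<integral>\<^sup>+ y \<in> ball (fst cr) (snd cr). ennreal \<bar>f y\<bar> \<partial>lebesgue)
        / emeasure lebesgue (ball (fst cr) (snd cr)))"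

definition M_bound_consts :: "'a::euclidean_space fnorm \<Rightarrow> real set" where
  "M_bound_consts Y = {C. 0 \<le> C \<and> (\<forall>f \<in> borel_measurable lebesgue.
      Y f < top \<longrightarrow> Xe Y (maxop f) \<le> ennreal C * Y f)}"

definition M_bounded :: "'a::euclidean_space fnorm \<Rightarrow> bool" where
  "M_bounded Y \<longleftrightarrow> M_bound_consts Y \<noteq> {}"

definition M_norm :: "'a::euclidean_space fnorm \<Rightarrow> real" where
  "M_norm Y = Inf (M_bound_consts Y)"

definition Eset :: "real \<Rightarrow> real \<Rightarrow> ('a::euclidean_space \<Rightarrow> real) \<Rightarrow> ('a \<times> 'a) set" where
  "Eset lam \<beta> f = {(x, y). x \<noteq> y \<and> \<bar>f x - f y\<bar> / (norm (x - y) powr (1 + \<beta>)) > lam}"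

end

theory Submission
  imports Defs
begin

text \<open>
  Averaging \<open>f\<close> over the ball centred at the midpoint of \<open>x\<close> and \<open>y\<close> shows that if
  \<open>\<bar>f x - f y\<bar> > \<lambda> r\<^bsup>1 + \<gamma>/q\<^esup>\<close> with \<open>r = \<bar>x - y\<bar>\<close>, then for some \<open>j\<close> the mean of \<open>\<bar>\<nabla>f\<bar>\<close> over the ball of
  radius \<open>2\<^bsup>-j\<^esup>r\<close> around \<open>x\<close> or around \<open>y\<close> exceeds a multiple of
  \<open>\<lambda> 2\<^bsup>j(1 - \<delta>)\<^esup> r\<^bsup>\<gamma>/q\<^esup>\<close>. For fixed \<open>j\<close>, Vitali's covering lemma replaces these balls by disjoint
  ones, on which an \<open>A\<^sub>1\<close> weight \<open>w\<close> is controlled by its essential infimum; summing over the disjoint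
  balls and over \<open>j\<close> gives a weighted \<open>L\<^sup>p\<close> estimate whose constant is quadratic in the \<open>A\<^sub>1\<close> constant.
  No strong type bound for the maximal operator is used, so \<open>p = 1\<close> is not special.

  The estimate is transferred to \<open>X\<close> by duality: \<open>X\<^bsup>1/p\<^esup>\<close> coincides with its second associate
  space (Lorentz--Luxemburg), and every function in the unit ball of the first associate space is
  dominated by an \<open>A\<^sub>1\<close> weight of comparable norm (Rubio de Francia).
\<close>

section \<open>Riesz kernels\<close>

text \<open>Two demands meet in \<open>\<delta>\<close>. The bound
  \<open>2 powr (real j * (1 - \<delta>))\<close> for the average at scale \<open>r / 2 ^ j\<close>
  turns into \<open>t powr (\<delta> - 1)\<close> at the fraction \<open>t\<close> of a segment, so
  \<open>0 < \<delta>\<close> is integrability at \<open>t = 0\<close>. The sum over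
  \<open>j\<close> has ratio \<open>2 powr (n * (1 - p / q) - p * (1 - \<delta>))\<close>, so
  \<open>\<delta>\<close> must also be small; the strict inequality assumed between
  \<open>n\<close>, \<open>p\<close>, \<open>q\<close> leaves room for both. Contributions of
  different balls and scales are added through subadditivity of the power \<open>p / q\<close>,
  which requires \<open>p \<le> q\<close>; this is why smaller \<open>q\<close> is reduced to
  \<open>q = p\<close>. Vitali's lemma needs bounded radii. Compact support bounds the gradient, and
  since \<open>\<gamma> / q\<close> is positive a bounded gradient cannot exceed the threshold at
  large distances. The \<open>A\<^sub>1\<close> constant is paid once for comparing an enlarged ball
  with the ball itself and once for letting the kernel act on the weight, hence the square.\<close>

lemma ball_borel [measurable]: "ball (c :: 'a :: metric_space) r \<in> sets borel"
  by simp

lemma ball_lebesgue [measurable]: "ball (c :: 'a :: euclidean_space) r \<in> sets lebesgue"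
  by simp

text \<open>The dyadic shell estimate summed up: the ball of radius \<open>R / 2 ^ m\<close>
  contributes at most \<open>2 ^ n * unit_ball_vol n * (R / 2 ^ m) powr \<alpha>\<close>, a
  geometric series in \<open>m\<close> of ratio \<open>2 powr - \<alpha>\<close>.\<close>

definition kernel_const :: "nat \<Rightarrow> real \<Rightarrow> real" where
  "kernel_const n \<alpha> = 2 ^ n * unit_ball_vol (real n) / (1 - 2 powr - \<alpha>)"

lemma kernel_const_pos: "0 < \<alpha> \<Longrightarrow> 0 < kernel_const n \<alpha>"
  by (auto simp: kernel_const_def intro!: divide_pos_pos mult_pos_pos powr_less_one)

text \<open>A single dyadic term dominates the kernel pointwise, so integrating it against a weight
  only involves averages over concentric balls. The index \<open>m\<close> is the shell containing
  \<open>z\<close>. For \<open>\<alpha> < n\<close> the kernel is largest at the inner radius, which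
  costs \<open>2 powr (n - \<alpha>)\<close>, at most \<open>2 ^ n\<close> since
  \<open>0 \<le> \<alpha>\<close>; for \<open>n \<le> \<alpha>\<close> the outer radius
  suffices.\<close>

lemma kernel_le_shells:
  fixes z :: "'a :: real_normed_vector"
  assumes "0 < R" "z \<noteq> 0" "norm z < R" "0 \<le> \<alpha>"
  shows "\<exists>m::nat. norm z < R / 2 ^ m \<and> norm z powr (\<alpha> - real n) \<le> 2 ^ n * (R / 2 ^ m) powr (\<alpha> - real n)"
proof -
  obtain N :: nat where N: "R / norm z < 2 ^ N"
    using real_arch_pow[of 2 "R / norm z"] by auto
  define m where "m = (LEAST m. R / 2 ^ Suc m \<le> norm z)"
  have ex: "R / 2 ^ Suc N \<le> norm z"
    using N assms by (simp add: field_simps)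
  then have m1: "R / 2 ^ Suc m \<le> norm z"
    unfolding m_def by (rule LeastI)
  have m2: "norm z < R / 2 ^ m"
  proof (cases m)
    case 0 then show ?thesis using assms by simp
  next
    case (Suc k)
    then have "\<not> R / 2 ^ Suc k \<le> norm z"
      unfolding m_def by (metis lessI not_less_Least)
    then show ?thesis by (simp add: Suc)
  qed
  have "norm z powr (\<alpha> - real n) \<le> 2 ^ n * (R / 2 ^ m) powr (\<alpha> - real n)"
  proof (cases "real n \<le> \<alpha>")
    case True
    have "norm z powr (\<alpha> - real n) \<le> 1 * (R / 2 ^ m) powr (\<alpha> - real n)"
      using True m2 by (simp add: powr_mono2)
    also have "\<dots> \<le> 2 ^ n * (R / 2 ^ m) powr (\<alpha> - real n)"
      by (intro mult_right_mono) auto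
    finally show ?thesis .
  next
    case False
    define \<beta> where "\<beta> = real n - \<alpha>"
    have "norm z powr (-\<beta>) \<le> (R / 2 ^ Suc m) powr (-\<beta>)"
      using False m1 assms by (intro powr_mono2') (auto simp: \<beta>_def)
    also have "\<dots> = (1/2) powr (-\<beta>) * (R / 2 ^ m) powr (-\<beta>)"
      using assms by (subst powr_mult[symmetric]) auto
    also have "(1/2) powr (-\<beta>) = 2 powr \<beta>"
      by (simp add: powr_divide powr_minus divide_simps)
    finally have *: "norm z powr (-\<beta>) \<le> 2 powr \<beta> * (R / 2 ^ m) powr (-\<beta>)" .
    have "2 powr \<beta> \<le> 2 powr real n" using assms by (simp add: \<beta>_def)
    then have "2 powr \<beta> \<le> 2 ^ n" by (simp add: powr_realpow)
    then have "2 powr \<beta> * (R / 2 ^ m) powr (-\<beta>) \<le> 2 ^ n * (R / 2 ^ m) powr (-\<beta>)"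
      by (intro mult_right_mono) auto
    with * show ?thesis by (simp add: \<beta>_def)
  qed
  with m2 show ?thesis by blast
qed

text \<open>At \<open>x = y\<close> the kernel is \<open>0\<close> for every exponent, because \<open>0 powr a = 0\<close>.\<close>

lemma kernel_integral_le:
  fixes w :: "'a :: euclidean_space \<Rightarrow> ennreal" and y :: 'a
  assumes \<alpha>: "0 < \<alpha>" and R: "0 < R" and [measurable]: "w \<in> borel_measurable borel"
    and avg: "\<And>r. 0 < r \<Longrightarrow> (\<integral>\<^sup>+x. indicator (ball y r) x * w x \<partial>lborel) \<le> b * emeasure lborel (ball y r)"
  shows "(\<integral>\<^sup>+x. ennreal (norm (x - y) powr (\<alpha> - real DIM('a))) * indicator (ball y R) x * w x \<partial>lborel)
    \<le> ennreal (kernel_const DIM('a) \<alpha> * R powr \<alpha>) * b"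
proof -
  let ?n = "DIM('a)"
  define c where "c m = 2 ^ ?n * (R / 2 ^ m) powr (\<alpha> - real ?n)" for m :: nat
  have "(\<integral>\<^sup>+x. ennreal (norm (x - y) powr (\<alpha> - real ?n)) * indicator (ball y R) x * w x \<partial>lborel)
    \<le> (\<integral>\<^sup>+x. (\<Sum>m. ennreal (c m) * (indicator (ball y (R / 2 ^ m)) x * w x)) \<partial>lborel)"
  proof (rule nn_integral_mono)
    fix x
    show "ennreal (norm (x - y) powr (\<alpha> - real ?n)) * indicator (ball y R) x * w x
      \<le> (\<Sum>m. ennreal (c m) * (indicator (ball y (R / 2 ^ m)) x * w x))"
    proof (cases "x \<in> ball y R \<and> x \<noteq> y")
      case True
      then have "norm (x - y) < R" "x - y \<noteq> 0" by (auto simp: dist_norm norm_minus_commute)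
      from kernel_le_shells[OF R this(2,1) less_imp_le[OF \<alpha>], of ?n] obtain m where
        m: "norm (x - y) < R / 2 ^ m" "norm (x - y) powr (\<alpha> - real ?n) \<le> c m"
        unfolding c_def by blast
      have "ennreal (norm (x - y) powr (\<alpha> - real ?n)) * indicator (ball y R) x * w x
         = ennreal (norm (x - y) powr (\<alpha> - real ?n)) * w x"
        using True by simp
      also have "\<dots> \<le> ennreal (c m) * (indicator (ball y (R / 2 ^ m)) x * w x)"
        using m by (auto simp: dist_norm norm_minus_commute indicator_def intro!: mult_right_mono ennreal_leI)
      also have "\<dots> = (\<Sum>k\<in>{m}. ennreal (c k) * (indicator (ball y (R / 2 ^ k)) x * w x))" by simp
      also have "\<dots> \<le> (\<Sum>m. ennreal (c m) * (indicator (ball y (R / 2 ^ m)) x * w x))"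
        by (rule sum_le_suminf) auto
      finally show ?thesis .
    qed (auto simp: indicator_def)
  qed
  also have "\<dots> = (\<Sum>m. ennreal (c m) * (\<integral>\<^sup>+x. indicator (ball y (R / 2 ^ m)) x * w x \<partial>lborel))"
    by (subst nn_integral_suminf) (auto simp: nn_integral_cmult)
  also have "\<dots> \<le> (\<Sum>m. ennreal (c m) * (b * emeasure lborel (ball y (R / 2 ^ m))))"
    using R by (intro suminf_le mult_left_mono avg) auto
  also have "\<dots> = (\<Sum>m. ennreal (2 ^ ?n * unit_ball_vol ?n * R powr \<alpha> * (2 powr - \<alpha>) ^ m) * b)"
  proof (rule suminf_cong)
    fix m
    have "c m * (unit_ball_vol ?n * (R / 2 ^ m) ^ ?n) = 2 ^ ?n * unit_ball_vol ?n * (R / 2 ^ m) powr \<alpha>"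
      using R by (simp add: c_def powr_diff powr_realpow)
    also have "(R / 2 ^ m) powr \<alpha> = R powr \<alpha> * (2 powr - \<alpha>) ^ m"
      using R by (simp add: powr_divide powr_realpow[symmetric] powr_powr powr_minus divide_simps mult.commute)
    finally have eq: "c m * (unit_ball_vol ?n * (R / 2 ^ m) ^ ?n) = 2 ^ ?n * unit_ball_vol ?n * R powr \<alpha> * (2 powr - \<alpha>) ^ m"
      by simp
    have "ennreal (c m) * (b * emeasure lborel (ball y (R / 2 ^ m)))
       = ennreal (c m * (unit_ball_vol ?n * (R / 2 ^ m) ^ ?n)) * b"
      using R by (simp add: emeasure_ball c_def ennreal_mult'' mult_ac)
    then show "ennreal (c m) * (b * emeasure lborel (ball y (R / 2 ^ m)))
      = ennreal (2 ^ ?n * unit_ball_vol ?n * R powr \<alpha> * (2 powr - \<alpha>) ^ m) * b"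
      unfolding eq .
  qed
  also have "\<dots> = (\<Sum>m. ennreal (2 ^ ?n * unit_ball_vol ?n * R powr \<alpha> * (2 powr - \<alpha>) ^ m)) * b"
    by (rule ennreal_suminf_multc)
  also have "(\<Sum>m. ennreal (2 ^ ?n * unit_ball_vol ?n * R powr \<alpha> * (2 powr - \<alpha>) ^ m))
     = ennreal (kernel_const ?n \<alpha> * R powr \<alpha>)"
  proof (rule suminf_ennreal_eq)
    have "(\<lambda>m. (2 powr - \<alpha>) ^ m) sums (1 / (1 - 2 powr - \<alpha>))"
      using \<alpha> by (intro geometric_sums) (auto intro!: powr_less_one)
    from sums_mult[OF this, of "2 ^ ?n * unit_ball_vol ?n * R powr \<alpha>"]
    show "(\<lambda>m. 2 ^ ?n * unit_ball_vol ?n * R powr \<alpha> * (2 powr - \<alpha>) ^ m) sums (kernel_const ?n \<alpha> * R powr \<alpha>)"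
      by (simp add: kernel_const_def)
  qed auto
  finally show ?thesis .
qed

lemma kernel_integral_ball_le:
  fixes y :: "'a :: euclidean_space"
  assumes \<alpha>: "0 < \<alpha>" and R: "0 < R"
  shows "(\<integral>\<^sup>+x. ennreal (norm (x - y) powr (\<alpha> - real DIM('a))) * indicator (ball y R) x \<partial>lborel)
    \<le> ennreal (kernel_const DIM('a) \<alpha> * R powr \<alpha>)"
  using kernel_integral_le[OF \<alpha> R, of "\<lambda>_. 1" y 1] by simp

section \<open>Oscillation and averages of the gradient\<close>

text \<open>Contraction towards \<open>x\<close> by the factor \<open>t\<close>: it converts the
  mean over \<open>z\<close> of the gradient at the point \<open>x + t *\<^sub>R (z - x)\<close>
  into a mean over the smaller concentric ball.\<close>

lemma nn_integral_ball_dilate: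
  fixes G :: "'a :: euclidean_space \<Rightarrow> ennreal"
  assumes t: "0 < t" and [measurable]: "G \<in> borel_measurable borel"
  shows "(\<integral>\<^sup>+u. G u * indicator (ball x (t * r)) u \<partial>lborel)
     = ennreal (t ^ DIM('a)) * (\<integral>\<^sup>+z. G (x + t *\<^sub>R (z - x)) * indicator (ball x r) z \<partial>lborel)"
proof -
  let ?T = "\<lambda>z. (x - t *\<^sub>R x) + t *\<^sub>R z"
  have ind: "indicator (ball x (t * r)) (?T z) = (indicator (ball x r) z :: ennreal)" for z
  proof -
    have "dist x (?T z) = norm (t *\<^sub>R (x - z))"
      by (simp add: dist_norm algebra_simps)
    then have "dist x (?T z) = t * dist x z"
      using t by (simp add: dist_norm)
    then show ?thesis using t by (simp add: indicator_def)
  qed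
  have "(\<integral>\<^sup>+u. G u * indicator (ball x (t * r)) u \<partial>lborel)
     = (\<integral>\<^sup>+u. G u * indicator (ball x (t * r)) u \<partial>(density (distr lborel borel ?T) (\<lambda>_. \<bar>t\<bar>^DIM('a))))"
    using lborel_affine[of t "x - t *\<^sub>R x"] t by simp
  also have "\<dots> = (\<integral>\<^sup>+z. ennreal (t ^ DIM('a)) * (G (?T z) * indicator (ball x (t * r)) (?T z)) \<partial>lborel)"
    using t by (subst nn_integral_density) (auto simp: nn_integral_distr)
  also have "\<dots> = ennreal (t ^ DIM('a)) * (\<integral>\<^sup>+z. G (?T z) * indicator (ball x (t * r)) (?T z) \<partial>lborel)"
    by (rule nn_integral_cmult) auto
  also have "(\<integral>\<^sup>+z. G (?T z) * indicator (ball x (t * r)) (?T z) \<partial>lborel)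
     = (\<integral>\<^sup>+z. G (x + t *\<^sub>R (z - x)) * indicator (ball x r) z \<partial>lborel)"
    unfolding ind by (simp add: algebra_simps)
  finally show ?thesis .
qed

text \<open>Fundamental theorem of calculus along the segment from \<open>x\<close> to
  \<open>z\<close>, stated as a nonnegative integral so that Tonelli applies in \<open>z\<close> and
  \<open>t\<close>.\<close>

lemma C1_diff_le_nn_integral:
  fixes f :: "'a :: euclidean_space \<Rightarrow> real"
  assumes der: "\<And>x. (f has_derivative (\<lambda>h. f' x \<bullet> h)) (at x)" and cont: "continuous_on UNIV f'"
  shows "ennreal \<bar>f z - f x\<bar> \<le>
    (\<integral>\<^sup>+t. indicator {0..1} t * ennreal (norm (z - x) * norm (f' (x + t *\<^sub>R (z - x)))) \<partial>lborel)"
proof -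
  let ?\<gamma> = "\<lambda>t. x + t *\<^sub>R (z - x)"
  have c: "continuous_on {0..1} (\<lambda>t. f' (?\<gamma> t))"
    by (rule continuous_on_compose2[OF cont]) (auto intro!: continuous_intros)
  have d: "((\<lambda>t. f (?\<gamma> t)) has_vector_derivative f' (?\<gamma> t) \<bullet> (z - x)) (at t within {0..1})" for t
  proof -
    have "((\<lambda>t. f (?\<gamma> t)) has_derivative (\<lambda>s. f' (?\<gamma> t) \<bullet> (s *\<^sub>R (z - x)))) (at t within {0..1})"
      by (rule has_derivative_compose[OF _ der]) (auto intro!: derivative_eq_intros)
    then show ?thesis by (simp add: has_vector_derivative_def)
  qed
  have I: "((\<lambda>t. f' (?\<gamma> t) \<bullet> (z - x)) has_integral (f z - f x)) {0..1}"
    using fundamental_theorem_of_calculus[of 0 1 "\<lambda>t. f (?\<gamma> t)", OF _ d] by simp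
  let ?h = "\<lambda>t. norm (z - x) * norm (f' (?\<gamma> t))"
  have J: "(?h has_integral integral {0..1} ?h) {0..1}"
    by (intro integrable_integral integrable_continuous_real continuous_intros c)
  have "\<bar>f z - f x\<bar> \<le> integral {0..1} ?h"
  proof -
    have "norm (integral {0..1} (\<lambda>t. f' (?\<gamma> t) \<bullet> (z - x))) \<le> integral {0..1} ?h"
      using I J by (intro integral_norm_bound_integral)
        (auto simp: has_integral_integrable mult.commute[of "norm (z - x)"] intro: Cauchy_Schwarz_ineq2)
    then show ?thesis using I by (simp add: integral_unique)
  qed
  moreover have "(\<integral>\<^sup>+t. ennreal (indicator {0..1} t * ?h t) \<partial>lborel) = ennreal (integral {0..1} ?h)"
    using nn_integral_has_integral_lebesgue[OF _ J] by simp
  moreover have "(\<integral>\<^sup>+t. indicator {0..1} t * ennreal (?h t) \<partial>lborel) = (\<integral>\<^sup>+t. ennreal (indicator {0..1} t * ?h t) \<partial>lborel)"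
    by (intro nn_integral_cong) (auto simp: indicator_def)
  ultimately show ?thesis by (simp add: ennreal_leI)
qed

lemma dyadic_scale:
  fixes t :: real
  assumes "0 < t" "t \<le> 1"
  obtains j :: nat where "t \<le> 1 / 2 ^ j" "1 / 2 ^ j < 2 * t"
proof -
  obtain N :: nat where N: "1 / t < 2 ^ N"
    using real_arch_pow[of 2 "1 / t"] by auto
  define j where "j = (LEAST j. 1 / 2 ^ j < 2 * t)"
  have "1 / 2 ^ N < 2 * t" using N assms by (simp add: field_simps)
  then have 1: "1 / 2 ^ j < 2 * t" unfolding j_def by (rule LeastI)
  have "t \<le> 1 / 2 ^ j"
  proof (cases j)
    case (Suc k)
    then have "\<not> 1 / 2 ^ k < 2 * t" unfolding j_def by (metis lessI not_less_Least)
    then show ?thesis by (simp add: Suc field_simps)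
  qed (use assms in simp)
  with 1 that show ?thesis by blast
qed

text \<open>The factor \<open>2 ^ n\<close> pays for passing from radius \<open>t * r\<close> to the
  next dyadic radius; the rest bounds the integral of
  \<open>\<bar>t\<bar> powr (\<delta> - 1)\<close> over \<open>ball 0 2\<close> in dimension
  one.\<close>

definition pw_const :: "nat \<Rightarrow> real \<Rightarrow> real" where
  "pw_const n \<delta> = 2 ^ n * kernel_const 1 \<delta> * 2 powr \<delta>"

lemma pw_const_pos: "0 < \<delta> \<Longrightarrow> 0 < pw_const n \<delta>"
  by (simp add: pw_const_def kernel_const_pos)

text \<open>After Tonelli, the integral over \<open>z\<close> for fixed \<open>t\<close> is a
  gradient integral over \<open>ball x (t * r)\<close>. This ball sits in a dyadic one of radius at
  most \<open>2 * t * r\<close>, where the hypothesis yields the factor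
  \<open>t powr (\<delta> - 1)\<close>, integrable at 0.\<close>

lemma nn_integral_ball_diff_le:
  fixes f :: "'a :: euclidean_space \<Rightarrow> real"
  assumes der: "\<And>x. (f has_derivative (\<lambda>h. f' x \<bullet> h)) (at x)" and cont: "continuous_on UNIV f'"
    and \<delta>: "0 < \<delta>" "\<delta> < 1" and r: "0 < r" and a: "0 \<le> a"
    and avg: "\<And>j::nat. (\<integral>\<^sup>+u. indicator (ball x (r / 2 ^ j)) u * ennreal (norm (f' u)) \<partial>lborel)
        \<le> ennreal (a * 2 powr (real j * (1 - \<delta>))) * emeasure lborel (ball x (r / 2 ^ j))"
  shows "(\<integral>\<^sup>+z. indicator (ball x r) z * ennreal \<bar>f z - f x\<bar> \<partial>lborel)
    \<le> ennreal (pw_const DIM('a) \<delta> * r * a) * emeasure lborel (ball x r)"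
proof -
  let ?n = "DIM('a)"
  define V where "V = unit_ball_vol (real ?n) * r ^ ?n"
  have V: "emeasure lborel (ball x r) = ennreal V" "0 \<le> V"
    using r by (auto simp: V_def emeasure_ball)
  have [measurable]: "f' \<in> borel_measurable borel"
    using cont by (rule borel_measurable_continuous_onI)
  define G where "G u = ennreal (norm (f' u))" for u
  have [measurable]: "G \<in> borel_measurable borel" unfolding G_def by measurable
  \<comment> \<open>The null set \<open>t = 0\<close> is removed because the contraction degenerates
    there.\<close>
  define H where "H z t = indicator {0<..1} t * (ennreal r * (G (x + t *\<^sub>R (z - x)) * indicator (ball x r) z))" for z t
  have H_meas: "case_prod H \<in> borel_measurable (lborel \<Otimes>\<^sub>M lborel)"
    unfolding H_def by (simp add: case_prod_beta')
  have "(\<integral>\<^sup>+z. indicator (ball x r) z * ennreal \<bar>f z - f x\<bar> \<partial>lborel) \<le> (\<integral>\<^sup>+z. \<integral>\<^sup>+t. H z t \<partial>lborel \<partial>lborel)"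
  proof (rule nn_integral_mono)
    fix z
    show "indicator (ball x r) z * ennreal \<bar>f z - f x\<bar> \<le> (\<integral>\<^sup>+t. H z t \<partial>lborel)"
    proof (cases "z \<in> ball x r")
      case True
      then have n: "norm (z - x) \<le> r" by (auto simp: dist_norm norm_minus_commute)
      have "ennreal \<bar>f z - f x\<bar> \<le> (\<integral>\<^sup>+t. indicator {0..1} t * ennreal (norm (z - x) * norm (f' (x + t *\<^sub>R (z - x)))) \<partial>lborel)"
        by (rule C1_diff_le_nn_integral[OF der cont])
      also have "\<dots> \<le> (\<integral>\<^sup>+t. H z t \<partial>lborel)"
      proof (rule nn_integral_mono_AE)
        show "AE t in lborel. indicator {0..1} t * ennreal (norm (z - x) * norm (f' (x + t *\<^sub>R (z - x)))) \<le> H z t"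
          using AE_lborel_singleton[of 0]
        proof eventually_elim
          case (elim t)
          then show ?case
            using True r n by (auto simp: H_def G_def indicator_def simp flip: ennreal_mult'
              intro!: ennreal_leI mult_right_mono)
        qed
      qed
      finally show ?thesis using True by simp
    qed simp
  qed
  also have "\<dots> = (\<integral>\<^sup>+t. \<integral>\<^sup>+z. H z t \<partial>lborel \<partial>lborel)"
    using lborel_pair.Fubini'[OF H_meas] by simp
  \<comment> \<open>The right side is brought to the shape of the one-dimensional Riesz kernel
    centred at 0; radius 2 makes the open ball contain the endpoint \<open>t = 1\<close>.\<close>
  also have "\<dots> \<le> (\<integral>\<^sup>+(t::real). ennreal (r * 2 ^ ?n * a * V) *
      (ennreal (norm (t - 0) powr (\<delta> - real DIM(real))) * indicator (ball 0 2) t) \<partial>lborel)"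
  proof (rule nn_integral_mono)
    fix t :: real
    show "(\<integral>\<^sup>+z. H z t \<partial>lborel) \<le> ennreal (r * 2 ^ ?n * a * V) *
      (ennreal (norm (t - 0) powr (\<delta> - real DIM(real))) * indicator (ball 0 2) t)"
    proof (cases "t \<in> {0<..1}")
      case True
      then have t: "0 < t" "t \<le> 1" by auto
      then obtain j where j: "t \<le> 1 / 2 ^ j" "1 / 2 ^ j < 2 * t" by (rule dyadic_scale)
      define I where "I = (\<integral>\<^sup>+z. G (x + t *\<^sub>R (z - x)) * indicator (ball x r) z \<partial>lborel)"
      have "ennreal (t ^ ?n) * I = (\<integral>\<^sup>+u. G u * indicator (ball x (t * r)) u \<partial>lborel)"
        unfolding I_def by (rule nn_integral_ball_dilate[symmetric]) (use t in auto)
      also have "\<dots> \<le> (\<integral>\<^sup>+u. indicator (ball x (r / 2 ^ j)) u * G u \<partial>lborel)"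
      proof (rule nn_integral_mono)
        fix u
        have "t * r \<le> r / 2 ^ j" using mult_right_mono[OF j(1), of r] r by simp
        then have "ball x (t * r) \<subseteq> ball x (r / 2 ^ j)" by (rule subset_ball)
        then show "G u * indicator (ball x (t * r)) u \<le> indicator (ball x (r / 2 ^ j)) u * G u"
          by (auto simp: indicator_def)
      qed
      also have "\<dots> \<le> ennreal (a * 2 powr (real j * (1 - \<delta>))) * emeasure lborel (ball x (r / 2 ^ j))"
        using avg[of j] unfolding G_def .
      also have "\<dots> = ennreal (a * 2 powr (real j * (1 - \<delta>)) * (unit_ball_vol (real ?n) * (r / 2 ^ j) ^ ?n))"
        using r a by (subst emeasure_ball) (auto simp flip: ennreal_mult')
      also have "\<dots> \<le> ennreal (t ^ ?n * (2 ^ ?n * a * t powr (\<delta> - 1) * V))"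
      proof (rule ennreal_leI)
        have "2 powr (real j * (1 - \<delta>)) = (1 / 2 ^ j) powr (\<delta> - 1)"
          by (simp add: powr_powr[symmetric] powr_realpow powr_divide powr_diff)
        also have "\<dots> \<le> t powr (\<delta> - 1)"
          using \<delta> t j by (intro powr_mono2') auto
        finally have 1: "2 powr (real j * (1 - \<delta>)) \<le> t powr (\<delta> - 1)" .
        have "r / 2 ^ j \<le> 2 * t * r"
          using mult_right_mono[OF less_imp_le[OF j(2)], of r] r by simp
        then have 2: "(r / 2 ^ j) ^ ?n \<le> (2 * t * r) ^ ?n"
          using r by (intro power_mono) auto
        have "a * 2 powr (real j * (1 - \<delta>)) * (unit_ball_vol (real ?n) * (r / 2 ^ j) ^ ?n)
          \<le> a * t powr (\<delta> - 1) * (unit_ball_vol (real ?n) * (2 * t * r) ^ ?n)"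
          using a r by (intro mult_mono mult_left_mono 1 2) auto
        also have "\<dots> = t ^ ?n * (2 ^ ?n * a * t powr (\<delta> - 1) * V)"
          by (simp add: V_def power_mult_distrib)
        finally show "a * 2 powr (real j * (1 - \<delta>)) * (unit_ball_vol (real ?n) * (r / 2 ^ j) ^ ?n)
          \<le> t ^ ?n * (2 ^ ?n * a * t powr (\<delta> - 1) * V)" .
      qed
      also have "\<dots> = ennreal (t ^ ?n) * ennreal (2 ^ ?n * a * t powr (\<delta> - 1) * V)"
        using t a V by (simp add: ennreal_mult')
      finally have I: "I \<le> ennreal (2 ^ ?n * a * t powr (\<delta> - 1) * V)"
        using t by (subst (asm) ennreal_mult_le_mult_iff) auto
      have "(\<integral>\<^sup>+z. H z t \<partial>lborel) = ennreal r * I"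
        unfolding H_def I_def using True by (simp add: nn_integral_cmult)
      also have "\<dots> \<le> ennreal r * ennreal (2 ^ ?n * a * t powr (\<delta> - 1) * V)"
        by (intro mult_left_mono I) auto
      also have "\<dots> = ennreal (r * 2 ^ ?n * a * V) *
          (ennreal (norm (t - 0) powr (\<delta> - real DIM(real))) * indicator (ball 0 2) t)"
        using t r a V by (simp add: ennreal_mult'[symmetric] mult_ac)
      finally show ?thesis .
    qed (auto simp: H_def)
  qed
  also have "\<dots> = ennreal (r * 2 ^ ?n * a * V) *
      (\<integral>\<^sup>+(t::real). ennreal (norm (t - 0) powr (\<delta> - real DIM(real))) * indicator (ball 0 2) t \<partial>lborel)"
    by (rule nn_integral_cmult) auto
  also have "\<dots> \<le> ennreal (r * 2 ^ ?n * a * V) * ennreal (kernel_const DIM(real) \<delta> * 2 powr \<delta>)"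
    by (intro mult_left_mono kernel_integral_ball_le \<delta>) auto
  also have "\<dots> = ennreal (pw_const ?n \<delta> * r * a) * emeasure lborel (ball x r)"
    using r a V kernel_const_pos[OF \<delta>(1), of 1]
    by (simp add: ennreal_mult'[symmetric] pw_const_def mult_ac)
  finally show ?thesis .
qed

text \<open>The ball of radius \<open>r / 2\<close> about the midpoint lies in both balls of radius
  \<open>r\<close>, so both endpoint estimates restrict to it. Dividing by its volume costs
  \<open>2 ^ n\<close>, and the two endpoints give the factor 2.\<close>

lemma C1_diff_le_of_averages:
  fixes f :: "'a :: euclidean_space \<Rightarrow> real"
  assumes der: "\<And>x. (f has_derivative (\<lambda>h. f' x \<bullet> h)) (at x)" and cont: "continuous_on UNIV f'"
    and \<delta>: "0 < \<delta>" "\<delta> < 1" and xy: "x \<noteq> y" and a: "0 \<le> a"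
    and avg: "\<And>c j::nat. c \<in> {x, y} \<Longrightarrow>
        (\<integral>\<^sup>+u. indicator (ball c (norm (x - y) / 2 ^ j)) u * ennreal (norm (f' u)) \<partial>lborel)
        \<le> ennreal (a * 2 powr (real j * (1 - \<delta>))) * emeasure lborel (ball c (norm (x - y) / 2 ^ j))"
  shows "\<bar>f x - f y\<bar> \<le> 2 * 2 ^ DIM('a) * pw_const DIM('a) \<delta> * a * norm (x - y)"
proof -
  let ?n = "DIM('a)" and ?P = "pw_const DIM('a) \<delta>"
  define r where "r = norm (x - y)"
  have r: "0 < r" using xy by (simp add: r_def)
  have P: "0 < ?P" using \<delta> by (rule_tac pw_const_pos)
  define D where "D = ball ((1/2) *\<^sub>R (x + y)) (r / 2)"
  have cont_f: "continuous_on UNIV f"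
    using der by (meson continuous_at_imp_continuous_on has_derivative_continuous)
  have [measurable]: "f \<in> borel_measurable borel"
    by (rule borel_measurable_continuous_onI[OF cont_f])
  have [measurable]: "D \<in> sets borel" by (simp add: D_def)
  define d where "d = unit_ball_vol (real ?n) * (r / 2) ^ ?n"
  have d: "0 < d" "emeasure lborel D = ennreal d"
    using r by (auto simp: d_def D_def emeasure_ball)
  have B: "emeasure lborel (ball c r) = ennreal (2 ^ ?n * d)" for c :: 'a
    using r by (simp add: emeasure_ball d_def power_divide)
  have half: "x - (1/2) *\<^sub>R (x + y) = (1/2) *\<^sub>R (x - y)" "y - (1/2) *\<^sub>R (x + y) = (1/2) *\<^sub>R (y - x)"
    by (simp_all add: algebra_simps scaleR_half_double flip: scaleR_add_left)
  have sub: "D \<subseteq> ball c r" if "c \<in> {x, y}" for c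
  proof -
    have "norm (c - (1/2) *\<^sub>R (x + y)) = r / 2"
      using that unfolding r_def by (auto simp only: half norm_scaleR norm_minus_commute insert_iff empty_iff)
    then show ?thesis
      unfolding D_def by (simp add: ball_subset_ball_iff dist_norm norm_minus_commute)
  qed
  have le: "(\<integral>\<^sup>+z. indicator D z * ennreal \<bar>f z - f c\<bar> \<partial>lborel) \<le> ennreal (?P * r * a * (2 ^ ?n * d))"
    if c: "c \<in> {x, y}" for c
  proof -
    have "(\<integral>\<^sup>+z. indicator D z * ennreal \<bar>f z - f c\<bar> \<partial>lborel)
      \<le> (\<integral>\<^sup>+z. indicator (ball c r) z * ennreal \<bar>f z - f c\<bar> \<partial>lborel)"
      using sub[OF c] by (intro nn_integral_mono mult_right_mono) (auto simp: indicator_def)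
    also have "\<dots> \<le> ennreal (?P * r * a) * emeasure lborel (ball c r)"
      using avg[OF c] by (intro nn_integral_ball_diff_le[OF der cont \<delta> r a]) (simp add: r_def)
    also have "\<dots> = ennreal (?P * r * a * (2 ^ ?n * d))"
      unfolding B using d r a P by (simp add: ennreal_mult'[symmetric])
    finally show ?thesis .
  qed
  have "ennreal (\<bar>f x - f y\<bar> * d) = (\<integral>\<^sup>+z. indicator D z * ennreal \<bar>f x - f y\<bar> \<partial>lborel)"
    using d by (simp add: nn_integral_cmult_indicator mult.commute[of "indicator D _"] ennreal_mult)
  also have "\<dots> \<le> (\<integral>\<^sup>+z. indicator D z * ennreal \<bar>f z - f x\<bar> + indicator D z * ennreal \<bar>f z - f y\<bar> \<partial>lborel)"
    by (intro nn_integral_mono) (auto simp: indicator_def ennreal_plus[symmetric] simp del: ennreal_plus intro!: ennreal_leI)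
  also have "\<dots> = (\<integral>\<^sup>+z. indicator D z * ennreal \<bar>f z - f x\<bar> \<partial>lborel) + (\<integral>\<^sup>+z. indicator D z * ennreal \<bar>f z - f y\<bar> \<partial>lborel)"
    by (rule nn_integral_add) auto
  also have "\<dots> \<le> ennreal (?P * r * a * (2 ^ ?n * d)) + ennreal (?P * r * a * (2 ^ ?n * d))"
    by (intro add_mono le) auto
  also have "\<dots> = ennreal ((2 * 2 ^ ?n * ?P * a * r) * d)"
    using P r a d by (subst ennreal_plus[symmetric]) (auto simp: algebra_simps)
  finally have "\<bar>f x - f y\<bar> * d \<le> (2 * 2 ^ ?n * ?P * a * r) * d"
    using P r a d by (subst (asm) ennreal_le_iff) auto
  then show ?thesis using d by (simp add: r_def)
qed

section \<open>Powers of extended nonnegative reals\<close>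

lemma enn_powr_ennreal: "0 \<le> x \<Longrightarrow> enn_powr (ennreal x) t = ennreal (x powr t)"
  by (simp add: enn_powr_def)

lemma enn_powr_top [simp]: "enn_powr top t = top"
  by (simp add: enn_powr_def)

lemma enn_powr_0 [simp]: "enn_powr 0 t = 0"
  by (simp add: enn_powr_def)

lemma enn_powr_1 [simp]: "enn_powr a 1 = a"
  by (cases a) (auto simp: enn_powr_ennreal)

lemma enn_powr_mono: "a \<le> b \<Longrightarrow> 0 \<le> t \<Longrightarrow> enn_powr a t \<le> enn_powr b t"
  by (cases a; cases b) (auto simp: enn_powr_ennreal top_unique intro!: ennreal_leI powr_mono2)

lemma enn_powr_powr: "enn_powr (enn_powr a s) t = enn_powr a (s * t)"
  by (cases a) (auto simp: enn_powr_ennreal powr_powr)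

lemma enn_powr_mult:
  "0 < t \<Longrightarrow> enn_powr (a * b) t = enn_powr a t * enn_powr b t"
  by (cases a; cases b)
    (auto simp: enn_powr_ennreal ennreal_mult'[symmetric] powr_mult ennreal_mult_top ennreal_top_mult)

lemma enn_powr_le_iff:
  assumes "0 < t"
  shows "enn_powr a t \<le> b \<longleftrightarrow> a \<le> enn_powr b (1 / t)"
proof
  assume "enn_powr a t \<le> b"
  from enn_powr_mono[OF this, of "1 / t"] assms show "a \<le> enn_powr b (1 / t)"
    by (simp add: enn_powr_powr)
next
  assume "a \<le> enn_powr b (1 / t)"
  from enn_powr_mono[OF this, of t] assms show "enn_powr a t \<le> b"
    by (simp add: enn_powr_powr)
qed

lemma measurable_enn_powr [measurable]:
  "(\<lambda>a. enn_powr a t) \<in> borel_measurable borel"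
  unfolding enn_powr_def by measurable

text \<open>Since \<open>t - 1\<close> is not positive,
  \<open>x * (a + b) powr (t - 1) \<le> x powr t\<close> for \<open>x = a\<close> and
  \<open>x = b\<close>; the left sides add up to \<open>(a + b) powr t\<close>.\<close>

lemma powr_subadditive:
  fixes a b :: real
  assumes "0 \<le> a" "0 \<le> b" "0 < t" "t \<le> 1"
  shows "(a + b) powr t \<le> a powr t + b powr t"
proof (cases "a = 0 \<or> b = 0")
  case False
  then have ab: "0 < a" "0 < b" using assms by auto
  have *: "x * (a + b) powr (t - 1) \<le> x powr t" if "0 < x" "x \<le> a + b" for x
  proof -
    have "x * (a + b) powr (t - 1) \<le> x * x powr (t - 1)"
      using that assms by (intro mult_left_mono powr_mono2') auto
    also have "\<dots> = x powr t"
      using that by (simp add: powr_diff)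
    finally show ?thesis .
  qed
  have "(a + b) powr t = a * (a + b) powr (t - 1) + b * (a + b) powr (t - 1)"
    using ab by (simp only: distrib_right[symmetric]) (simp add: powr_diff)
  also have "\<dots> \<le> a powr t + b powr t"
    using ab by (intro add_mono *) auto
  finally show ?thesis .
qed (use assms in auto)

lemma enn_powr_add_le:
  "0 < t \<Longrightarrow> t \<le> 1 \<Longrightarrow> enn_powr (a + b) t \<le> enn_powr a t + enn_powr b t"
  by (cases a; cases b)
    (auto simp: enn_powr_ennreal ennreal_plus[symmetric] simp del: ennreal_plus intro!: ennreal_leI powr_subadditive)

text \<open>The limit is taken on the other side of the equivalence \<open>enn_powr_le_iff\<close>,
  where it only concerns partial sums of \<open>a\<close>; continuity of the power is
  avoided.\<close>

lemma enn_powr_suminf_le: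
  fixes a :: "nat \<Rightarrow> ennreal"
  assumes t: "0 < t" "t \<le> 1"
  shows "enn_powr (\<Sum>i. a i) t \<le> (\<Sum>i. enn_powr (a i) t)"
proof -
  have fin: "enn_powr (\<Sum>i<n. a i) t \<le> (\<Sum>i<n. enn_powr (a i) t)" for n
  proof (induction n)
    case (Suc n)
    then show ?case
      using enn_powr_add_le[OF t, of "\<Sum>i<n. a i" "a n"]
      by (auto intro: order_trans add_right_mono)
  qed simp
  have "(\<Sum>i<n. a i) \<le> enn_powr (\<Sum>i. enn_powr (a i) t) (1 / t)" for n
    using order_trans[OF fin sum_le_suminf[of "\<lambda>i. enn_powr (a i) t" "{..<n}"]]
    unfolding enn_powr_le_iff[OF t(1), symmetric] by auto
  then have "(\<Sum>i. a i) \<le> enn_powr (\<Sum>i. enn_powr (a i) t) (1 / t)"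
    by (intro suminf_le_const) auto
  then show ?thesis unfolding enn_powr_le_iff[OF t(1)] .
qed

text \<open>Up to the level \<open>\<kappa>\<close> the constant term dominates, above it the linear
  one. This replaces a power of an integral by something that can be integrated against a
  weight.\<close>

lemma enn_powr_le_linear:
  assumes "0 < t" "t \<le> 1" "0 < \<kappa>"
  shows "enn_powr h t \<le> ennreal (\<kappa> powr (t - 1)) * h + ennreal (\<kappa> powr t)"
proof (cases h)
  case (real x)
  have "x powr t \<le> \<kappa> powr (t - 1) * x + \<kappa> powr t"
  proof (cases "x \<le> \<kappa>")
    case True
    then have "x powr t \<le> \<kappa> powr t" using assms real by (intro powr_mono2) auto
    then show ?thesis using real by (simp add: add_increasing)
  next
    case False
    then have "x powr t = x powr (t - 1) * x" using assms by (simp add: powr_diff)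
    also have "\<dots> \<le> \<kappa> powr (t - 1) * x"
      using False assms by (intro mult_right_mono powr_mono2') auto
    finally show ?thesis by (simp add: add_increasing2)
  qed
  then show ?thesis
    using real by (simp add: enn_powr_ennreal ennreal_mult'[symmetric] ennreal_plus[symmetric] ennreal_leI del: ennreal_plus)
qed (use assms in \<open>auto simp: ennreal_mult_top\<close>)

section \<open>Weights of class \<open>A\<^sub>1\<close>\<close>

text \<open>This is \<open>M w \<le> A * w\<close> almost everywhere for the uncentred maximal
  operator, with one null set serving all balls. Borel measurability is demanded because Tonelli is
  used on products of \<open>lborel\<close>; the value \<open>top\<close> is allowed because the
  weights constructed later are infinite series.\<close>

definition A1_weight :: "real \<Rightarrow> ('a :: euclidean_space \<Rightarrow> ennreal) \<Rightarrow> bool" where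
  "A1_weight A w \<longleftrightarrow> w \<in> borel_measurable borel \<and>
    (AE z in lborel. \<forall>c r. 0 < r \<longrightarrow> z \<in> ball c r \<longrightarrow>
      (\<integral>\<^sup>+x. indicator (ball c r) x * w x \<partial>lborel) \<le> ennreal A * w z * emeasure lborel (ball c r))"

text \<open>A form of Jensen's inequality with a lost factor \<open>2 powr p\<close>. At the level
  \<open>S = T / 2\<close> one has \<open>y \<le> S + S powr (1 - p) * y powr p\<close>, and the
  constant part accounts for only half of the average, so it can be absorbed.\<close>

lemma average_powr_le:
  fixes g :: "'a :: euclidean_space \<Rightarrow> real"
  assumes [measurable]: "g \<in> borel_measurable borel" and g: "\<And>x. 0 \<le> g x"
    and [measurable]: "B \<in> sets borel" and V: "emeasure lborel B = ennreal V" "0 \<le> V" and p: "1 \<le> p" and T: "0 < T"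
    and avg: "ennreal T * emeasure lborel B \<le> (\<integral>\<^sup>+x. indicator B x * ennreal (g x) \<partial>lborel)"
  shows "ennreal ((T / 2) powr p) * emeasure lborel B \<le> (\<integral>\<^sup>+x. indicator B x * ennreal (g x powr p) \<partial>lborel)"
proof -
  define J where "J = (\<integral>\<^sup>+x. indicator B x * ennreal (g x powr p) \<partial>lborel)"
  define S where "S = T / 2"
  have S: "0 < S" using T by (simp add: S_def)
  have pw: "y \<le> S + S powr (1 - p) * y powr p" if "0 \<le> y" for y
  proof (cases "y \<le> S")
    case False
    then have "y = y powr (1 - p) * y powr p" using S by (simp flip: powr_add)
    also have "\<dots> \<le> S powr (1 - p) * y powr p"
      using False S p by (intro mult_right_mono powr_mono2') auto
    finally show ?thesis using S by simp
  qed (simp add: add_increasing2)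
  have "ennreal T * emeasure lborel B \<le> (\<integral>\<^sup>+x. indicator B x * ennreal (g x) \<partial>lborel)" by fact
  also have "\<dots> \<le> (\<integral>\<^sup>+x. ennreal S * indicator B x + ennreal (S powr (1 - p)) * (indicator B x * ennreal (g x powr p)) \<partial>lborel)"
    using pw[OF g] S by (intro nn_integral_mono)
      (auto simp: indicator_def ennreal_mult'[symmetric] ennreal_plus[symmetric] simp del: ennreal_plus intro!: ennreal_leI)
  also have "\<dots> = ennreal S * emeasure lborel B + ennreal (S powr (1 - p)) * J"
    by (simp add: nn_integral_add nn_integral_cmult J_def)
  finally have main: "ennreal T * ennreal V \<le> ennreal S * ennreal V + ennreal (S powr (1 - p)) * J"
    by (simp add: V)
  show ?thesis
  proof (cases J)
    case (real j)
    have "T * V \<le> S * V + S powr (1 - p) * j"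
      using main real V S T by (simp add: ennreal_mult'[symmetric] ennreal_plus[symmetric] del: ennreal_plus)
    then have "S * V \<le> S powr (1 - p) * j" by (simp add: S_def field_simps)
    then have "S powr (p - 1) * (S * V) \<le> S powr (p - 1) * (S powr (1 - p) * j)"
      by (rule mult_left_mono) simp
    also have "\<dots> = j" using S by (simp add: powr_diff)
    also have "S powr (p - 1) * (S * V) = S powr p * V" using S by (simp add: powr_diff)
    finally have "ennreal (S powr p * V) \<le> J" using real by (simp add: ennreal_leI)
    then show ?thesis using V by (simp add: J_def S_def ennreal_mult')
  qed (simp add: J_def[symmetric])
qed

text \<open>Almost every \<open>z\<close> in the small ball also lies in the enlarged one, so the
  \<open>A\<^sub>1\<close> condition bounds the weight of the latter by \<open>w z\<close>.
  Integrating against \<open>g z powr p\<close> over the small ball and inserting the lower bound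
  for the mean of \<open>g powr p\<close> moves the large average of \<open>g\<close> into the
  estimate.\<close>

lemma A1_weight_ball_le:
  fixes g :: "'a :: euclidean_space \<Rightarrow> real"
  assumes w: "A1_weight A w" and A: "0 \<le> A"
    and [measurable]: "g \<in> borel_measurable borel" and g: "\<And>x. 0 \<le> g x"
    and p: "1 \<le> p" and T: "0 < T" and \<rho>: "0 < \<rho>" and s: "1 \<le> s"
    and avg: "ennreal T * emeasure lborel (ball c \<rho>) \<le> (\<integral>\<^sup>+x. indicator (ball c \<rho>) x * ennreal (g x) \<partial>lborel)"
  shows "(\<integral>\<^sup>+x. indicator (ball c (s * \<rho>)) x * w x \<partial>lborel)
     \<le> ennreal (2 powr p * s ^ DIM('a) * A / T powr p) * (\<integral>\<^sup>+x. indicator (ball c \<rho>) x * (ennreal (g x powr p) * w x) \<partial>lborel)"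
proof -
  have [measurable]: "w \<in> borel_measurable borel" using w by (simp add: A1_weight_def)
  define V where "V = unit_ball_vol DIM('a) * \<rho> ^ DIM('a)"
  have V: "0 < V" "emeasure lborel (ball c \<rho>) = ennreal V"
    "emeasure lborel (ball c (s * \<rho>)) = ennreal (s ^ DIM('a) * V)"
    using \<rho> s by (auto simp: V_def emeasure_ball power_mult_distrib mult_ac)
  define W where "W = (\<integral>\<^sup>+x. indicator (ball c (s * \<rho>)) x * w x \<partial>lborel)"
  define I where "I = (\<integral>\<^sup>+x. indicator (ball c \<rho>) x * (ennreal (g x powr p) * w x) \<partial>lborel)"
  have "ennreal V * (ennreal ((T / 2) powr p) * W) = W * (ennreal ((T / 2) powr p) * emeasure lborel (ball c \<rho>))"
    by (simp add: V mult_ac)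
  also have "\<dots> \<le> W * (\<integral>\<^sup>+x. indicator (ball c \<rho>) x * ennreal (g x powr p) \<partial>lborel)"
    using V g p T by (intro mult_left_mono average_powr_le[OF _ _ _ V(2)] avg) auto
  also have "\<dots> = (\<integral>\<^sup>+x. W * (indicator (ball c \<rho>) x * ennreal (g x powr p)) \<partial>lborel)"
    by (rule nn_integral_cmult[symmetric]) auto
  also have "\<dots> \<le> (\<integral>\<^sup>+x. ennreal (A * (s ^ DIM('a) * V)) * (indicator (ball c \<rho>) x * (ennreal (g x powr p) * w x)) \<partial>lborel)"
  proof (rule nn_integral_mono_AE)
    from w have "AE z in lborel. \<forall>c r. 0 < r \<longrightarrow> z \<in> ball c r \<longrightarrow>
      (\<integral>\<^sup>+x. indicator (ball c r) x * w x \<partial>lborel) \<le> ennreal A * w z * emeasure lborel (ball c r)"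
      by (simp add: A1_weight_def)
    then show "AE x in lborel. W * (indicator (ball c \<rho>) x * ennreal (g x powr p))
      \<le> ennreal (A * (s ^ DIM('a) * V)) * (indicator (ball c \<rho>) x * (ennreal (g x powr p) * w x))"
    proof eventually_elim
      case (elim z)
      show ?case
      proof (cases "z \<in> ball c \<rho>")
        case True
        have "\<rho> \<le> s * \<rho>" using \<rho> s by simp
        then have "z \<in> ball c (s * \<rho>)" using True by auto
        then have "W \<le> ennreal A * w z * emeasure lborel (ball c (s * \<rho>))"
          unfolding W_def using elim \<rho> s by (simp del: mem_ball)
        also have "\<dots> = ennreal (A * (s ^ DIM('a) * V)) * w z"
          using A V s by (simp add: ennreal_mult' mult_ac)
        finally have "W * ennreal (g z powr p) \<le> ennreal (A * (s ^ DIM('a) * V)) * w z * ennreal (g z powr p)"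
          by (rule mult_right_mono) simp
        then show ?thesis using True by (simp add: mult_ac)
      qed simp
    qed
  qed
  also have "\<dots> = ennreal (A * (s ^ DIM('a) * V)) * I"
    unfolding I_def by (rule nn_integral_cmult) auto
  also have "\<dots> = ennreal V * (ennreal (A * s ^ DIM('a)) * I)"
    using A V s by (simp add: ennreal_mult' mult_ac)
  finally have "ennreal ((T / 2) powr p) * W \<le> ennreal (A * s ^ DIM('a)) * I"
    using V by (subst (asm) ennreal_mult_le_mult_iff) auto
  then have "ennreal (2 powr p / T powr p) * (ennreal ((T / 2) powr p) * W) \<le> ennreal (2 powr p / T powr p) * (ennreal (A * s ^ DIM('a)) * I)"
    by (rule mult_left_mono) simp
  also have "ennreal (2 powr p / T powr p) * (ennreal ((T / 2) powr p) * W) = ennreal (2 powr p / T powr p * (T / 2) powr p) * W"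
    by (subst ennreal_mult) (auto simp: mult.assoc)
  also have "2 powr p / T powr p * (T / 2) powr p = 1"
    using T by (simp add: powr_divide)
  also have "ennreal (2 powr p / T powr p) * (ennreal (A * s ^ DIM('a)) * I) = ennreal (2 powr p / T powr p * (A * s ^ DIM('a))) * I"
    using A s by (subst ennreal_mult) (auto simp: mult.assoc)
  also have "2 powr p / T powr p * (A * s ^ DIM('a)) = 2 powr p * s ^ DIM('a) * A / T powr p"
    by simp
  finally show ?thesis by (simp add: W_def I_def)
qed

section \<open>The weighted estimate on one ball\<close>

text \<open>Majorant of the kernel on the pairs assigned to one selected ball of radius
  \<open>\<rho> = R / 2 ^ j\<close>: the fivefold enlargement in Vitali's lemma captures one
  endpoint of the pair and limits the distance of the pair to \<open>5 * R\<close>. The sum of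
  indicators covers both choices of the endpoint.\<close>

definition ball_kernel :: "real \<Rightarrow> 'a::euclidean_space \<Rightarrow> real \<Rightarrow> real \<Rightarrow> 'a \<Rightarrow> 'a \<Rightarrow> ennreal" where
  "ball_kernel \<gamma> c \<rho> R x y = ennreal (norm (x - y) powr (\<gamma> - real DIM('a))) *
     (if dist x y < 5 * R then 1 else 0) * (indicator (ball c (5 * \<rho>)) x + indicator (ball c (5 * \<rho>)) y)"

lemma ball_kernel_measurable [measurable]:
  "(\<lambda>(x, y). ball_kernel \<gamma> c \<rho> R x y) \<in> borel_measurable (borel \<Otimes>\<^sub>M borel)"
  unfolding ball_kernel_def by measurable

text \<open>Tonelli reduces the second summand of the kernel to the action of the adjoint kernel on the
  weight, where the \<open>A\<^sub>1\<close> condition applies pointwise.\<close>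

lemma ball_kernel_integral_le:
  fixes w :: "'a :: euclidean_space \<Rightarrow> ennreal"
  assumes w: "A1_weight A w" and A: "0 \<le> A" and \<gamma>: "0 < \<gamma>" and R: "0 < R"
  shows "(\<integral>\<^sup>+x. (\<integral>\<^sup>+y. ball_kernel \<gamma> c \<rho> R x y \<partial>lborel) * w x \<partial>lborel)
    \<le> ennreal (kernel_const DIM('a) \<gamma> * (5 * R) powr \<gamma> * (1 + A)) * (\<integral>\<^sup>+x. indicator (ball c (5 * \<rho>)) x * w x \<partial>lborel)"
proof -
  have [measurable]: "w \<in> borel_measurable borel" using w by (simp add: A1_weight_def)
  let ?B = "ball c (5 * \<rho>)"
  define L where "L = kernel_const DIM('a) \<gamma> * (5 * R) powr \<gamma>"
  have L: "0 \<le> L" using kernel_const_pos[OF \<gamma>, of "DIM('a)"] by (simp add: L_def)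
  define k :: "'a \<Rightarrow> 'a \<Rightarrow> ennreal" where
    "k x y = ennreal (norm (x - y) powr (\<gamma> - real DIM('a))) * (if dist x y < 5 * R then 1 else 0)" for x y
  have [measurable]: "(\<lambda>(x, y). k x y) \<in> borel_measurable (borel \<Otimes>\<^sub>M borel)"
    unfolding k_def by measurable
  have k1: "k x y = ennreal (norm (x - y) powr (\<gamma> - real DIM('a))) * indicator (ball y (5 * R)) x" for x y
    by (simp add: k_def indicator_def dist_commute)
  have sym: "k x y = k y x" for x y by (simp add: k_def norm_minus_commute dist_commute)
  have bk: "ball_kernel \<gamma> c \<rho> R x y = k x y * indicator ?B x + k x y * indicator ?B y" for x y
    by (simp add: ball_kernel_def k_def distrib_left)
  have k_int: "(\<integral>\<^sup>+y. k x y \<partial>lborel) \<le> ennreal L" for x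
    unfolding sym[of x] unfolding k1 L_def using R by (intro kernel_integral_ball_le \<gamma>) auto
  have "(\<integral>\<^sup>+x. (\<integral>\<^sup>+y. ball_kernel \<gamma> c \<rho> R x y \<partial>lborel) * w x \<partial>lborel)
    = (\<integral>\<^sup>+x. (\<integral>\<^sup>+y. k x y \<partial>lborel) * indicator ?B x * w x + (\<integral>\<^sup>+y. k x y * indicator ?B y * w x \<partial>lborel) \<partial>lborel)"
    unfolding bk by (simp add: nn_integral_add nn_integral_multc distrib_right)
  also have "\<dots> = (\<integral>\<^sup>+x. (\<integral>\<^sup>+y. k x y \<partial>lborel) * indicator ?B x * w x \<partial>lborel)
      + (\<integral>\<^sup>+x. \<integral>\<^sup>+y. k x y * indicator ?B y * w x \<partial>lborel \<partial>lborel)"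
    by (rule nn_integral_add) measurable
  also have "(\<integral>\<^sup>+x. \<integral>\<^sup>+y. k x y * indicator ?B y * w x \<partial>lborel \<partial>lborel)
    = (\<integral>\<^sup>+y. \<integral>\<^sup>+x. k x y * indicator ?B y * w x \<partial>lborel \<partial>lborel)"
    by (rule lborel_pair.Fubini') measurable
  also have "(\<integral>\<^sup>+y. \<integral>\<^sup>+x. k x y * indicator ?B y * w x \<partial>lborel \<partial>lborel)
    \<le> (\<integral>\<^sup>+y. ennreal (L * A) * (indicator ?B y * w y) \<partial>lborel)"
  proof (rule nn_integral_mono_AE)
    from w have "AE z in lborel. \<forall>c r. 0 < r \<longrightarrow> z \<in> ball c r \<longrightarrow>
      (\<integral>\<^sup>+x. indicator (ball c r) x * w x \<partial>lborel) \<le> ennreal A * w z * emeasure lborel (ball c r)"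
      by (simp add: A1_weight_def)
    then show "AE y in lborel. (\<integral>\<^sup>+x. k x y * indicator ?B y * w x \<partial>lborel) \<le> ennreal (L * A) * (indicator ?B y * w y)"
    proof eventually_elim
      case (elim y)
      have "(\<integral>\<^sup>+x. k x y * w x \<partial>lborel) \<le> ennreal L * (ennreal A * w y)"
        unfolding k1 L_def using elim R by (intro kernel_integral_le \<gamma>) (auto simp: centre_in_ball)
      then have "(\<integral>\<^sup>+x. k x y * w x \<partial>lborel) \<le> ennreal (L * A) * w y"
        using L A by (simp add: ennreal_mult' mult.assoc)
      then show ?case by (simp add: indicator_def)
    qed
  qed
  also have "\<dots> = ennreal (L * A) * (\<integral>\<^sup>+x. indicator ?B x * w x \<partial>lborel)"
    by (rule nn_integral_cmult) measurable
  also have "(\<integral>\<^sup>+x. (\<integral>\<^sup>+y. k x y \<partial>lborel) * indicator ?B x * w x \<partial>lborel)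
    \<le> (\<integral>\<^sup>+x. ennreal L * (indicator ?B x * w x) \<partial>lborel)"
    unfolding mult.assoc by (intro nn_integral_mono mult_right_mono k_int) auto
  also have "\<dots> = ennreal L * (\<integral>\<^sup>+x. indicator ?B x * w x \<partial>lborel)"
    by (rule nn_integral_cmult) measurable
  also have "ennreal L * (\<integral>\<^sup>+x. indicator ?B x * w x \<partial>lborel) + ennreal (L * A) * (\<integral>\<^sup>+x. indicator ?B x * w x \<partial>lborel)
     = ennreal (L * (1 + A)) * (\<integral>\<^sup>+x. indicator ?B x * w x \<partial>lborel)"
    using L A by (simp add: distrib_left flip: distrib_right)
  finally show ?thesis by (simp add: L_def add_right_mono)
qed

text \<open>One summand for each term of the linear bound on the power: the kernel of range
  \<open>5 * R\<close> over the ball of radius \<open>5 * \<rho>\<close>, and the support ball of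
  radius \<open>10 * R\<close>, whose volume ratio \<open>(10 * 2 ^ j) ^ n\<close> keeps only
  \<open>10 ^ n\<close> here.\<close>

definition cov_const :: "nat \<Rightarrow> real \<Rightarrow> real" where
  "cov_const n \<gamma> = kernel_const n \<gamma> * 5 powr \<gamma> * 5 ^ n + 10 ^ n"

lemma cov_const_pos: "0 < \<gamma> \<Longrightarrow> 0 < cov_const n \<gamma>"
  using kernel_const_pos[of \<gamma> n] by (auto simp: cov_const_def intro!: add_pos_pos)

lemma ennreal_lincomb:
  assumes "0 \<le> k" "0 \<le> l" "0 \<le> a" "0 \<le> m" "0 \<le> b"
  shows "ennreal k * (ennreal l * (ennreal a * I)) + ennreal m * (ennreal b * I) = ennreal (k * (l * a) + m * b) * I"
  using assms by (simp add: ennreal_mult distrib_right mult.assoc)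

text \<open>Concavity of the power \<open>p / q\<close> enters through the linear bound \<open>enn_powr_le_linear\<close>; the level
  \<open>\<kappa>\<close> equalises the two resulting terms, and this is what produces the factor
  \<open>2\<^bsup>j n (1 - p / q)\<^esup>\<close> that the hypothesis \<open>n (1 / p - 1 / q) < 1\<close> has to absorb.\<close>

lemma ball_kernel_powr_integral_le:
  fixes w :: "'a :: euclidean_space \<Rightarrow> ennreal" and g :: "'a \<Rightarrow> real"
  assumes w: "A1_weight A w" and A: "0 \<le> A" and \<gamma>: "0 < \<gamma>" and p: "1 \<le> p" and q: "p \<le> q" and R: "0 < R"
    and [measurable]: "g \<in> borel_measurable borel" and g: "\<And>x. 0 \<le> g x"
    and \<rho>: "\<rho> = R / 2 ^ j" and a: "0 < a"
    and avg: "ennreal (a * R powr (\<gamma> / q)) * emeasure lborel (ball c \<rho>) \<le> (\<integral>\<^sup>+x. indicator (ball c \<rho>) x * ennreal (g x) \<partial>lborel)"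
  shows "(\<integral>\<^sup>+x. enn_powr (\<integral>\<^sup>+y. ball_kernel \<gamma> c \<rho> R x y \<partial>lborel) (p / q) * w x \<partial>lborel)
    \<le> ennreal ((2 / a) powr p * 2 powr (real (j * DIM('a)) * (1 - p / q)) * cov_const DIM('a) \<gamma> * (1 + A)\<^sup>2)
      * (\<integral>\<^sup>+x. indicator (ball c \<rho>) x * (ennreal (g x powr p) * w x) \<partial>lborel)"
proof -
  let ?n = "DIM('a)"
  have [measurable]: "w \<in> borel_measurable borel" using w by (simp add: A1_weight_def)
  define \<theta> where "\<theta> = p / q"
  have \<theta>: "0 < \<theta>" "\<theta> \<le> 1" using p q by (auto simp: \<theta>_def)
  define N where "N = (2::real) powr (real (j * ?n))"
  have N: "0 < N" "N = (2 ^ j) ^ ?n"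
    using powr_realpow[of 2 "j * ?n"] by (simp_all add: N_def power_mult del: of_nat_mult)
  \<comment> \<open>Since \<open>N\<close> is the volume ratio of the balls of radii
    \<open>R\<close> and \<open>\<rho>\<close>, this is the order of the unweighted mean of
    \<open>h\<close> over a ball of radius comparable to \<open>R\<close>.\<close>
  define \<kappa> where "\<kappa> = R powr \<gamma> / N"
  have \<kappa>: "0 < \<kappa>" using R N by (simp add: \<kappa>_def)
  define h where "h x = (\<integral>\<^sup>+y. ball_kernel \<gamma> c \<rho> R x y \<partial>lborel)" for x
  have [measurable]: "h \<in> borel_measurable borel" unfolding h_def by measurable
  define T where "T = a * R powr (\<gamma> / q)"
  have T: "0 < T" using a R by (simp add: T_def)
  define I where "I = (\<integral>\<^sup>+x. indicator (ball c \<rho>) x * (ennreal (g x powr p) * w x) \<partial>lborel)"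
  have \<rho>0: "0 < \<rho>" using R by (simp add: \<rho>)
  have wle: "(\<integral>\<^sup>+x. indicator (ball c (s * \<rho>)) x * w x \<partial>lborel) \<le> ennreal (2 powr p * s ^ ?n * A / T powr p) * I"
    if "1 \<le> s" for s
    unfolding I_def by (rule A1_weight_ball_le[OF w A _ g p T \<rho>0 that]) (use avg in \<open>auto simp: T_def\<close>)
  \<comment> \<open>A nonzero kernel puts \<open>x\<close> within \<open>5 * \<rho>\<close> of
    \<open>c\<close>, or puts \<open>y\<close> there with \<open>x\<close> at distance below
    \<open>5 * R\<close>; as \<open>\<rho> \<le> R\<close>, radius \<open>10 * R\<close> suffices.
    This localises the constant term of the linear bound, which otherwise would be integrated over
    the whole space.\<close>
  have supp: "h x = 0" if "x \<notin> ball c (10 * R)" for x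
  proof -
    have "\<rho> \<le> R" using R by (simp add: \<rho> divide_le_eq_1 field_simps)
    then have "ball_kernel \<gamma> c \<rho> R x y = 0" for y
      using that dist_triangle[of c x y] \<rho>0 by (auto simp: ball_kernel_def indicator_def dist_commute)
    then show ?thesis by (simp add: h_def)
  qed
  have "(\<integral>\<^sup>+x. enn_powr (h x) \<theta> * w x \<partial>lborel)
    \<le> (\<integral>\<^sup>+x. ennreal (\<kappa> powr (\<theta> - 1)) * (h x * w x) + ennreal (\<kappa> powr \<theta>) * (indicator (ball c (10 * R)) x * w x) \<partial>lborel)"
  proof (rule nn_integral_mono)
    fix x
    have "enn_powr (h x) \<theta> \<le> ennreal (\<kappa> powr (\<theta> - 1)) * h x + ennreal (\<kappa> powr \<theta>) * indicator (ball c (10 * R)) x"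
      using enn_powr_le_linear[OF \<theta> \<kappa>, of "h x"] supp[of x] by (cases "x \<in> ball c (10 * R)") auto
    then have "enn_powr (h x) \<theta> * w x \<le> (ennreal (\<kappa> powr (\<theta> - 1)) * h x + ennreal (\<kappa> powr \<theta>) * indicator (ball c (10 * R)) x) * w x"
      by (rule mult_right_mono) simp
    then show "enn_powr (h x) \<theta> * w x
      \<le> ennreal (\<kappa> powr (\<theta> - 1)) * (h x * w x) + ennreal (\<kappa> powr \<theta>) * (indicator (ball c (10 * R)) x * w x)"
      by (simp add: distrib_right mult.assoc)
  qed
  also have "\<dots> = ennreal (\<kappa> powr (\<theta> - 1)) * (\<integral>\<^sup>+x. h x * w x \<partial>lborel)
     + ennreal (\<kappa> powr \<theta>) * (\<integral>\<^sup>+x. indicator (ball c (10 * R)) x * w x \<partial>lborel)"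
    by (simp add: nn_integral_add nn_integral_cmult)
  also have "\<dots> \<le> ennreal (\<kappa> powr (\<theta> - 1)) * (ennreal (kernel_const ?n \<gamma> * (5 * R) powr \<gamma> * (1 + A)) * (ennreal (2 powr p * 5 ^ ?n * A / T powr p) * I))
     + ennreal (\<kappa> powr \<theta>) * (ennreal (2 powr p * (10 * 2 ^ j) ^ ?n * A / T powr p) * I)"
  proof (intro add_mono mult_left_mono)
    have "(\<integral>\<^sup>+x. h x * w x \<partial>lborel) \<le> ennreal (kernel_const ?n \<gamma> * (5 * R) powr \<gamma> * (1 + A)) * (\<integral>\<^sup>+x. indicator (ball c (5 * \<rho>)) x * w x \<partial>lborel)"
      unfolding h_def by (rule ball_kernel_integral_le[OF w A \<gamma> R])
    also have "\<dots> \<le> ennreal (kernel_const ?n \<gamma> * (5 * R) powr \<gamma> * (1 + A)) * (ennreal (2 powr p * 5 ^ ?n * A / T powr p) * I)"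
      by (intro mult_left_mono wle) auto
    finally show "(\<integral>\<^sup>+x. h x * w x \<partial>lborel) \<le> \<dots>" .
    have "10 * R = (10 * 2 ^ j) * \<rho>" by (simp add: \<rho>)
    moreover have "1 \<le> 10 * (2::real) ^ j" using one_le_power[of "2::real" j] by linarith
    ultimately show "(\<integral>\<^sup>+x. indicator (ball c (10 * R)) x * w x \<partial>lborel) \<le> ennreal (2 powr p * (10 * 2 ^ j) ^ ?n * A / T powr p) * I"
      using wle[of "10 * 2 ^ j"] by (simp only:)
  qed auto
  also have "\<dots> = ennreal (\<kappa> powr (\<theta> - 1) * (kernel_const ?n \<gamma> * (5 * R) powr \<gamma> * (1 + A) * (2 powr p * 5 ^ ?n * A / T powr p))
     + \<kappa> powr \<theta> * (2 powr p * (10 * 2 ^ j) ^ ?n * A / T powr p)) * I"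
    using A kernel_const_pos[OF \<gamma>, of ?n] by (intro ennreal_lincomb) auto
  also have "\<dots> \<le> ennreal ((2 / a) powr p * N powr (1 - \<theta>) * cov_const ?n \<gamma> * (1 + A)\<^sup>2) * I"
  proof (intro mult_right_mono ennreal_leI)
    have q0: "0 < q" using p q by simp
    have "T powr p = a powr p * R powr (\<gamma> * \<theta>)"
      using a R q0 by (simp add: T_def powr_mult powr_powr \<theta>_def)
    then have Tp: "2 powr p / T powr p = (2 / a) powr p / R powr (\<gamma> * \<theta>)"
      using a by (simp add: powr_divide)
    have k1: "\<kappa> powr (\<theta> - 1) * R powr \<gamma> = R powr (\<gamma> * \<theta>) * N powr (1 - \<theta>)"
      using R N by (simp add: \<kappa>_def powr_divide powr_powr powr_diff algebra_simps)
    have k2: "\<kappa> powr \<theta> * N = R powr (\<gamma> * \<theta>) * N powr (1 - \<theta>)"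
      using R N by (simp add: \<kappa>_def powr_divide powr_powr powr_diff algebra_simps)
    have RR: "0 < R powr (\<gamma> * \<theta>)" using R by simp
    have "\<kappa> powr (\<theta> - 1) * (kernel_const ?n \<gamma> * (5 * R) powr \<gamma> * (1 + A) * (2 powr p * 5 ^ ?n * A / T powr p))
     + \<kappa> powr \<theta> * (2 powr p * (10 * 2 ^ j) ^ ?n * A / T powr p)
     = (2 powr p / T powr p) * ((\<kappa> powr (\<theta> - 1) * R powr \<gamma>) * (kernel_const ?n \<gamma> * 5 powr \<gamma> * 5 ^ ?n * ((1 + A) * A)) + (\<kappa> powr \<theta> * N) * (10 ^ ?n * A))"
      using R by (simp add: powr_mult power_mult_distrib N(2) algebra_simps add_divide_distrib)
    also have "\<dots> = (2 / a) powr p * N powr (1 - \<theta>) * (kernel_const ?n \<gamma> * 5 powr \<gamma> * 5 ^ ?n * ((1 + A) * A) + 10 ^ ?n * A)"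
      unfolding Tp k1 k2 using RR by (simp add: field_simps)
    also have "\<dots> \<le> (2 / a) powr p * N powr (1 - \<theta>) * (kernel_const ?n \<gamma> * 5 powr \<gamma> * 5 ^ ?n * (1 + A)\<^sup>2 + 10 ^ ?n * (1 + A)\<^sup>2)"
      using A kernel_const_pos[OF \<gamma>, of ?n]
      by (intro mult_left_mono add_mono) (auto simp: power2_eq_square algebra_simps)
    finally show "\<kappa> powr (\<theta> - 1) * (kernel_const ?n \<gamma> * (5 * R) powr \<gamma> * (1 + A) * (2 powr p * 5 ^ ?n * A / T powr p))
     + \<kappa> powr \<theta> * (2 powr p * (10 * 2 ^ j) ^ ?n * A / T powr p) \<le> (2 / a) powr p * N powr (1 - \<theta>) * cov_const ?n \<gamma> * (1 + A)\<^sup>2"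
      by (simp add: cov_const_def algebra_simps)
  qed auto
  finally show ?thesis
    by (simp add: h_def I_def \<theta>_def N_def powr_powr)
qed

section \<open>The covering argument\<close>

text \<open>Here \<open>r\<close> is the distance of a pair, and the average is taken over the ball
  shrunk by \<open>2 ^ j\<close>; \<open>\<beta>\<close> stands for
  \<open>\<gamma> / q\<close>.\<close>

definition large_avg :: "('a::euclidean_space \<Rightarrow> real) \<Rightarrow> real \<Rightarrow> real \<Rightarrow> nat \<Rightarrow> 'a \<Rightarrow> real \<Rightarrow> bool" where
  "large_avg g a \<beta> j c r \<longleftrightarrow> ennreal (a * r powr \<beta>) * emeasure lborel (ball c (r / 2 ^ j))
     < (\<integral>\<^sup>+u. indicator (ball c (r / 2 ^ j)) u * ennreal (g u) \<partial>lborel)"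

definition large_pair :: "('a::euclidean_space \<Rightarrow> real) \<Rightarrow> real \<Rightarrow> real \<Rightarrow> nat \<Rightarrow> 'a \<Rightarrow> 'a \<Rightarrow> bool" where
  "large_pair g a \<beta> j x y \<longleftrightarrow> x \<noteq> y \<and>
     (large_avg g a \<beta> j x (norm (x - y)) \<or> large_avg g a \<beta> j y (norm (x - y)))"

text \<open>No average of \<open>g\<close> exceeds \<open>G\<close>, so
  \<open>a * r powr \<beta> \<le> G\<close>. This gives the uniform bound on radii for the covering
  lemma.\<close>

lemma large_avg_bounded:
  assumes "large_avg g a \<beta> j c r" "0 < r" "0 < a" "0 < \<beta>" and G: "\<And>x. g x \<le> G" "0 \<le> G"
  shows "r \<le> (G / a) powr (1 / \<beta>)"
proof -
  let ?B = "ball c (r / 2 ^ j)"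
  have "(\<integral>\<^sup>+u. indicator ?B u * ennreal (g u) \<partial>lborel) \<le> (\<integral>\<^sup>+u. ennreal G * indicator ?B u \<partial>lborel)"
    using G by (intro nn_integral_mono) (auto simp: indicator_def intro!: ennreal_leI)
  also have "\<dots> = ennreal G * emeasure lborel ?B"
    by (rule nn_integral_cmult_indicator) simp
  finally have "ennreal (a * r powr \<beta>) * emeasure lborel ?B < ennreal G * emeasure lborel ?B"
    using assms(1) unfolding large_avg_def by (rule less_le_trans[rotated])
  then have "\<not> ennreal G \<le> ennreal (a * r powr \<beta>)"
    by (meson mult_right_mono not_le zero_le)
  then have "a * r powr \<beta> \<le> G"
    by (metis ennreal_leI linorder_linear)
  then have "r powr \<beta> \<le> G / a" using assms by (simp add: field_simps)
  then have "(r powr \<beta>) powr (1 / \<beta>) \<le> (G / a) powr (1 / \<beta>)"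
    using assms by (intro powr_mono2) auto
  then show ?thesis using \<open>0 < r\<close> \<open>0 < \<beta>\<close> by (simp add: powr_powr)
qed

lemma weighted_covering_estimate:
  fixes w :: "'a :: euclidean_space \<Rightarrow> ennreal" and g :: "'a \<Rightarrow> real"
  assumes w: "A1_weight A w" and A: "0 \<le> A" and \<gamma>: "0 < \<gamma>" and p: "1 \<le> p" and q: "p \<le> q"
    and [measurable]: "g \<in> borel_measurable borel" and g: "\<And>x. 0 \<le> g x" "\<And>x. g x \<le> G"
    and a: "0 < a"
  shows "(\<integral>\<^sup>+x. enn_powr (\<integral>\<^sup>+y. (if large_pair g a (\<gamma> / q) j x y then 1 else 0) * ennreal (norm (x - y) powr (\<gamma> - real DIM('a))) \<partial>lborel) (p / q) * w x \<partial>lborel)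
    \<le> ennreal ((2 / a) powr p * 2 powr (real (j * DIM('a)) * (1 - p / q)) * cov_const DIM('a) \<gamma> * (1 + A)\<^sup>2)
      * (\<integral>\<^sup>+x. ennreal (g x powr p) * w x \<partial>lborel)"
proof -
  have [measurable]: "w \<in> borel_measurable borel" using w by (simp add: A1_weight_def)
  have q0: "0 < q" using p q by simp
  define \<beta> where "\<beta> = \<gamma> / q"
  have \<beta>: "0 < \<beta>" using \<gamma> q0 by (simp add: \<beta>_def)
  define Cst where "Cst = ennreal ((2 / a) powr p * 2 powr (real (j * DIM('a)) * (1 - p / q)) * cov_const DIM('a) \<gamma> * (1 + A)\<^sup>2)"
  define K where "K = {(c, r). 0 < r \<and> large_avg g a \<beta> j c r}"
  define rad where "rad = (\<lambda>i::'a \<times> real. snd i / 2 ^ j)"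
  have G0: "0 \<le> G" using g[of undefined] by linarith
  have bdd: "0 < rad i \<and> rad i \<le> (G / a) powr (1 / \<beta>)" if "i \<in> K" for i
  proof -
    have "0 < snd i" "large_avg g a \<beta> j (fst i) (snd i)" using that by (auto simp: K_def)
    moreover from large_avg_bounded[OF this(2,1) a \<beta> g(2) G0]
    have "snd i \<le> (G / a) powr (1 / \<beta>)" .
    moreover have "snd i / 2 ^ j \<le> snd i" using \<open>0 < snd i\<close> by (simp add: divide_le_eq)
    ultimately show ?thesis by (simp add: rad_def)
  qed
  obtain C where C: "countable C" "C \<subseteq> K"
    and disj: "pairwise (\<lambda>i k. disjnt (cball (fst i) (rad i)) (cball (fst k) (rad k))) C"
    and cov: "\<And>i. i \<in> K \<Longrightarrow> \<exists>k. k \<in> C \<and> \<not> disjnt (cball (fst i) (rad i)) (cball (fst k) (rad k)) \<and>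
        cball (fst i) (rad i) \<subseteq> ball (fst k) (5 * rad k)"
    by (rule Vitali_covering_lemma_cballs_balls[of K rad "(G / a) powr (1 / \<beta>)" fst, OF bdd]) (blast intro: that)+
  \<comment> \<open>The selected family may be finite. It is enumerated along \<open>Ix\<close>, and
    kernels and balls are set to 0 and to the empty set off \<open>Ix\<close>, so that all sums run
    over the naturals.\<close>
  define e where "e = from_nat_into C"
  define Ix where "Ix = to_nat_on C ` C"
  have e_C: "e m \<in> C" if "m \<in> Ix" for m
    using that C by (auto simp: e_def Ix_def)
  have e_inj: "e m \<noteq> e k" if "m \<in> Ix" "k \<in> Ix" "m \<noteq> k" for m k
    using that C by (auto simp: e_def Ix_def)
  have e_surj: "\<exists>m\<in>Ix. e m = i" if "i \<in> C" for i
    using that C by (auto simp: e_def Ix_def)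
  define kk where "kk m x y = (if m \<in> Ix then ball_kernel \<gamma> (fst (e m)) (rad (e m)) (snd (e m)) x y else 0)" for m x y
  have kk_meas [measurable]: "(\<lambda>(x, y). kk m x y) \<in> borel_measurable (borel \<Otimes>\<^sub>M borel)" for m
    by (cases "m \<in> Ix") (simp_all add: kk_def)
  define Bs where "Bs m = (if m \<in> Ix then ball (fst (e m)) (rad (e m)) else {})" for m
  have Bs_meas [measurable]: "Bs m \<in> sets borel" for m by (simp add: Bs_def)
  have Bs_disj: "disjoint_family Bs"
    unfolding disjoint_family_on_def
  proof (intro ballI impI)
    fix m k :: nat assume "m \<noteq> k"
    show "Bs m \<inter> Bs k = {}"
    proof (cases "m \<in> Ix \<and> k \<in> Ix")
      case True
      then have "disjnt (cball (fst (e m)) (rad (e m))) (cball (fst (e k)) (rad (e k)))"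
        using pairwiseD[OF disj] e_C e_inj \<open>m \<noteq> k\<close> by blast
      moreover have "Bs m \<subseteq> cball (fst (e m)) (rad (e m))" "Bs k \<subseteq> cball (fst (e k)) (rad (e k))"
        using True by (simp_all add: Bs_def ball_subset_cball)
      ultimately show ?thesis unfolding disjnt_def by blast
    qed (auto simp: Bs_def)
  qed
  \<comment> \<open>The ball about the endpoint \<open>c\<close> lies in the enlargement of a
    selected ball. Comparing centre distance and radii gives both properties encoded in
    \<open>ball_kernel\<close>: \<open>c\<close> is in the enlargement, and, after cancelling
    \<open>2 ^ j\<close>, the distance of the pair is below \<open>5 * snd k\<close>.\<close>
  have pw: "(if large_pair g a \<beta> j x y then 1 else 0) * ennreal (norm (x - y) powr (\<gamma> - real DIM('a))) \<le> (\<Sum>m. kk m x y)" for x y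
  proof (cases "large_pair g a \<beta> j x y")
    case True
    then obtain c where c: "c \<in> {x, y}" "large_avg g a \<beta> j c (norm (x - y))" "x \<noteq> y"
      by (auto simp: large_pair_def)
    then have "(c, norm (x - y)) \<in> K" by (simp add: K_def)
    from cov[OF this] obtain k where k: "k \<in> C" "cball c (norm (x - y) / 2 ^ j) \<subseteq> ball (fst k) (5 * rad k)"
      by (auto simp: rad_def)
    then obtain m where m: "m \<in> Ix" "e m = k" using e_surj by blast
    have nn: "0 \<le> norm (x - y) / 2 ^ j" by simp
    have le: "dist c (fst k) + norm (x - y) / 2 ^ j < 5 * rad k"
      using k(2) nn unfolding cball_subset_ball_iff by linarith
    then have "norm (x - y) / 2 ^ j < 5 * snd k / 2 ^ j"
      using zero_le_dist[of c "fst k"] unfolding rad_def by linarith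
    then have 1: "norm (x - y) < 5 * snd k" by (simp add: divide_less_cancel)
    have 2: "c \<in> ball (fst k) (5 * rad k)"
      unfolding mem_ball dist_commute[of _ c] using le nn by linarith
    have "1 \<le> indicator (ball (fst k) (5 * rad k)) x + (indicator (ball (fst k) (5 * rad k)) y :: ennreal)"
      using 2 c(1) by (auto simp: indicator_def)
    then have "ennreal (norm (x - y) powr (\<gamma> - real DIM('a))) * 1 \<le> kk m x y"
      unfolding kk_def ball_kernel_def using 1 m by (simp add: dist_norm mult_left_mono del: mult_1_right)
        (metis mult.right_neutral mult_left_mono zero_le)
    also have "\<dots> = (\<Sum>m\<in>{m}. kk m x y)" by simp
    also have "\<dots> \<le> (\<Sum>m. kk m x y)" by (rule sum_le_suminf) auto
    finally show ?thesis using True by simp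
  qed simp
  have \<theta>: "0 < p / q" "p / q \<le> 1" using p q by auto
  have "(\<integral>\<^sup>+x. enn_powr (\<integral>\<^sup>+y. (if large_pair g a \<beta> j x y then 1 else 0) * ennreal (norm (x - y) powr (\<gamma> - real DIM('a))) \<partial>lborel) (p / q) * w x \<partial>lborel)
    \<le> (\<integral>\<^sup>+x. (\<Sum>m. enn_powr (\<integral>\<^sup>+y. kk m x y \<partial>lborel) (p / q) * w x) \<partial>lborel)"
  proof (rule nn_integral_mono)
    fix x
    have "enn_powr (\<integral>\<^sup>+y. (if large_pair g a \<beta> j x y then 1 else 0) * ennreal (norm (x - y) powr (\<gamma> - real DIM('a))) \<partial>lborel) (p / q)
      \<le> enn_powr (\<integral>\<^sup>+y. (\<Sum>m. kk m x y) \<partial>lborel) (p / q)"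
      using \<theta> by (intro enn_powr_mono nn_integral_mono pw) auto
    also have "\<dots> = enn_powr (\<Sum>m. \<integral>\<^sup>+y. kk m x y \<partial>lborel) (p / q)"
      by (subst nn_integral_suminf) auto
    also have "\<dots> \<le> (\<Sum>m. enn_powr (\<integral>\<^sup>+y. kk m x y \<partial>lborel) (p / q))"
      by (rule enn_powr_suminf_le[OF \<theta>])
    finally show "enn_powr (\<integral>\<^sup>+y. (if large_pair g a \<beta> j x y then 1 else 0) * ennreal (norm (x - y) powr (\<gamma> - real DIM('a))) \<partial>lborel) (p / q) * w x
      \<le> (\<Sum>m. enn_powr (\<integral>\<^sup>+y. kk m x y \<partial>lborel) (p / q) * w x)"
      unfolding ennreal_suminf_multc by (rule mult_right_mono) simp
  qed
  also have "\<dots> = (\<Sum>m. \<integral>\<^sup>+x. enn_powr (\<integral>\<^sup>+y. kk m x y \<partial>lborel) (p / q) * w x \<partial>lborel)"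
    by (rule nn_integral_suminf) measurable
  also have "\<dots> \<le> (\<Sum>m. Cst * (\<integral>\<^sup>+x. indicator (Bs m) x * (ennreal (g x powr p) * w x) \<partial>lborel))"
  proof (rule suminf_le)
    fix m
    show "(\<integral>\<^sup>+x. enn_powr (\<integral>\<^sup>+y. kk m x y \<partial>lborel) (p / q) * w x \<partial>lborel)
      \<le> Cst * (\<integral>\<^sup>+x. indicator (Bs m) x * (ennreal (g x powr p) * w x) \<partial>lborel)"
    proof (cases "m \<in> Ix")
      case True
      then have "e m \<in> K" using e_C C by blast
      then have e: "0 < snd (e m)" "large_avg g a (\<gamma> / q) j (fst (e m)) (snd (e m))"
        by (auto simp: K_def \<beta>_def)
      have "(\<integral>\<^sup>+x. enn_powr (\<integral>\<^sup>+y. ball_kernel \<gamma> (fst (e m)) (rad (e m)) (snd (e m)) x y \<partial>lborel) (p / q) * w x \<partial>lborel)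
        \<le> Cst * (\<integral>\<^sup>+x. indicator (ball (fst (e m)) (rad (e m))) x * (ennreal (g x powr p) * w x) \<partial>lborel)"
        unfolding Cst_def
        by (rule ball_kernel_powr_integral_le[OF w A \<gamma> p q e(1) _ g(1) _ a])
          (use e(2) in \<open>auto simp: rad_def large_avg_def\<close>)
      then show ?thesis using True by (simp add: kk_def Bs_def)
    qed (simp add: kk_def)
  qed auto
  also have "\<dots> = Cst * (\<Sum>m. \<integral>\<^sup>+x. indicator (Bs m) x * (ennreal (g x powr p) * w x) \<partial>lborel)"
    by (rule ennreal_suminf_cmult)
  also have "(\<Sum>m. \<integral>\<^sup>+x. indicator (Bs m) x * (ennreal (g x powr p) * w x) \<partial>lborel)
    = (\<integral>\<^sup>+x. (\<Sum>m. indicator (Bs m) x * (ennreal (g x powr p) * w x)) \<partial>lborel)"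
    by (rule nn_integral_suminf[symmetric]) measurable
  also have "\<dots> \<le> (\<integral>\<^sup>+x. ennreal (g x powr p) * w x \<partial>lborel)"
  proof (rule nn_integral_mono)
    fix x
    have "(\<Sum>m. indicator (Bs m) x * (ennreal (g x powr p) * w x)) = indicator (\<Union>m. Bs m) x * (ennreal (g x powr p) * w x)"
      unfolding ennreal_suminf_multc by (simp add: suminf_indicator[OF Bs_disj])
    also have "\<dots> \<le> ennreal (g x powr p) * w x" by (simp add: indicator_def)
    finally show "(\<Sum>m. indicator (Bs m) x * (ennreal (g x powr p) * w x)) \<le> ennreal (g x powr p) * w x" .
  qed
  finally show ?thesis by (simp add: \<beta>_def Cst_def mult_left_mono)
qed

section \<open>The weighted estimate\<close>

text \<open>With the moving ball written as a condition on \<open>dist\<close> and its volume as a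
  power of the radius, the average is a parametrised integral of a jointly measurable
  integrand.\<close>

lemma large_pair_measurable [measurable]:
  fixes g :: "'a :: euclidean_space \<Rightarrow> real"
  assumes [measurable]: "g \<in> borel_measurable borel"
  shows "Measurable.pred (borel \<Otimes>\<^sub>M borel) (\<lambda>(x, y). large_pair g a \<beta> j x y)"
proof -
  have large_avg: "large_avg g a \<beta> j c (norm z) \<longleftrightarrow>
     ennreal (a * norm z powr \<beta>) * ennreal (unit_ball_vol (real DIM('a)) * (norm z / 2 ^ j) ^ DIM('a))
     < (\<integral>\<^sup>+u. (if dist c u < norm z / 2 ^ j then 1 else 0) * ennreal (g u) \<partial>lborel)" for c z
    by (simp add: large_avg_def emeasure_ball indicator_def of_bool_def)
  show ?thesis unfolding large_pair_def large_avg by measurable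
qed

lemma Eset_borel [measurable]:
  fixes f :: "'a :: euclidean_space \<Rightarrow> real"
  assumes [measurable]: "f \<in> borel_measurable borel"
  shows "Eset lam \<beta> f \<in> sets (borel \<Otimes>\<^sub>M borel)"
proof -
  have "Eset lam \<beta> f = {z \<in> space (borel \<Otimes>\<^sub>M borel). fst z \<noteq> snd z \<and>
      lam < \<bar>f (fst z) - f (snd z)\<bar> / (norm (fst z - snd z) powr (1 + \<beta>))}"
    by (auto simp: Eset_def space_pair_measure)
  also have "\<dots> \<in> sets (borel \<Otimes>\<^sub>M borel)" by measurable
  finally show ?thesis .
qed

definition osc_const :: "nat \<Rightarrow> real \<Rightarrow> real" where
  "osc_const n \<delta> = 2 * 2 ^ n * pw_const n \<delta>"

lemma osc_const_pos: "0 < \<delta> \<Longrightarrow> 0 < osc_const n \<delta>"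
  by (simp add: osc_const_def pw_const_pos)

text \<open>By contraposition: if no scale is large, the oscillation bound applies at both endpoints
  with \<open>a = lam * r powr \<beta> / osc_const n \<delta>\<close>. The division by
  \<open>osc_const\<close> makes the outcome exactly \<open>lam * r powr (1 + \<beta>)\<close>,
  contradicting membership in \<open>Eset\<close>.\<close>

lemma Eset_imp_large_pair:
  fixes f :: "'a :: euclidean_space \<Rightarrow> real"
  assumes der: "\<And>x. (f has_derivative (\<lambda>h. f' x \<bullet> h)) (at x)" and cont: "continuous_on UNIV f'"
    and \<delta>: "0 < \<delta>" "\<delta> < 1" and lam: "0 < lam" and xy: "(x, y) \<in> Eset lam \<beta> f"
  shows "\<exists>j. large_pair (\<lambda>x. norm (f' x)) (lam * 2 powr (real j * (1 - \<delta>)) / osc_const DIM('a) \<delta>) \<beta> j x y"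
proof (rule ccontr)
  let ?P = "osc_const DIM('a) \<delta>" and ?r = "norm (x - y)"
  assume neg: "\<not> ?thesis"
  have P: "0 < ?P" by (rule osc_const_pos[OF \<delta>(1)])
  have "x \<noteq> y" and gt: "lam < \<bar>f x - f y\<bar> / ?r powr (1 + \<beta>)"
    using xy by (auto simp: Eset_def)
  then have r: "0 < ?r" by simp
  have "\<bar>f x - f y\<bar> \<le> 2 * 2 ^ DIM('a) * pw_const DIM('a) \<delta> * (lam * ?r powr \<beta> / ?P) * ?r"
  proof (rule C1_diff_le_of_averages[OF der cont \<delta> \<open>x \<noteq> y\<close>])
    show "0 \<le> lam * ?r powr \<beta> / ?P" using lam P by simp
    fix c and j :: nat assume "c \<in> {x, y}"
    then have "\<not> large_avg (\<lambda>x. norm (f' x)) (lam * 2 powr (real j * (1 - \<delta>)) / ?P) \<beta> j c ?r"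
      using neg \<open>x \<noteq> y\<close> by (auto simp: large_pair_def)
    then show "(\<integral>\<^sup>+u. indicator (ball c (?r / 2 ^ j)) u * ennreal (norm (f' u)) \<partial>lborel)
        \<le> ennreal (lam * ?r powr \<beta> / ?P * 2 powr (real j * (1 - \<delta>))) * emeasure lborel (ball c (?r / 2 ^ j))"
      by (simp add: large_avg_def not_less mult_ac)
  qed
  also have "\<dots> = lam * ?r powr (1 + \<beta>)"
    using P r pw_const_pos[OF \<delta>(1), of "DIM('a)"] by (simp add: osc_const_def powr_add)
  finally have "\<bar>f x - f y\<bar> / ?r powr (1 + \<beta>) \<le> lam" using r by (simp add: divide_le_eq)
  with gt show False by simp
qed

text \<open>The numerator is the covering constant with the oscillation threshold inserted, the
  denominator sums the geometric series over the scales \<open>j\<close>.\<close>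

definition est_const :: "nat \<Rightarrow> real \<Rightarrow> real \<Rightarrow> real \<Rightarrow> real \<Rightarrow> real" where
  "est_const n p q \<gamma> \<delta> = (2 * osc_const n \<delta>) powr p * cov_const n \<gamma> / (1 - 2 powr (n * (1 - p / q) - p * (1 - \<delta>)))"

text \<open>At scale \<open>j\<close> the threshold contributes a decay
  \<open>2 powr (- j * p * (1 - \<delta>))\<close> and the covering estimate a growth
  \<open>2 powr (j * n * (1 - p / q))\<close>; hypothesis \<open>neg\<close> says that the decay
  wins.\<close>

lemma weighted_estimate_ge:
  fixes f :: "'a :: euclidean_space \<Rightarrow> real" and w :: "'a \<Rightarrow> ennreal"
  assumes der: "\<And>x. (f has_derivative (\<lambda>h. f' x \<bullet> h)) (at x)" and cont: "continuous_on UNIV f'"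
    and G: "\<And>x. norm (f' x) \<le> G"
    and w: "A1_weight A w" and A: "0 \<le> A" and \<gamma>: "0 < \<gamma>" and p: "1 \<le> p" and q: "p \<le> q"
    and \<delta>: "0 < \<delta>" "\<delta> < 1" and neg: "real DIM('a) * (1 - p / q) < p * (1 - \<delta>)" and lam: "0 < lam"
  shows "(\<integral>\<^sup>+x. enn_powr (\<integral>\<^sup>+y. indicator (Eset lam (\<gamma> / q) f) (x, y) * ennreal (norm (x - y) powr (\<gamma> - real DIM('a))) \<partial>lborel) (p / q) * w x \<partial>lborel)
    \<le> ennreal (est_const DIM('a) p q \<gamma> \<delta> * (1 + A)\<^sup>2 / lam powr p) * (\<integral>\<^sup>+x. ennreal (norm (f' x) powr p) * w x \<partial>lborel)"
proof -
  let ?n = "DIM('a)"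
  have [measurable]: "w \<in> borel_measurable borel" using w by (simp add: A1_weight_def)
  have [measurable]: "f' \<in> borel_measurable borel"
    using cont by (rule borel_measurable_continuous_onI)
  define g where "g x = norm (f' x)" for x
  have [measurable]: "g \<in> borel_measurable borel" unfolding g_def by measurable
  define I where "I = (\<integral>\<^sup>+x. ennreal (g x powr p) * w x \<partial>lborel)"
  define P where "P = osc_const ?n \<delta>"
  have P: "0 < P" unfolding P_def by (rule osc_const_pos[OF \<delta>(1)])
  define a where "a j = lam * 2 powr (real j * (1 - \<delta>)) / P" for j :: nat
  have a: "0 < a j" for j using lam P by (simp add: a_def)
  have \<theta>: "0 < p / q" "p / q \<le> 1" using p q by auto
  define S where "S j x y = (if large_pair g (a j) (\<gamma> / q) j x y then 1 else 0) * ennreal (norm (x - y) powr (\<gamma> - real ?n))" for j x y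
  have [measurable]: "(\<lambda>(x, y). S j x y) \<in> borel_measurable (borel \<Otimes>\<^sub>M borel)" for j
    unfolding S_def by measurable
  have pw: "indicator (Eset lam (\<gamma> / q) f) (x, y) * ennreal (norm (x - y) powr (\<gamma> - real ?n)) \<le> (\<Sum>j. S j x y)" for x y
  proof (cases "(x, y) \<in> Eset lam (\<gamma> / q) f")
    case True
    from Eset_imp_large_pair[OF der cont \<delta> lam this] obtain j where "large_pair g (a j) (\<gamma> / q) j x y"
      unfolding g_def a_def P_def by blast
    then have "indicator (Eset lam (\<gamma> / q) f) (x, y) * ennreal (norm (x - y) powr (\<gamma> - real ?n)) = (\<Sum>j\<in>{j}. S j x y)"
      using True by (simp add: S_def)
    also have "\<dots> \<le> (\<Sum>j. S j x y)" by (rule sum_le_suminf) auto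
    finally show ?thesis .
  qed simp
  have "(\<integral>\<^sup>+x. enn_powr (\<integral>\<^sup>+y. indicator (Eset lam (\<gamma> / q) f) (x, y) * ennreal (norm (x - y) powr (\<gamma> - real ?n)) \<partial>lborel) (p / q) * w x \<partial>lborel)
    \<le> (\<integral>\<^sup>+x. (\<Sum>j. enn_powr (\<integral>\<^sup>+y. S j x y \<partial>lborel) (p / q) * w x) \<partial>lborel)"
  proof (rule nn_integral_mono)
    fix x
    have "enn_powr (\<integral>\<^sup>+y. indicator (Eset lam (\<gamma> / q) f) (x, y) * ennreal (norm (x - y) powr (\<gamma> - real ?n)) \<partial>lborel) (p / q)
      \<le> enn_powr (\<integral>\<^sup>+y. (\<Sum>j. S j x y) \<partial>lborel) (p / q)"
      using \<theta> by (intro enn_powr_mono nn_integral_mono pw) auto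
    also have "\<dots> = enn_powr (\<Sum>j. \<integral>\<^sup>+y. S j x y \<partial>lborel) (p / q)"
      by (subst nn_integral_suminf) auto
    also have "\<dots> \<le> (\<Sum>j. enn_powr (\<integral>\<^sup>+y. S j x y \<partial>lborel) (p / q))"
      by (rule enn_powr_suminf_le[OF \<theta>])
    finally show "enn_powr (\<integral>\<^sup>+y. indicator (Eset lam (\<gamma> / q) f) (x, y) * ennreal (norm (x - y) powr (\<gamma> - real ?n)) \<partial>lborel) (p / q) * w x
      \<le> (\<Sum>j. enn_powr (\<integral>\<^sup>+y. S j x y \<partial>lborel) (p / q) * w x)"
      unfolding ennreal_suminf_multc by (rule mult_right_mono) simp
  qed
  also have "\<dots> = (\<Sum>j. \<integral>\<^sup>+x. enn_powr (\<integral>\<^sup>+y. S j x y \<partial>lborel) (p / q) * w x \<partial>lborel)"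
    by (rule nn_integral_suminf) measurable
  also have "\<dots> \<le> (\<Sum>j. ennreal ((2 / a j) powr p * 2 powr (real (j * ?n) * (1 - p / q)) * cov_const ?n \<gamma> * (1 + A)\<^sup>2) * I)"
    unfolding S_def I_def using G
    by (intro suminf_le weighted_covering_estimate[OF w A \<gamma> p q _ _ _ a, where G=G]) (auto simp: g_def)
  also have "\<dots> = (\<Sum>j. ennreal ((2 / a j) powr p * 2 powr (real (j * ?n) * (1 - p / q)) * cov_const ?n \<gamma> * (1 + A)\<^sup>2)) * I"
    by (rule ennreal_suminf_multc)
  also have "(\<Sum>j. ennreal ((2 / a j) powr p * 2 powr (real (j * ?n) * (1 - p / q)) * cov_const ?n \<gamma> * (1 + A)\<^sup>2))
    = ennreal (est_const ?n p q \<gamma> \<delta> * (1 + A)\<^sup>2 / lam powr p)"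
  proof (rule suminf_ennreal_eq)
    define e where "e = ?n * (1 - p / q) - p * (1 - \<delta>)"
    have e: "e < 0" using neg by (simp add: e_def)
    have geo: "(2 / a j) powr p * 2 powr (real (j * ?n) * (1 - p / q)) * cov_const ?n \<gamma> * (1 + A)\<^sup>2
      = (2 * P) powr p * cov_const ?n \<gamma> * (1 + A)\<^sup>2 / lam powr p * (2 powr e) ^ j" for j
    proof -
      have "2 / a j = (2 * P) / (lam * 2 powr (real j * (1 - \<delta>)))" by (simp add: a_def)
      then have "(2 / a j) powr p = (2 * P) powr p / (lam powr p * 2 powr (real j * (1 - \<delta>) * p))"
        using lam P by (simp add: powr_divide powr_mult powr_powr)
      moreover have "(2 powr e) ^ j = 2 powr (real (j * ?n) * (1 - p / q)) / 2 powr (real j * (1 - \<delta>) * p)"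
        by (simp add: e_def powr_realpow[symmetric] powr_powr powr_diff[symmetric] algebra_simps)
      ultimately show ?thesis by simp
    qed
    have "(\<lambda>j. (2 powr e) ^ j) sums (1 / (1 - 2 powr e))"
      using e by (intro geometric_sums) (auto intro!: powr_less_one)
    from sums_mult[OF this, of "(2 * P) powr p * cov_const ?n \<gamma> * (1 + A)\<^sup>2 / lam powr p"]
    show "(\<lambda>j. (2 / a j) powr p * 2 powr (real (j * ?n) * (1 - p / q)) * cov_const ?n \<gamma> * (1 + A)\<^sup>2)
      sums (est_const ?n p q \<gamma> \<delta> * (1 + A)\<^sup>2 / lam powr p)"
      unfolding geo by (simp add: est_const_def P_def e_def mult.commute[of "lam powr p"])
  qed (use cov_const_pos[OF \<gamma>, of ?n] A in auto)
  finally show ?thesis by (simp add: I_def g_def)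
qed

text \<open>For a given mass of \<open>\<bar>x - y\<bar>\<^bsup>\<gamma> - n\<^esup>dy\<close>, the mass of \<open>\<bar>x - y\<bar>\<^bsup>\<gamma>' - n\<^esup>dy\<close> is smallest on a ball
  around \<open>x\<close>. Keeping \<open>\<gamma> / q\<close> fixed, this allows one to increase \<open>q\<close>, so that \<open>q < p\<close> reduces to \<open>q = p\<close>.\<close>

lemma kernel_exponent_increase:
  fixes x :: "'a :: euclidean_space"
  assumes \<gamma>: "0 < \<gamma>" "\<gamma> \<le> \<gamma>'" and [measurable]: "S \<in> sets borel"
  shows "(\<integral>\<^sup>+y. indicator S y * ennreal (norm (x - y) powr (\<gamma> - real DIM('a))) \<partial>lborel)
    \<le> ennreal (kernel_const DIM('a) \<gamma> + 1) *
       enn_powr (\<integral>\<^sup>+y. indicator S y * ennreal (norm (x - y) powr (\<gamma>' - real DIM('a))) \<partial>lborel) (\<gamma> / \<gamma>')"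
proof -
  let ?n = "DIM('a)"
  define K where "K = kernel_const ?n \<gamma>"
  have K: "0 < K" unfolding K_def by (rule kernel_const_pos[OF \<gamma>(1)])
  define H1 where "H1 = (\<integral>\<^sup>+y. indicator S y * ennreal (norm (x - y) powr (\<gamma> - real ?n)) \<partial>lborel)"
  define H2 where "H2 = (\<integral>\<^sup>+y. indicator S y * ennreal (norm (x - y) powr (\<gamma>' - real ?n)) \<partial>lborel)"
  \<comment> \<open>Split at radius \<open>\<rho>\<close>: inside, the whole ball bounds the mass;
    outside, the two kernels differ by at most the factor
    \<open>\<rho> powr (\<gamma> - \<gamma>')\<close>.\<close>
  have main: "H1 \<le> ennreal (K * \<rho> powr \<gamma>) + ennreal (\<rho> powr (\<gamma> - \<gamma>')) * H2" if \<rho>: "0 < \<rho>" for \<rho>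
  proof -
    have "H1 \<le> (\<integral>\<^sup>+y. ennreal (norm (y - x) powr (\<gamma> - real ?n)) * indicator (ball x \<rho>) y
        + ennreal (\<rho> powr (\<gamma> - \<gamma>')) * (indicator S y * ennreal (norm (x - y) powr (\<gamma>' - real ?n))) \<partial>lborel)"
      unfolding H1_def
    proof (rule nn_integral_mono)
      fix y
      show "indicator S y * ennreal (norm (x - y) powr (\<gamma> - real ?n))
        \<le> ennreal (norm (y - x) powr (\<gamma> - real ?n)) * indicator (ball x \<rho>) y
        + ennreal (\<rho> powr (\<gamma> - \<gamma>')) * (indicator S y * ennreal (norm (x - y) powr (\<gamma>' - real ?n)))"
      proof (cases "y \<in> ball x \<rho>")
        case True
        then show ?thesis by (auto simp: norm_minus_commute indicator_def intro: add_increasing2)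
      next
        case False
        then have r: "\<rho> \<le> norm (x - y)" by (simp add: dist_norm)
        have "norm (x - y) powr (\<gamma> - real ?n) = norm (x - y) powr (\<gamma> - \<gamma>') * norm (x - y) powr (\<gamma>' - real ?n)"
          by (simp flip: powr_add)
        also have "\<dots> \<le> \<rho> powr (\<gamma> - \<gamma>') * norm (x - y) powr (\<gamma>' - real ?n)"
          using r \<rho> \<gamma> by (intro mult_right_mono powr_mono2') auto
        finally show ?thesis
          using False by (auto simp: indicator_def ennreal_mult'[symmetric] intro!: ennreal_leI)
      qed
    qed
    also have "\<dots> = (\<integral>\<^sup>+y. ennreal (norm (y - x) powr (\<gamma> - real ?n)) * indicator (ball x \<rho>) y \<partial>lborel)
        + ennreal (\<rho> powr (\<gamma> - \<gamma>')) * H2"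
      by (simp add: nn_integral_add nn_integral_cmult H2_def)
    also have "\<dots> \<le> ennreal (K * \<rho> powr \<gamma>) + ennreal (\<rho> powr (\<gamma> - \<gamma>')) * H2"
      unfolding K_def by (intro add_right_mono kernel_integral_ball_le \<gamma> \<rho>)
    finally show ?thesis .
  qed
  have "H1 \<le> ennreal (K + 1) * enn_powr H2 (\<gamma> / \<gamma>')"
  proof (cases H2)
    case (real h)
    show ?thesis
    proof (cases "h = 0")
      case True
      \<comment> \<open>There is no balancing radius for \<open>h = 0\<close>; instead
        \<open>\<rho>\<close> is sent to 0, parametrised so that the remaining term equals
        \<open>e\<close>.\<close>
      have "H1 \<le> 0"
      proof (rule ennreal_le_epsilon)
        fix e :: real assume e: "0 < e"
        have "H1 \<le> ennreal (K * ((e / K) powr (1 / \<gamma>)) powr \<gamma>)"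
          using main[of "(e / K) powr (1 / \<gamma>)"] e K real True by simp
        also have "K * ((e / K) powr (1 / \<gamma>)) powr \<gamma> = e"
          using e K \<gamma> by (simp add: powr_powr)
        finally show "H1 \<le> 0 + ennreal e" by simp
      qed
      then show ?thesis by simp
    next
      case False
      then have h: "0 < h" using real by simp
      \<comment> \<open>The radius at which both terms of \<open>main\<close> have size
        \<open>h powr (\<gamma> / \<gamma>')\<close>.\<close>
      define \<rho> where "\<rho> = h powr (1 / \<gamma>')"
      have r1: "\<rho> powr \<gamma> = h powr (\<gamma> / \<gamma>')" by (simp add: \<rho>_def powr_powr)
      have r2: "\<rho> powr (\<gamma> - \<gamma>') * h = h powr (\<gamma> / \<gamma>')"
        using h \<gamma> by (simp add: \<rho>_def powr_powr diff_divide_distrib powr_diff)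
      have "H1 \<le> ennreal (K * \<rho> powr \<gamma>) + ennreal (\<rho> powr (\<gamma> - \<gamma>')) * H2"
        using h by (intro main) (simp add: \<rho>_def)
      also have "\<dots> = ennreal (K * \<rho> powr \<gamma> + \<rho> powr (\<gamma> - \<gamma>') * h)"
        using K h real by (simp add: ennreal_mult'[symmetric])
      also have "\<dots> = ennreal ((K + 1) * h powr (\<gamma> / \<gamma>'))"
        unfolding r1 r2 by (simp add: algebra_simps)
      also have "\<dots> = ennreal (K + 1) * enn_powr H2 (\<gamma> / \<gamma>')"
        using K real by (simp add: enn_powr_ennreal ennreal_mult')
      finally show ?thesis .
    qed
  next
    case top
    then show ?thesis using K by (simp add: ennreal_mult_top)
  qed
  then show ?thesis by (simp add: H1_def H2_def K_def)
qed

text \<open>\<open>D\<close> is fixed before the function, the weight and its constant. This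
  uniformity makes the final constant independent of the space \<open>X\<close>.\<close>

theorem weighted_estimate:
  fixes \<gamma> p q :: real
  assumes \<gamma>: "0 < \<gamma>" and p: "1 \<le> p" and q: "0 < q"
    and npq: "real DIM('a::euclidean_space) * (1 / p - 1 / q) < 1"
  obtains D where "0 < D"
    and "\<And>(f :: 'a \<Rightarrow> real) f' G A w lam. (\<And>x. (f has_derivative (\<lambda>h. f' x \<bullet> h)) (at x)) \<Longrightarrow>
      continuous_on UNIV f' \<Longrightarrow> (\<And>x. norm (f' x) \<le> G) \<Longrightarrow> A1_weight A w \<Longrightarrow> 0 \<le> A \<Longrightarrow> 0 < lam \<Longrightarrow>
      (\<integral>\<^sup>+x. enn_powr (\<integral>\<^sup>+y. indicator (Eset lam (\<gamma> / q) f) (x, y) * ennreal (norm (x - y) powr (\<gamma> - real DIM('a))) \<partial>lborel) (p / q) * w x \<partial>lborel)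
      \<le> ennreal (D * (1 + A)\<^sup>2 / lam powr p) * (\<integral>\<^sup>+x. ennreal (norm (f' x) powr p) * w x \<partial>lborel)"
proof -
  let ?n = "DIM('a)"
  define q' where "q' = max p q"
  \<comment> \<open>Chosen so that \<open>\<gamma>' / q' = \<gamma> / q\<close>: the set
    \<open>Eset\<close> stays the same and only the kernel changes.\<close>
  define \<gamma>' where "\<gamma>' = \<gamma> * q' / q"
  have q': "p \<le> q'" "q \<le> q'" "0 < q'" using p by (auto simp: q'_def)
  have \<gamma>': "0 < \<gamma>'" "\<gamma> \<le> \<gamma>'" "\<gamma>' / q' = \<gamma> / q" "\<gamma> / \<gamma>' = q / q'"
    using \<gamma> q q' by (auto simp: \<gamma>'_def field_simps)
  have npq': "real ?n * (1 / p - 1 / q') < 1"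
    using npq by (auto simp: q'_def max_def)
  define s where "s = real ?n * (1 / p - 1 / q')"
  have s: "0 \<le> s" "s < 1" using npq' q' p by (auto simp: s_def intro!: mult_nonneg_nonneg divide_left_mono)
  \<comment> \<open>Half of the gap \<open>1 - s\<close>. It is positive by the hypothesis on
    \<open>n\<close>, \<open>p\<close>, \<open>q\<close>, and below 1 because
    \<open>p \<le> q'\<close> makes \<open>s\<close> nonnegative.\<close>
  define \<delta> where "\<delta> = (1 - s) / 2"
  have \<delta>: "0 < \<delta>" "\<delta> < 1" using s by (auto simp: \<delta>_def)
  have "s < 1 - \<delta>" using s by (simp add: \<delta>_def field_simps)
  then have "p * s < p * (1 - \<delta>)" using p by simp
  moreover have "p * s = real ?n * (1 - p / q')" using p by (simp add: s_def field_simps)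
  ultimately have neg: "real ?n * (1 - p / q') < p * (1 - \<delta>)" by simp
  define L where "L = kernel_const ?n \<gamma> + 1"
  have L: "0 < L" using kernel_const_pos[OF \<gamma>, of ?n] by (simp add: L_def)
  define E0 where "E0 = est_const ?n p q' \<gamma>' \<delta>"
  have E0: "0 < E0"
    unfolding E0_def est_const_def using osc_const_pos[OF \<delta>(1), of ?n] cov_const_pos[OF \<gamma>'(1), of ?n] neg
    by (auto intro!: divide_pos_pos mult_pos_pos powr_less_one)
  show ?thesis
  proof (rule that[of "L powr (p / q) * E0"])
    show "0 < L powr (p / q) * E0" using L E0 by simp
    fix f :: "'a \<Rightarrow> real" and f' G A lam and w :: "'a \<Rightarrow> ennreal"
    assume der: "\<And>x. (f has_derivative (\<lambda>h. f' x \<bullet> h)) (at x)" and cont: "continuous_on UNIV f'"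
      and G: "\<And>x. norm (f' x) \<le> (G::real)" and w: "A1_weight A w" and A: "0 \<le> A" and lam: "0 < (lam::real)"
    have [measurable]: "w \<in> borel_measurable borel" using w by (simp add: A1_weight_def)
    have "continuous_on UNIV f"
      using der by (meson continuous_at_imp_continuous_on has_derivative_continuous)
    then have [measurable]: "f \<in> borel_measurable borel" by (rule borel_measurable_continuous_onI)
    define E where "E = Eset lam (\<gamma> / q) f"
    have [measurable]: "E \<in> sets (borel \<Otimes>\<^sub>M borel)" unfolding E_def by measurable
    define H where "H \<alpha> x = (\<integral>\<^sup>+y. indicator E (x, y) * ennreal (norm (x - y) powr (\<alpha> - real ?n)) \<partial>lborel)" for \<alpha> x
    have [measurable]: "H \<alpha> \<in> borel_measurable borel" for \<alpha> unfolding H_def by measurable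
    have le: "enn_powr (H \<gamma> x) (p / q) \<le> ennreal (L powr (p / q)) * enn_powr (H \<gamma>' x) (p / q')" for x
    proof -
      have [measurable]: "Pair x -` E \<in> sets borel"
        using sets_Pair1[of E borel borel x] by simp
      have "H \<gamma> x \<le> ennreal L * enn_powr (H \<gamma>' x) (q / q')"
        using kernel_exponent_increase[OF \<gamma> \<gamma>'(2), of "Pair x -` E" x]
        by (simp add: H_def L_def \<gamma>'(4) indicator_def)
      then have "enn_powr (H \<gamma> x) (p / q) \<le> enn_powr (ennreal L * enn_powr (H \<gamma>' x) (q / q')) (p / q)"
        using p q by (intro enn_powr_mono) auto
      also have "\<dots> = ennreal (L powr (p / q)) * enn_powr (H \<gamma>' x) (p / q')"
        using p q L by (simp add: enn_powr_mult enn_powr_powr enn_powr_ennreal)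
      finally show ?thesis .
    qed
    have "(\<integral>\<^sup>+x. enn_powr (H \<gamma> x) (p / q) * w x \<partial>lborel)
      \<le> (\<integral>\<^sup>+x. ennreal (L powr (p / q)) * (enn_powr (H \<gamma>' x) (p / q') * w x) \<partial>lborel)"
      unfolding mult.assoc[symmetric] by (intro nn_integral_mono mult_right_mono le) auto
    also have "\<dots> = ennreal (L powr (p / q)) * (\<integral>\<^sup>+x. enn_powr (H \<gamma>' x) (p / q') * w x \<partial>lborel)"
      by (rule nn_integral_cmult) measurable
    also have "\<dots> \<le> ennreal (L powr (p / q)) * (ennreal (E0 * (1 + A)\<^sup>2 / lam powr p) * (\<integral>\<^sup>+x. ennreal (norm (f' x) powr p) * w x \<partial>lborel))"
      using weighted_estimate_ge[OF der cont G w A \<gamma>'(1) p q'(1) \<delta> neg lam]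
      unfolding H_def E_def E0_def \<gamma>'(3) by (intro mult_left_mono) auto
    also have "\<dots> = ennreal (L powr (p / q) * E0 * (1 + A)\<^sup>2 / lam powr p) * (\<integral>\<^sup>+x. ennreal (norm (f' x) powr p) * w x \<partial>lborel)"
      using E0 A by (simp add: ennreal_mult' mult.assoc flip: times_divide_eq_right)
    finally show "(\<integral>\<^sup>+x. enn_powr (\<integral>\<^sup>+y. indicator (Eset lam (\<gamma> / q) f) (x, y) * ennreal (norm (x - y) powr (\<gamma> - real DIM('a))) \<partial>lborel) (p / q) * w x \<partial>lborel)
      \<le> ennreal (L powr (p / q) * E0 * (1 + A)\<^sup>2 / lam powr p) * (\<integral>\<^sup>+x. ennreal (norm (f' x) powr p) * w x \<partial>lborel)"
      by (simp add: H_def E_def)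
  qed
qed

section \<open>Lorentz--Luxemburg duality\<close>

lemma integrable_lebesgue_ball:
  fixes F :: "'a :: euclidean_space \<Rightarrow> real"
  assumes "F \<in> borel_measurable lebesgue" "\<And>x. \<bar>F x\<bar> \<le> K" "\<And>x. x \<notin> ball 0 R \<Longrightarrow> F x = 0"
  shows "integrable lebesgue F"
proof (rule integrableI_bounded_set[where A="ball 0 R" and B=K])
  show "emeasure lebesgue (ball 0 R :: 'a set) < \<infinity>"
    using emeasure_bounded_finite[of "ball 0 R :: 'a set"] by (simp add: less_top)
qed (use assms in auto)

text \<open>Riesz-Fischer: the sum of the absolute increments has finite integral, hence is finite
  almost everywhere, and the sequence telescopes.\<close>

lemma AE_convergent_of_summable_L1:
  fixes h :: "nat \<Rightarrow> 'a :: euclidean_space \<Rightarrow> real"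
  assumes [measurable]: "\<And>k. h k \<in> borel_measurable lebesgue"
    and int: "\<And>k. (\<integral>\<^sup>+x. ennreal \<bar>h (Suc k) x - h k x\<bar> \<partial>lebesgue) \<le> ennreal (c k)" and c: "summable c" "\<And>k. 0 \<le> c k"
  shows "AE x in lebesgue. convergent (\<lambda>k. h k x)"
proof -
  have "(\<integral>\<^sup>+x. (\<Sum>k. ennreal \<bar>h (Suc k) x - h k x\<bar>) \<partial>lebesgue) = (\<Sum>k. \<integral>\<^sup>+x. ennreal \<bar>h (Suc k) x - h k x\<bar> \<partial>lebesgue)"
    by (rule nn_integral_suminf) measurable
  also have "\<dots> \<le> (\<Sum>k. ennreal (c k))" by (intro suminf_le int) auto
  also have "\<dots> = ennreal (\<Sum>k. c k)" using c by (simp add: suminf_ennreal2)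
  also have "\<dots> < \<infinity>" by simp
  finally have "AE x in lebesgue. (\<Sum>k. ennreal \<bar>h (Suc k) x - h k x\<bar>) \<noteq> \<infinity>"
    by (intro nn_integral_PInf_AE) auto
  then show ?thesis
  proof eventually_elim
    case (elim x)
    have "summable (\<lambda>k. \<bar>h (Suc k) x - h k x\<bar>)"
      by (rule summable_suminf_not_top) (use elim in auto)
    then have "summable (\<lambda>k. h (Suc k) x - h k x)" by (rule summable_rabs_cancel)
    then have "convergent (\<lambda>n. \<Sum>k<n. h (Suc k) x - h k x)" by (simp add: summable_iff_convergent)
    then have "convergent (\<lambda>n. h n x - h 0 x)" by (simp add: sum_lessThan_telescope[of "\<lambda>k. h k x"])
    from convergent_add[OF this convergent_const[of "h 0 x"]] show ?case by simp
  qed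
qed

context
  fixes Y :: "'a :: euclidean_space fnorm"
  assumes Y: "ball_Banach_fs Y"
begin

lemma bBfs_mono:
  assumes "f \<in> borel_measurable lebesgue" "g \<in> borel_measurable lebesgue" "AE x in lebesgue. \<bar>g x\<bar> \<le> \<bar>f x\<bar>"
  shows "Y g \<le> Y f"
  using Y assms unfolding ball_Banach_fs_def ball_quasi_Banach_fs_def by blast

lemma bBfs_scale: "f \<in> borel_measurable lebesgue \<Longrightarrow> Y (\<lambda>x. c * f x) = ennreal \<bar>c\<bar> * Y f"
  using Y unfolding ball_Banach_fs_def ball_quasi_Banach_fs_def quasi_Banach_fs_def by blast

lemma bBfs_add:
  "f \<in> borel_measurable lebesgue \<Longrightarrow> g \<in> borel_measurable lebesgue \<Longrightarrow> Y (\<lambda>x. f x + g x) \<le> Y f + Y g"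
  using Y unfolding ball_Banach_fs_def by blast

lemma bBfs_eq_0: "f \<in> borel_measurable lebesgue \<Longrightarrow> Y f = 0 \<Longrightarrow> AE x in lebesgue. f x = 0"
  using Y unfolding ball_Banach_fs_def ball_quasi_Banach_fs_def by blast

lemma bBfs_Fatou:
  assumes "\<And>m. F m \<in> borel_measurable lebesgue" "f \<in> borel_measurable lebesgue"
    and "AE x in lebesgue. (\<forall>m. 0 \<le> F m x \<and> F m x \<le> F (Suc m) x) \<and> (\<lambda>m. F m x) \<longlonglongrightarrow> f x"
  shows "(\<lambda>m. Y (F m)) \<longlonglongrightarrow> Y f"
proof -
  have "\<forall>(F::nat \<Rightarrow> 'a \<Rightarrow> real) f. (\<forall>m. F m \<in> borel_measurable lebesgue) \<and> f \<in> borel_measurable lebesgue \<and>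
        (AE x in lebesgue. (\<forall>m. 0 \<le> F m x \<and> F m x \<le> F (Suc m) x) \<and> (\<lambda>m. F m x) \<longlonglongrightarrow> f x) \<longrightarrow>
        (\<lambda>m. Y (F m)) \<longlonglongrightarrow> Y f"
    using Y unfolding ball_Banach_fs_def ball_quasi_Banach_fs_def by (elim conjE)
  then show ?thesis using assms by blast
qed

lemma bBfs_0: "Y (\<lambda>x. 0) = 0"
  using bBfs_scale[of "\<lambda>x. 0" 0] by simp

text \<open>Fatou's lemma for the norm. The tail infima increase to the limit, so the monotone
  convergence axiom applies to them, and each lies below \<open>h k\<close>. They are formed in
  \<open>ennreal\<close> and then converted back, which is harmless as they are finite.\<close>

lemma bBfs_le_of_AE_limit:
  assumes [measurable]: "\<And>k. h k \<in> borel_measurable lebesgue" and pos: "\<And>k x. 0 \<le> h k x" and M: "\<And>k. Y (h k) \<le> M"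
    and [measurable]: "f \<in> borel_measurable lebesgue" and lim: "AE x in lebesgue. (\<lambda>k. h k x) \<longlonglongrightarrow> f x"
  shows "Y f \<le> M"
proof -
  define m where "m k x = enn2real (INF l\<in>{k..}. ennreal (h l x))" for k x
  have [measurable]: "m k \<in> borel_measurable lebesgue" for k unfolding m_def by measurable
  have fin: "(INF l\<in>{k..}. ennreal (h l x)) < top" for k x
    by (rule le_less_trans[OF INF_lower[of k]]) auto
  have m_le: "m k x \<le> h k x" for k x
  proof -
    have "m k x \<le> enn2real (ennreal (h k x))"
      unfolding m_def by (intro enn2real_mono INF_lower) auto
    then show ?thesis using pos by simp
  qed
  have m_pos: "0 \<le> m k x" for k x by (simp add: m_def)
  have "(\<lambda>k. Y (m k)) \<longlonglongrightarrow> Y f"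
  proof (rule bBfs_Fatou)
    show "AE x in lebesgue. (\<forall>k. 0 \<le> m k x \<and> m k x \<le> m (Suc k) x) \<and> (\<lambda>k. m k x) \<longlonglongrightarrow> f x"
      using lim
    proof eventually_elim
      case (elim x)
      have inc: "incseq (\<lambda>k. INF l\<in>{k..}. ennreal (h l x))"
        by (auto simp: incseq_def intro!: INF_superset_mono)
      have "m k x \<le> m (Suc k) x" for k
        unfolding m_def using inc fin by (intro enn2real_mono) (auto simp: incseq_Suc_iff)
      moreover have "(\<lambda>k. m k x) \<longlonglongrightarrow> f x"
      proof -
        have "(\<lambda>k. ennreal (h k x)) \<longlonglongrightarrow> ennreal (f x)" using elim by (rule tendsto_ennrealI)
        then have "liminf (\<lambda>k. ennreal (h k x)) = ennreal (f x)"
          by (intro lim_imp_Liminf) auto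
        then have "(SUP k. INF l\<in>{k..}. ennreal (h l x)) = ennreal (f x)"
          by (simp add: liminf_SUP_INF)
        then have "(\<lambda>k. INF l\<in>{k..}. ennreal (h l x)) \<longlonglongrightarrow> ennreal (f x)"
          using LIMSEQ_SUP[OF inc] by simp
        then have "(\<lambda>k. m k x) \<longlonglongrightarrow> enn2real (ennreal (f x))"
          unfolding m_def by (intro tendsto_enn2real) auto
        moreover have "0 \<le> f x" using pos by (intro LIMSEQ_le_const[OF elim]) auto
        ultimately show ?thesis by simp
      qed
      ultimately show ?case using m_pos by simp
    qed
  qed auto
  moreover have "Y (m k) \<le> M" for k
    using order_trans[OF bBfs_mono[of "h k" "m k"] M[of k]] m_le m_pos pos by auto
  ultimately show ?thesis by (intro LIMSEQ_le_const2) auto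
qed

text \<open>Separation by hand: if \<open>h\<^sub>0\<close> minimises \<open>\<integral>(v - h)\<^sup>2\<close> over \<open>0 \<le> h \<le> v\<close>, \<open>Y h \<le> M\<close>, then the
  residual \<open>g = v - h\<^sub>0\<close> is the separating functional, and testing the duality hypothesis with it
  gives \<open>\<integral>g\<^sup>2 \<le> 0\<close>.\<close>

lemma Lorentz_Luxemburg_bounded:
  fixes v :: "'a \<Rightarrow> real"
  assumes v_meas [measurable]: "v \<in> borel_measurable lebesgue" and v: "\<And>x. 0 \<le> v x" "\<And>x. v x \<le> K" "\<And>x. x \<notin> ball 0 R \<Longrightarrow> v x = 0"
    and M: "0 < M"
    and dual: "\<And>g. g \<in> borel_measurable lebesgue \<Longrightarrow> assoc Y g \<le> 1 \<Longrightarrow> (\<integral>\<^sup>+x. ennreal (v x * \<bar>g x\<bar>) \<partial>lebesgue) \<le> ennreal M"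
  shows "Y v \<le> ennreal M"
proof -
  have K: "0 \<le> K" using v(1,2)[of 0] by linarith
  define U where "U = {h \<in> borel_measurable lebesgue. (\<forall>x. 0 \<le> h x \<and> h x \<le> v x) \<and> Y h \<le> ennreal M}"
  define D where "D h = (\<integral>x. (v x - h x)\<^sup>2 \<partial>lebesgue)" for h
  have U_meas: "h \<in> borel_measurable lebesgue" and U_pos: "0 \<le> h x" and U_le: "h x \<le> v x" and U_Y: "Y h \<le> ennreal M"
    if "h \<in> U" for h x using that by (auto simp: U_def)
  have U_K: "h x \<le> K" "x \<notin> ball 0 R \<Longrightarrow> h x = 0" if "h \<in> U" for h x
    using U_le[OF that, of x] U_pos[OF that, of x] v(2)[of x] v(3)[of x] by auto
  have zeroU: "(\<lambda>x. 0) \<in> U" using v by (simp add: U_def bBfs_0)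
  have sq_int: "integrable lebesgue (\<lambda>x. (a x - b x)\<^sup>2)"
    if [measurable]: "a \<in> borel_measurable lebesgue" "b \<in> borel_measurable lebesgue"
      and bd: "\<And>x. \<bar>a x\<bar> \<le> L" "\<And>x. \<bar>b x\<bar> \<le> L" "\<And>x. x \<notin> ball 0 R \<Longrightarrow> a x = 0" "\<And>x. x \<notin> ball 0 R \<Longrightarrow> b x = 0" for a b :: "'a \<Rightarrow> real" and L
  proof (rule integrable_lebesgue_ball[where K="(2 * L)\<^sup>2" and R=R])
    fix x
    have "\<bar>a x - b x\<bar> \<le> 2 * L" using bd(1,2)[of x] by linarith
    then have "\<bar>a x - b x\<bar>\<^sup>2 \<le> (2 * L)\<^sup>2" by (intro power_mono) auto
    then show "\<bar>(a x - b x)\<^sup>2\<bar> \<le> (2 * L)\<^sup>2" by simp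
  qed (use bd in auto)
  have v_abs: "\<bar>v x\<bar> \<le> K" for x using v[of x] by simp
  have U_abs: "\<bar>h x\<bar> \<le> K" if "h \<in> U" for h x using U_pos[OF that, of x] U_K[OF that, of x] by simp
  have D_int: "integrable lebesgue (\<lambda>x. (v x - h x)\<^sup>2)" if "h \<in> U" for h
    using U_meas[OF that] U_abs[OF that] U_K[OF that] v(3) v_abs by (intro sq_int) auto
  define d where "d = (INF h\<in>U. D h)"
  have D_nonneg: "0 \<le> D h" for h by (simp add: D_def)
  have bdd: "bdd_below (D ` U)" by (auto intro!: bdd_belowI[of _ 0] D_nonneg)
  have d_le: "d \<le> D h" if "h \<in> U" for h unfolding d_def by (rule cINF_lower[OF bdd that])
  \<comment> \<open>The rate \<open>(1/16)^k\<close> is chosen so that, after weighting squared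
    differences by \<open>4^k\<close> below, a summable \<open>(1/4)^k\<close> remains.\<close>
  have ex: "\<exists>h\<in>U. D h < d + (1/16)^k" for k :: nat
  proof -
    have "(INF h\<in>U. D h) < d + (1/16)^k" by (simp add: d_def)
    then show ?thesis using cINF_less_iff[OF _ bdd, of "d + (1/16)^k"] zeroU by blast
  qed
  then obtain h where hU: "\<And>k::nat. h k \<in> U" and hD: "\<And>k. D (h k) < d + (1/16)^k" by metis
  have [measurable]: "h k \<in> borel_measurable lebesgue" for k by (rule U_meas[OF hU])
  have mid: "(\<lambda>x. (h k x + h l x) / 2) \<in> U" for k l
  proof -
    have "Y (\<lambda>x. (1/2) * (h k x + h l x)) = ennreal (1/2) * Y (\<lambda>x. h k x + h l x)"
      by (subst bBfs_scale) auto
    also have "\<dots> \<le> ennreal (1/2) * (Y (h k) + Y (h l))" by (intro mult_left_mono bBfs_add) auto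
    also have "\<dots> \<le> ennreal (1/2) * (ennreal M + ennreal M)"
      by (intro mult_left_mono add_mono U_Y hU) auto
    also have "\<dots> = ennreal (1/2 * (M + M))"
      using M by (subst ennreal_mult) (auto simp: ennreal_plus[symmetric] simp del: ennreal_plus)
    also have "\<dots> = ennreal M" by simp
    finally have "Y (\<lambda>x. (h k x + h l x) / 2) \<le> ennreal M" by simp
    moreover have "0 \<le> (h k x + h l x) / 2 \<and> (h k x + h l x) / 2 \<le> v x" for x
      using U_pos[OF hU, of k x] U_pos[OF hU, of l x] U_le[OF hU, of k x] U_le[OF hU, of l x] by auto
    ultimately show ?thesis by (simp add: U_def)
  qed
  have diff_int: "integrable lebesgue (\<lambda>x. (h k x - h l x)\<^sup>2)" for k l
    using U_abs[OF hU] U_K(2)[OF hU] by (intro sq_int) auto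
  \<comment> \<open>Parallelogram identity. Midpoints stay in \<open>U\<close>, so the subtracted
    term is at least \<open>4 * d\<close>, and a minimising sequence is Cauchy in the mean
    square.\<close>
  have par: "(\<integral>x. (h k x - h l x)\<^sup>2 \<partial>lebesgue) = 2 * D (h k) + 2 * D (h l) - 4 * D (\<lambda>x. (h k x + h l x) / 2)" for k l
  proof -
    have "(\<integral>x. (h k x - h l x)\<^sup>2 \<partial>lebesgue) = (\<integral>x. 2 * (v x - h k x)\<^sup>2 + 2 * (v x - h l x)\<^sup>2 - 4 * (v x - (h k x + h l x) / 2)\<^sup>2 \<partial>lebesgue)"
      by (intro Bochner_Integration.integral_cong refl) (simp add: power2_eq_square field_simps)
    also have "\<dots> = 2 * D (h k) + 2 * D (h l) - 4 * D (\<lambda>x. (h k x + h l x) / 2)"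
      unfolding D_def using D_int[OF hU] D_int[OF mid] by simp
    finally show ?thesis .
  qed
  define V where "V = measure lebesgue (ball 0 R :: 'a set)"
  have V: "emeasure lebesgue (ball 0 R :: 'a set) = ennreal V"
    unfolding V_def using emeasure_bounded_finite[of "ball 0 R :: 'a set"] by (intro emeasure_eq_ennreal_measure) auto
  have V0: "0 \<le> V" by (simp add: V_def)
  have "AE x in lebesgue. convergent (\<lambda>k. h k x)"
  proof (rule AE_convergent_of_summable_L1)
    show "summable (\<lambda>k. (1/4)^k * (V + 4))" by (intro summable_mult2 summable_geometric) auto
    fix k
    have sq: "(\<integral>x. (h (Suc k) x - h k x)\<^sup>2 \<partial>lebesgue) \<le> 4 * (1/16)^k"
    proof -
      have "d \<le> D (\<lambda>x. (h (Suc k) x + h k x) / 2)" by (rule d_le[OF mid])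
      moreover have "(1/16::real)^Suc k \<le> (1/16)^k" by simp
      ultimately show ?thesis unfolding par using hD[of k] hD[of "Suc k"] by linarith
    qed
    have "(\<integral>\<^sup>+x. ennreal \<bar>h (Suc k) x - h k x\<bar> \<partial>lebesgue)
      \<le> (\<integral>\<^sup>+x. ennreal ((1/4)^k) * indicator (ball 0 R) x + ennreal (4^k) * ennreal ((h (Suc k) x - h k x)\<^sup>2) \<partial>lebesgue)"
    proof (rule nn_integral_mono)
      fix x
      \<comment> \<open>Young's inequality with a weight depending on \<open>k\<close>; it trades
        the square for an absolute value on the bounded set where the functions live.\<close>
      have *: "\<bar>y\<bar> \<le> (1/4)^k + 4^k * y\<^sup>2" for y :: real
      proof -
        have "0 \<le> (2^k * \<bar>y\<bar> - (1/2)^k)\<^sup>2 + \<bar>y\<bar>" by simp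
        moreover have "(2^k * \<bar>y\<bar> - (1/2)^k)\<^sup>2 = 4^k * y\<^sup>2 + (1/4)^k - 2 * \<bar>y\<bar> * (2^k * (1/2)^k)"
          by (simp add: power2_eq_square algebra_simps flip: power_mult_distrib abs_mult)
        moreover have "(2::real)^k * (1/2)^k = 1" by (simp flip: power_mult_distrib)
        ultimately show ?thesis by simp
      qed
      show "ennreal \<bar>h (Suc k) x - h k x\<bar> \<le> ennreal ((1/4)^k) * indicator (ball 0 R) x + ennreal (4^k) * ennreal ((h (Suc k) x - h k x)\<^sup>2)"
      proof (cases "x \<in> ball 0 R")
        case True
        then show ?thesis using *[of "h (Suc k) x - h k x"]
          by (simp add: ennreal_mult'[symmetric] ennreal_plus[symmetric] ennreal_leI del: ennreal_plus)
      next
        case False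
        then show ?thesis using U_K(2)[OF hU False] by simp
      qed
    qed
    also have "\<dots> = ennreal ((1/4)^k) * ennreal V + ennreal (4^k) * (\<integral>\<^sup>+x. ennreal ((h (Suc k) x - h k x)\<^sup>2) \<partial>lebesgue)"
      by (simp add: nn_integral_add nn_integral_cmult V)
    also have "(\<integral>\<^sup>+x. ennreal ((h (Suc k) x - h k x)\<^sup>2) \<partial>lebesgue) = ennreal (\<integral>x. (h (Suc k) x - h k x)\<^sup>2 \<partial>lebesgue)"
      by (intro nn_integral_eq_integral diff_int) auto
    also have "ennreal ((1/4)^k) * ennreal V + ennreal (4^k) * \<dots> \<le> ennreal ((1/4)^k) * ennreal V + ennreal (4^k) * ennreal (4 * (1/16)^k)"
      by (intro add_left_mono mult_left_mono ennreal_leI sq) auto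
    also have "\<dots> = ennreal ((1/4)^k * V + 4^k * (4 * (1/16)^k))"
      using V0 by (simp add: ennreal_mult'[symmetric] ennreal_plus[symmetric] del: ennreal_plus)
    also have "(1/4)^k * V + 4^k * (4 * (1/16)^k) = (1/4)^k * (V + (4::real))"
      by (simp add: algebra_simps flip: power_mult_distrib)
    finally show "(\<integral>\<^sup>+x. ennreal \<bar>h (Suc k) x - h k x\<bar> \<partial>lebesgue) \<le> ennreal ((1/4)^k * (V + 4))" .
  qed (use V0 in auto)
  note conv = this
  \<comment> \<open>Clamping changes the limit only on a null set, but gives the pointwise
    constraints of \<open>U\<close> everywhere.\<close>
  define h0 where "h0 x = max 0 (min (v x) (lim (\<lambda>k. h k x)))" for x
  have [measurable]: "h0 \<in> borel_measurable lebesgue" unfolding h0_def by measurable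
  have lim: "AE x in lebesgue. (\<lambda>k. h k x) \<longlonglongrightarrow> h0 x"
    using conv
  proof eventually_elim
    case (elim x)
    then have l: "(\<lambda>k. h k x) \<longlonglongrightarrow> lim (\<lambda>k. h k x)" by (simp add: convergent_LIMSEQ_iff)
    have "0 \<le> lim (\<lambda>k. h k x)" using l by (rule LIMSEQ_le_const) (use U_pos[OF hU] in auto)
    moreover have "lim (\<lambda>k. h k x) \<le> v x" using l by (rule LIMSEQ_le_const2) (use U_le[OF hU] in auto)
    ultimately show ?case using l by (simp add: h0_def)
  qed
  have "Y h0 \<le> ennreal M"
    by (rule bBfs_le_of_AE_limit[OF _ U_pos[OF hU] U_Y[OF hU] _ lim]) measurable
  moreover have "0 \<le> h0 x \<and> h0 x \<le> v x" for x using v(1) by (auto simp: h0_def)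
  ultimately have h0U: "h0 \<in> U" by (simp add: U_def)
  have "(\<lambda>k. D (h k)) \<longlonglongrightarrow> D h0"
    unfolding D_def
  proof (rule integral_dominated_convergence[where w="\<lambda>x. K\<^sup>2 * indicator (ball 0 R) x"])
    show "AE x in lebesgue. (\<lambda>k. (v x - h k x)\<^sup>2) \<longlonglongrightarrow> (v x - h0 x)\<^sup>2"
      using lim by eventually_elim (intro tendsto_intros)
    show "integrable lebesgue (\<lambda>x::'a. K\<^sup>2 * indicator (ball 0 R) x)"
    proof (rule integrable_lebesgue_ball[of _ "K\<^sup>2" R])
      show "(\<lambda>x::'a. K\<^sup>2 * indicator (ball 0 R) x) \<in> borel_measurable lebesgue" by measurable
    qed (auto simp: indicator_def)
    fix k
    show "AE x in lebesgue. norm ((v x - h k x)\<^sup>2) \<le> K\<^sup>2 * indicator (ball 0 R) x"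
    proof (rule AE_I2)
      fix x
      have "\<bar>v x - h k x\<bar> \<le> K" using v(2)[of x] U_pos[OF hU, of k x] U_le[OF hU, of k x] by auto
      then have "\<bar>v x - h k x\<bar>\<^sup>2 \<le> K\<^sup>2" by (intro power_mono) auto
      then show "norm ((v x - h k x)\<^sup>2) \<le> K\<^sup>2 * indicator (ball 0 R) x"
        using v(3)[of x] U_K(2)[OF hU, of x k] by (auto simp: indicator_def)
    qed
  qed measurable
  moreover have "(\<lambda>k. D (h k)) \<longlonglongrightarrow> d"
  proof (rule tendsto_sandwich[of "\<lambda>_. d" _ _ "\<lambda>k. d + (1/16)^k"])
    show "(\<lambda>k. d + (1/16)^k) \<longlonglongrightarrow> d"
      using tendsto_add[OF tendsto_const[of d] LIMSEQ_power_zero[of "1/16::real"]] by simp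
  qed (use d_le[OF hU] hD in \<open>auto intro: less_imp_le always_eventually\<close>)
  ultimately have Dh0: "D h0 = d" by (rule LIMSEQ_unique)
  define g where "g x = v x - h0 x" for x
  have [measurable]: "g \<in> borel_measurable lebesgue" unfolding g_def by measurable
  have g: "0 \<le> g x" "g x \<le> K" "x \<notin> ball 0 R \<Longrightarrow> g x = 0" for x
    using U_le[OF h0U, of x] U_pos[OF h0U, of x] v(2,3)[of x] U_K(2)[OF h0U, of x] by (auto simp: g_def)
  have gint: "integrable lebesgue (\<lambda>x. g x * u x)"
    if "u \<in> borel_measurable lebesgue" "\<And>x. \<bar>u x\<bar> \<le> L" for u L
  proof (rule integrable_lebesgue_ball[where K="K * L" and R=R])
    show "\<bar>g x * u x\<bar> \<le> K * L" for x
      using g[of x] that(2)[of x] K by (auto simp: abs_mult intro!: mult_mono)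
  qed (use g that in auto)
  \<comment> \<open>First-order optimality of \<open>h0\<close>: were \<open>u\<close> better
    against \<open>g\<close>, a small move from \<open>h0\<close> towards \<open>u\<close> would
    lower \<open>D\<close> below its minimum.\<close>
  have var: "(\<integral>x. g x * u x \<partial>lebesgue) \<le> (\<integral>x. g x * h0 x \<partial>lebesgue)"
    if u_meas [measurable]: "u \<in> borel_measurable lebesgue" and u: "\<And>x. 0 \<le> u x" "\<And>x. u x \<le> L" "\<And>x. x \<notin> ball 0 R \<Longrightarrow> u x = 0"
      and Yu: "Y u \<le> ennreal M" for u L
  proof (rule ccontr)
    assume neg: "\<not> ?thesis"
    have iu: "integrable lebesgue (\<lambda>x. g x * u x)" using u by (intro gint[of _ L]) auto
    have ih: "integrable lebesgue (\<lambda>x. g x * h0 x)" using U_abs[OF h0U] by (intro gint[of _ K]) auto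
    have L: "0 \<le> L" using u(1,2)[of 0] by linarith
    have iJ: "integrable lebesgue (\<lambda>x. (u x - h0 x)\<^sup>2)"
    proof (rule sq_int[of _ _ "K + L"])
      show "\<bar>u x\<bar> \<le> K + L" for x using u[of x] K by simp
      show "\<bar>h0 x\<bar> \<le> K + L" for x using U_abs[OF h0U, of x] L by simp
    qed (use u U_K[OF h0U] in auto)
    define J where "J = (\<integral>x. (u x - h0 x)\<^sup>2 \<partial>lebesgue)"
    have J: "0 \<le> J" by (simp add: J_def)
    define I where "I = (\<integral>x. g x * u x \<partial>lebesgue) - (\<integral>x. g x * h0 x \<partial>lebesgue)"
    have I: "0 < I" using neg by (simp add: I_def)
    have step: "2 * I \<le> t * J" if t: "0 < t" "t \<le> 1" for t
    proof -
      define a where "a x = (1 - t) * h0 x + t * u x" for x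
      have [measurable]: "a \<in> borel_measurable lebesgue" unfolding a_def by measurable
      have a0: "0 \<le> a x" for x using t u(1)[of x] U_pos[OF h0U, of x] by (simp add: a_def)
      have "Y a \<le> Y (\<lambda>x. (1 - t) * h0 x) + Y (\<lambda>x. t * u x)"
        unfolding a_def by (rule bBfs_add) auto
      also have "\<dots> = ennreal (1 - t) * Y h0 + ennreal t * Y u"
        using t by (simp add: bBfs_scale)
      also have "\<dots> \<le> ennreal (1 - t) * ennreal M + ennreal t * ennreal M"
        by (intro add_mono mult_left_mono U_Y[OF h0U] Yu) auto
      also have "\<dots> = ennreal M"
        using t M by (simp add: ennreal_mult'[symmetric] ennreal_plus[symmetric] algebra_simps del: ennreal_plus)
      finally have Ya: "Y a \<le> ennreal M" .
      \<comment> \<open>\<open>u\<close> may exceed \<open>v\<close>, so the convex combination can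
        leave \<open>U\<close>. Truncation at \<open>v\<close> brings it back and moves it no
        farther from \<open>v\<close>.\<close>
      define b where "b x = min (a x) (v x)" for x
      have [measurable]: "b \<in> borel_measurable lebesgue" unfolding b_def by measurable
      have "Y b \<le> Y a" using a0 v(1) by (intro bBfs_mono) (auto simp: b_def)
      then have bU: "b \<in> U" using Ya a0 v(1) by (auto simp: U_def b_def)
      have a_eq: "(v x - a x)\<^sup>2 = (v x - h0 x)\<^sup>2 - 2 * t * (g x * u x) + 2 * t * (g x * h0 x) + t\<^sup>2 * (u x - h0 x)\<^sup>2" for x
        by (simp add: a_def g_def power2_eq_square algebra_simps)
      have ia: "integrable lebesgue (\<lambda>x. (v x - a x)\<^sup>2)"
        unfolding a_eq using D_int[OF h0U] iu ih iJ by simp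
      have "d \<le> D b" by (rule d_le[OF bU])
      also have "\<dots> \<le> (\<integral>x. (v x - a x)\<^sup>2 \<partial>lebesgue)"
        unfolding D_def
      proof (rule integral_mono[OF D_int[OF bU] ia])
        fix x
        have "\<bar>v x - b x\<bar> \<le> \<bar>v x - a x\<bar>" by (auto simp: b_def min_def)
        then show "(v x - b x)\<^sup>2 \<le> (v x - a x)\<^sup>2" by (simp add: abs_le_square_iff)
      qed
      also have "\<dots> = D h0 - 2 * t * I + t\<^sup>2 * J"
        unfolding a_eq D_def I_def J_def using D_int[OF h0U] iu ih iJ by (simp add: right_diff_distrib)
      finally have "t * (2 * I) \<le> t * (t * J)" using Dh0 by (simp add: power2_eq_square)
      then show ?thesis using t by simp
    qed
    have "2 * I \<le> min 1 (I / (J + 1)) * J" using I J by (intro step) auto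
    also have "\<dots> \<le> I / (J + 1) * J" using J by (intro mult_right_mono) auto
    also have "\<dots> \<le> I" using I J by (simp add: field_simps)
    finally show False using I by simp
  qed
  define s where "s = (\<integral>x. g x * h0 x \<partial>lebesgue)"
  have s: "0 \<le> s" unfolding s_def using g U_pos[OF h0U] by (intro Bochner_Integration.integral_nonneg) auto
  have "assoc Y g \<le> ennreal (s / M)"
    unfolding assoc_def
  proof (rule SUP_least, clarify)
    fix u :: "'a \<Rightarrow> real" assume [measurable]: "u \<in> borel_measurable lebesgue" and Yu: "Y u = 1"
    \<comment> \<open>The variational inequality is available for bounded functions supported in the
      ball; monotone convergence then removes the truncation of
      \<open>M * \<bar>u x\<bar>\<close>.\<close>
    define um where "um m x = min (M * \<bar>u x\<bar>) (real m) * indicator (ball 0 R) x" for m x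
    have [measurable]: "um m \<in> borel_measurable lebesgue" for m unfolding um_def by measurable
    have um: "0 \<le> um m x" "um m x \<le> real m" "um m x \<le> M * \<bar>u x\<bar>" for m x
      using M by (auto simp: um_def indicator_def)
    have um0: "um m x = 0" if "x \<notin> ball 0 R" for m x using that by (simp add: um_def)
    have le: "(\<integral>\<^sup>+x. ennreal (g x * um m x) \<partial>lebesgue) \<le> ennreal s" for m
    proof -
      have "Y (um m) \<le> Y (\<lambda>x. M * u x)" using um M by (intro bBfs_mono) (auto simp: abs_mult)
      also have "\<dots> = ennreal M" using M Yu by (simp add: bBfs_scale)
      finally have "(\<integral>x. g x * um m x \<partial>lebesgue) \<le> s"
        unfolding s_def by (intro var[of _ "real m"]) (use um um0 in auto)
      moreover have "(\<integral>\<^sup>+x. ennreal (g x * um m x) \<partial>lebesgue) = ennreal (\<integral>x. g x * um m x \<partial>lebesgue)"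
        using um g by (intro nn_integral_eq_integral gint[of _ "real m"]) auto
      ultimately show ?thesis by (simp add: ennreal_leI)
    qed
    have "ennreal M * (\<integral>\<^sup>+x. ennreal \<bar>g x * u x\<bar> \<partial>lebesgue) = (\<integral>\<^sup>+x. ennreal (g x * (M * \<bar>u x\<bar>)) \<partial>lebesgue)"
      using M g by (subst nn_integral_cmult[symmetric])
        (auto simp: abs_mult ennreal_mult'[symmetric] mult_ac intro!: nn_integral_cong)
    also have "\<dots> = (\<integral>\<^sup>+x. (SUP m. ennreal (g x * um m x)) \<partial>lebesgue)"
    proof (rule nn_integral_cong)
      fix x
      have "(\<lambda>m. ennreal (g x * um m x)) \<longlonglongrightarrow> ennreal (g x * (M * \<bar>u x\<bar>))"
      proof (rule tendsto_ennrealI, rule tendsto_eventually)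
        obtain N :: nat where N: "M * \<bar>u x\<bar> \<le> real N" using real_arch_simple by blast
        show "\<forall>\<^sub>F m in sequentially. g x * um m x = g x * (M * \<bar>u x\<bar>)"
          using eventually_ge_at_top[of N]
        proof eventually_elim
          case (elim m)
          then have "M * \<bar>u x\<bar> \<le> real m" using N by linarith
          then show ?case using g(3)[of x] by (auto simp: um_def indicator_def)
        qed
      qed
      moreover have "incseq (\<lambda>m. ennreal (g x * um m x))"
        using g(1)[of x] by (auto simp: incseq_def um_def indicator_def intro!: ennreal_leI mult_left_mono)
      ultimately show "ennreal (g x * (M * \<bar>u x\<bar>)) = (SUP m. ennreal (g x * um m x))"
        using LIMSEQ_SUP LIMSEQ_unique by blast
    qed
    also have "\<dots> = (SUP m. \<integral>\<^sup>+x. ennreal (g x * um m x) \<partial>lebesgue)"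
    proof (rule nn_integral_monotone_convergence_SUP)
      show "incseq (\<lambda>m x. ennreal (g x * um m x))"
        using g(1) by (auto simp: incseq_def le_fun_def um_def indicator_def intro!: ennreal_leI mult_left_mono)
    qed measurable
    also have "\<dots> \<le> ennreal s" by (rule SUP_least[OF le])
    also have "\<dots> = ennreal M * ennreal (s / M)" using M s by (simp add: ennreal_mult'[symmetric])
    finally show "(\<integral>\<^sup>+x. ennreal \<bar>g x * u x\<bar> \<partial>lebesgue) \<le> ennreal (s / M)"
      using M by (subst (asm) ennreal_mult_le_mult_iff) auto
  qed
  note assoc_g = this
  have "(\<integral>x. g x * v x \<partial>lebesgue) \<le> s"
  proof (rule field_le_epsilon)
    fix e' :: real assume e': "0 < e'"
    define e where "e = e' / M"
    have e: "0 < e" using e' M by (simp add: e_def)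
    \<comment> \<open>\<open>s\<close> may be 0, so \<open>g\<close> is normalised by a slightly
      larger positive number than \<open>s / M\<close>.\<close>
    define c where "c = s / M + e"
    have c: "0 < c" using s M e by (auto simp: c_def intro!: add_nonneg_pos)
    have "assoc Y (\<lambda>x. g x / c) \<le> 1"
      unfolding assoc_def
    proof (rule SUP_least, clarify)
      fix u :: "'a \<Rightarrow> real" assume [measurable]: "u \<in> borel_measurable lebesgue" and Yu: "Y u = 1"
      have "(\<integral>\<^sup>+x. ennreal \<bar>g x * u x\<bar> \<partial>lebesgue) \<le> assoc Y g"
        unfolding assoc_def by (intro SUP_upper) (auto simp: Yu)
      also note assoc_g
      also have "ennreal (s / M) \<le> ennreal c" using e by (intro ennreal_leI) (simp add: c_def)
      finally have "(\<integral>\<^sup>+x. ennreal \<bar>g x * u x\<bar> \<partial>lebesgue) \<le> ennreal c" .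
      then have "ennreal (1 / c) * (\<integral>\<^sup>+x. ennreal \<bar>g x * u x\<bar> \<partial>lebesgue) \<le> ennreal (1 / c) * ennreal c"
        by (intro mult_left_mono) auto
      also have "\<dots> = 1" using c by (simp add: ennreal_mult'[symmetric])
      also have "ennreal (1 / c) * (\<integral>\<^sup>+x. ennreal \<bar>g x * u x\<bar> \<partial>lebesgue) = (\<integral>\<^sup>+x. ennreal \<bar>g x / c * u x\<bar> \<partial>lebesgue)"
        using c by (subst nn_integral_cmult[symmetric])
          (auto simp: abs_mult ennreal_mult'[symmetric] intro!: nn_integral_cong)
      finally show "(\<integral>\<^sup>+x. ennreal \<bar>g x / c * u x\<bar> \<partial>lebesgue) \<le> 1" .
    qed
    then have "(\<integral>\<^sup>+x. ennreal (v x * \<bar>g x / c\<bar>) \<partial>lebesgue) \<le> ennreal M" by (intro dual) auto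
    moreover have "(\<integral>\<^sup>+x. ennreal (v x * \<bar>g x / c\<bar>) \<partial>lebesgue) = ennreal (\<integral>x. g x * v x / c \<partial>lebesgue)"
    proof -
      have "(\<integral>\<^sup>+x. ennreal (v x * \<bar>g x / c\<bar>) \<partial>lebesgue) = (\<integral>\<^sup>+x. ennreal (g x * v x / c) \<partial>lebesgue)"
        using c g by (intro nn_integral_cong) (simp add: mult.commute)
      also have "\<dots> = ennreal (\<integral>x. g x * v x / c \<partial>lebesgue)"
        using c g v v_abs by (intro nn_integral_eq_integral integrable_divide gint[of _ K]) auto
      finally show ?thesis .
    qed
    ultimately have "(\<integral>x. g x * v x \<partial>lebesgue) / c \<le> M"
      using M by (simp add: ennreal_le_iff)
    then have "(\<integral>x. g x * v x \<partial>lebesgue) \<le> M * c" using c by (simp add: field_simps)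
    also have "M * c = s + e'" using M by (simp add: c_def e_def field_simps)
    finally show "(\<integral>x. g x * v x \<partial>lebesgue) \<le> s + e'" .
  qed
  moreover have gv: "integrable lebesgue (\<lambda>x. g x * v x)" "integrable lebesgue (\<lambda>x. g x * h0 x)"
    using v_abs U_abs[OF h0U] by (auto intro!: gint[of _ K])
  moreover have "d = (\<integral>x. g x * v x \<partial>lebesgue) - s"
    unfolding Dh0[symmetric] D_def s_def Bochner_Integration.integral_diff[OF gv, symmetric]
    by (intro Bochner_Integration.integral_cong) (auto simp: g_def power2_eq_square algebra_simps)
  ultimately have "d = 0" using D_nonneg[of h0] Dh0 by simp
  then have "AE x in lebesgue. (v x - h0 x)\<^sup>2 = 0"
    using integral_nonneg_eq_0_iff_AE[OF D_int[OF h0U]] Dh0 unfolding D_def by simp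
  then have "AE x in lebesgue. \<bar>v x\<bar> \<le> \<bar>h0 x\<bar>" by eventually_elim simp
  then have "Y v \<le> Y h0" by (intro bBfs_mono) auto
  then show ?thesis using U_Y[OF h0U] by simp
qed

text \<open>Truncation in height and support reduces to the bounded case, and the monotone
  convergence axiom passes to the limit. The extra \<open>e\<close> supplies the strictly positive
  bound needed there when \<open>M = 0\<close>.\<close>

theorem Lorentz_Luxemburg:
  fixes u :: "'a \<Rightarrow> real"
  assumes u_meas [measurable]: "u \<in> borel_measurable lebesgue" and u: "\<And>x. 0 \<le> u x" and M: "0 \<le> M"
    and dual: "\<And>g. g \<in> borel_measurable lebesgue \<Longrightarrow> assoc Y g \<le> 1 \<Longrightarrow> (\<integral>\<^sup>+x. ennreal (u x * \<bar>g x\<bar>) \<partial>lebesgue) \<le> ennreal M"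
  shows "Y u \<le> ennreal M"
proof (rule ennreal_le_epsilon)
  fix e :: real assume e: "0 < e"
  define v where "v m x = min (u x) (real m) * indicator (ball 0 (real m)) x" for m x
  have [measurable]: "v m \<in> borel_measurable lebesgue" for m unfolding v_def by measurable
  have v_le: "v m x \<le> u x" for m x using u by (auto simp: v_def indicator_def)
  have "(\<lambda>m. Y (v m)) \<longlonglongrightarrow> Y u"
  proof (rule bBfs_Fatou)
    show "AE x in lebesgue. (\<forall>m. 0 \<le> v m x \<and> v m x \<le> v (Suc m) x) \<and> (\<lambda>m. v m x) \<longlonglongrightarrow> u x"
    proof (rule AE_I2, intro conjI allI)
      fix x m
      show "0 \<le> v m x" using u by (simp add: v_def indicator_def)
      show "v m x \<le> v (Suc m) x" using u by (auto simp: v_def indicator_def)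
      show "(\<lambda>m. v m x) \<longlonglongrightarrow> u x"
      proof (rule tendsto_eventually)
        obtain N :: nat where N: "max (u x) (norm x + 1) \<le> real N" using real_arch_simple by blast
        show "\<forall>\<^sub>F m in sequentially. v m x = u x"
          using eventually_ge_at_top[of N]
        proof eventually_elim
          case (elim m)
          then have "u x \<le> real m" "norm x < real m" using N by auto
          then show ?case by (simp add: v_def)
        qed
      qed
    qed
  qed auto
  moreover have "Y (v m) \<le> ennreal (M + e)" for m
  proof (rule Lorentz_Luxemburg_bounded[of _ "real m" "real m"])
    fix g :: "'a \<Rightarrow> real" assume g: "g \<in> borel_measurable lebesgue" "assoc Y g \<le> 1"
    have "(\<integral>\<^sup>+x. ennreal (v m x * \<bar>g x\<bar>) \<partial>lebesgue) \<le> (\<integral>\<^sup>+x. ennreal (u x * \<bar>g x\<bar>) \<partial>lebesgue)"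
      by (intro nn_integral_mono ennreal_leI mult_right_mono v_le) auto
    also have "\<dots> \<le> ennreal M" by (rule dual[OF g])
    also have "\<dots> \<le> ennreal (M + e)" using e by (intro ennreal_leI) auto
    finally show "(\<integral>\<^sup>+x. ennreal (v m x * \<bar>g x\<bar>) \<partial>lebesgue) \<le> ennreal (M + e)" .
  qed (use u M e in \<open>auto simp: v_def indicator_def\<close>)
  ultimately have "Y u \<le> ennreal (M + e)" by (intro LIMSEQ_le_const2) auto
  then show "Y u \<le> ennreal M + ennreal e" using M e by simp
qed

end

section \<open>Extrapolation\<close>

text \<open>The operator is uncentred, so its strict superlevel sets are unions of open
  balls.\<close>

lemma maxop_borel [measurable]: "maxop (f :: 'a :: euclidean_space \<Rightarrow> real) \<in> borel_measurable borel"
proof (rule borel_measurableI_greater)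
  fix t :: ennreal
  let ?a = "\<lambda>c r. (\<integral>\<^sup>+ y \<in> ball c r. ennreal \<bar>f y\<bar> \<partial>lebesgue) / emeasure lebesgue (ball c r)"
  have "{x \<in> space borel. t < maxop f x} = (\<Union>(c, r)\<in>{(c, r). 0 < r \<and> t < ?a c r}. ball c r)"
    by (auto simp: maxop_def less_SUP_iff) blast
  moreover have "open (\<Union>(c, r)\<in>{(c, r). 0 < r \<and> t < ?a c r}. ball c r)"
    by (intro open_UN) auto
  ultimately show "{x \<in> space borel. t < maxop f x} \<in> sets borel" by simp
qed

lemma nn_integral_ball_le_maxop:
  fixes f :: "'a :: euclidean_space \<Rightarrow> real"
  assumes "0 < r" "z \<in> ball c r"
  shows "(\<integral>\<^sup>+ y. indicator (ball c r) y * ennreal \<bar>f y\<bar> \<partial>lebesgue) \<le> maxop f z * emeasure lebesgue (ball c r)"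
proof -
  define I where "I = (\<integral>\<^sup>+ y. indicator (ball c r) y * ennreal \<bar>f y\<bar> \<partial>lebesgue)"
  define V where "V = unit_ball_vol (real DIM('a)) * r ^ DIM('a)"
  have V: "0 < V" "emeasure lebesgue (ball c r) = ennreal V"
    using assms by (auto simp: V_def emeasure_ball)
  have "I / emeasure lebesgue (ball c r) \<le> maxop f z"
    unfolding maxop_def I_def using assms by (intro SUP_upper2[of "(c, r)"]) (auto simp: mult.commute)
  then have "I / ennreal V * ennreal V \<le> maxop f z * ennreal V"
    unfolding V by (rule mult_right_mono) simp
  moreover have "I / ennreal V * ennreal V = I"
    using V by (simp add: divide_ennreal_def mult.assoc inverse_ennreal ennreal_mult'[symmetric])
  ultimately show ?thesis by (simp add: I_def V)
qed

lemma M_norm_nonneg: "M_bounded Z \<Longrightarrow> 0 \<le> M_norm Z"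
  unfolding M_bounded_def M_norm_def by (rule cInf_greatest) (auto simp: M_bound_consts_def)

text \<open>Adding 1 avoids showing that the infimum in \<^const>\<open>M_norm\<close> is attained, and keeps the constant
  away from 0.\<close>

lemma Xe_maxop_le:
  fixes Z :: "'a :: euclidean_space fnorm"
  assumes "M_bounded Z" "f \<in> borel_measurable lebesgue" "Z f < top"
  shows "Xe Z (maxop f) \<le> ennreal (M_norm Z + 1) * Z f"
proof -
  have "Inf (M_bound_consts Z) < M_norm Z + 1" by (simp add: M_norm_def)
  then obtain C where C: "C \<in> M_bound_consts Z" "C < M_norm Z + 1"
    using assms(1) cInf_lessD[of "M_bound_consts Z"] unfolding M_bounded_def by blast
  then have "Xe Z (maxop f) \<le> ennreal C * Z f"
    using assms by (simp add: M_bound_consts_def)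
  also have "\<dots> \<le> ennreal (M_norm Z + 1) * Z f"
    using C by (intro mult_right_mono ennreal_leI) auto
  finally show ?thesis .
qed

text \<open>The supremum in \<open>assoc\<close> runs over norm exactly 1, so \<open>u\<close> is
  rescaled; for norm 0 it vanishes almost everywhere.\<close>

lemma assoc_Holder:
  fixes u h :: "'a :: euclidean_space \<Rightarrow> real"
  assumes Y: "ball_Banach_fs Y" and [measurable]: "u \<in> borel_measurable lebesgue" "h \<in> borel_measurable lebesgue"
    and fin: "Y u < top"
  shows "(\<integral>\<^sup>+x. ennreal \<bar>h x * u x\<bar> \<partial>lebesgue) \<le> Y u * assoc Y h"
proof (cases "Y u = 0")
  case True
  then have "AE x in lebesgue. u x = 0" by (intro bBfs_eq_0[OF Y]) auto
  then have "(\<integral>\<^sup>+x. ennreal \<bar>h x * u x\<bar> \<partial>lebesgue) = (\<integral>\<^sup>+(x::'a). 0 \<partial>lebesgue)"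
    by (intro nn_integral_cong_AE) (auto elim!: eventually_mono)
  then show ?thesis by simp
next
  case False
  then obtain y where y: "Y u = ennreal y" "0 < y"
    using fin by (cases "Y u") (auto simp: less_le)
  have "Y (\<lambda>x. (1 / y) * u x) = 1"
    using y by (subst bBfs_scale[OF Y]) (simp_all add: ennreal_mult'[symmetric])
  then have "(\<integral>\<^sup>+x. ennreal \<bar>h x * ((1 / y) * u x)\<bar> \<partial>lebesgue) \<le> assoc Y h"
    unfolding assoc_def by (intro SUP_upper) auto
  then have "ennreal y * (\<integral>\<^sup>+x. ennreal \<bar>h x * ((1 / y) * u x)\<bar> \<partial>lebesgue) \<le> ennreal y * assoc Y h"
    by (rule mult_left_mono) simp
  also have "ennreal y * (\<integral>\<^sup>+x. ennreal \<bar>h x * ((1 / y) * u x)\<bar> \<partial>lebesgue) = (\<integral>\<^sup>+x. ennreal \<bar>h x * u x\<bar> \<partial>lebesgue)"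
    using y by (subst nn_integral_cmult[symmetric])
      (auto simp: abs_mult ennreal_mult'[symmetric] intro!: nn_integral_cong)
  finally show ?thesis by (simp add: y)
qed

lemma suminf_Suc_le:
  fixes a :: "nat \<Rightarrow> ennreal"
  shows "(\<Sum>k. a (Suc k)) \<le> (\<Sum>k. a k)"
proof (rule suminf_le_const)
  fix n
  have "(\<Sum>k<n. a (Suc k)) \<le> (\<Sum>k<Suc n. a k)" by (subst sum.lessThan_Suc_shift) simp
  also have "\<dots> \<le> (\<Sum>k. a k)" by (rule sum_le_suminf) auto
  finally show "(\<Sum>k<n. a (Suc k)) \<le> (\<Sum>k. a k)" .
qed auto

text \<open>The weight is \<open>\<Sum>k. M\<^sup>k g / (2 N)\<^sup>k\<close> with \<open>N\<close> a bound for the maximal operator; it may take the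
  value \<open>\<infinity>\<close> on a null set.\<close>

lemma Rubio_de_Francia:
  fixes Y :: "'a :: euclidean_space fnorm"
  assumes Y: "ball_Banach_fs Y" and N: "0 < N"
    and bound: "\<And>f. f \<in> borel_measurable lebesgue \<Longrightarrow> assoc Y f < top \<Longrightarrow> Xe (assoc Y) (maxop f) \<le> ennreal N * assoc Y f"
    and g [measurable]: "g \<in> borel_measurable lebesgue" and g1: "assoc Y g \<le> 1"
  obtains w where "A1_weight (2 * N) w" "AE x in lborel. ennreal \<bar>g x\<bar> \<le> w x"
    "\<And>u. u \<in> borel_measurable lebesgue \<Longrightarrow> (\<And>x. 0 \<le> u x) \<Longrightarrow> Y u < top \<Longrightarrow>
      (\<integral>\<^sup>+x. ennreal (u x) * w x \<partial>lborel) \<le> 2 * Y u"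
proof -
  let ?Z = "assoc Y"
  \<comment> \<open>The norm acts on real functions, so each iterate is cut back by
    \<open>enn2real\<close>. The finite \<open>Xe\<close> bound shows inductively that this changes
    values only on null sets.\<close>
  define F where "F k = ((\<lambda>h x. enn2real (maxop h x)) ^^ k) (\<lambda>x. \<bar>g x\<bar>)" for k :: nat
  have F0: "F 0 = (\<lambda>x. \<bar>g x\<bar>)" and FS: "F (Suc k) = (\<lambda>x. enn2real (maxop (F k) x))" for k
    by (simp_all add: F_def)
  have F_meas [measurable]: "F k \<in> borel_measurable lebesgue" for k
  proof (cases k)
    case (Suc n)
    have "(\<lambda>x. enn2real (maxop (F n) x)) \<in> borel_measurable lborel" by simp
    then show ?thesis unfolding Suc FS by (rule measurable_completion)
  qed (simp add: F0)
  have F_pos: "0 \<le> F k x" for k x by (cases k) (simp_all add: F0 FS)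
  have ZF: "?Z (F k) \<le> ennreal (N ^ k)" and XF: "Xe ?Z (maxop (F k)) \<le> ennreal (N ^ Suc k)" for k
  proof -
    have XX: "Xe ?Z (maxop (F k)) \<le> ennreal (N ^ Suc k)" if "?Z (F k) \<le> ennreal (N ^ k)" for k
    proof -
      have "?Z (F k) < top" using that by (rule le_less_trans) simp
      then have "Xe ?Z (maxop (F k)) \<le> ennreal N * ?Z (F k)" by (intro bound) auto
      also have "\<dots> \<le> ennreal N * ennreal (N ^ k)" by (intro mult_left_mono that) auto
      also have "\<dots> = ennreal (N ^ Suc k)" using N by (simp add: ennreal_mult'[symmetric])
      finally show ?thesis .
    qed
    show "?Z (F k) \<le> ennreal (N ^ k)"
    proof (induction k)
      case 0
      then show ?case using g1 by (simp add: F0 assoc_def abs_mult)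
    next
      case (Suc k)
      have X: "Xe ?Z (maxop (F k)) \<le> ennreal (N ^ Suc k)" by (rule XX[OF Suc])
      then have "AE x in lebesgue. maxop (F k) x < top"
        by (auto simp: Xe_def top_unique split: if_splits)
      then show ?case using X by (simp add: Xe_def FS)
    qed
    then show "Xe ?Z (maxop (F k)) \<le> ennreal (N ^ Suc k)" by (rule XX)
  qed
  have "AE x in lebesgue. maxop (F k) x < top" for k
    using XF[of k] by (auto simp: Xe_def top_unique split: if_splits)
  then have "AE x in lborel. maxop (F k) x < top" for k
    by (simp add: AE_completion_iff)
  then have fin: "AE x in lborel. \<forall>k. maxop (F k) x < top" by (simp add: AE_all_countable)
  define b where "b = 1 / (2 * N)"
  have b: "0 < b" "b * N = 1 / 2" using N by (simp_all add: b_def)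
  define w0 where "w0 x = (\<Sum>k. ennreal (b ^ k) * ennreal (F k x))" for x
  have [measurable]: "w0 \<in> borel_measurable lebesgue" unfolding w0_def by measurable
  \<comment> \<open>The term \<open>k = 0\<close> is only Lebesgue measurable; \<open>w\<close> is a
    Borel version of the series.\<close>
  then obtain w where [measurable]: "w \<in> borel_measurable lborel" and ww: "AE x in lborel. w0 x = w x"
    using completion_ex_borel_measurable by blast
  have int_w: "(\<integral>\<^sup>+x. h x * w x \<partial>lborel) = (\<Sum>k. ennreal (b ^ k) * (\<integral>\<^sup>+x. h x * ennreal (F k x) \<partial>lebesgue))"
    if [measurable]: "h \<in> borel_measurable lebesgue" for h
  proof -
    have "(\<integral>\<^sup>+x. h x * w x \<partial>lborel) = (\<integral>\<^sup>+x. h x * w0 x \<partial>lborel)"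
      using ww by (intro nn_integral_cong_AE) (auto elim!: eventually_mono)
    also have "\<dots> = (\<integral>\<^sup>+x. (\<Sum>k. ennreal (b ^ k) * (h x * ennreal (F k x))) \<partial>lebesgue)"
      unfolding nn_integral_completion w0_def
      by (intro nn_integral_cong) (simp add: mult.left_commute flip: ennreal_suminf_cmult)
    also have "\<dots> = (\<Sum>k. \<integral>\<^sup>+x. ennreal (b ^ k) * (h x * ennreal (F k x)) \<partial>lebesgue)"
      by (rule nn_integral_suminf) measurable
    also have "\<dots> = (\<Sum>k. ennreal (b ^ k) * (\<integral>\<^sup>+x. h x * ennreal (F k x) \<partial>lebesgue))"
      by (intro suminf_cong nn_integral_cmult) measurable
    finally show ?thesis .
  qed
  show ?thesis
  proof (rule that)
    show "A1_weight (2 * N) w"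
      unfolding A1_weight_def
    proof (intro conjI)
      show "AE z in lborel. \<forall>c r. 0 < r \<longrightarrow> z \<in> ball c r \<longrightarrow>
        (\<integral>\<^sup>+x. indicator (ball c r) x * w x \<partial>lborel) \<le> ennreal (2 * N) * w z * emeasure lborel (ball c r)"
        using fin ww
      proof eventually_elim
        case (elim z)
        show ?case
        proof (intro allI impI)
          fix c r assume r: "0 < r" and z: "z \<in> ball c r"
          let ?V = "emeasure lborel (ball c r)"
          have "(\<integral>\<^sup>+x. indicator (ball c r) x * w x \<partial>lborel)
            = (\<Sum>k. ennreal (b ^ k) * (\<integral>\<^sup>+x. indicator (ball c r) x * ennreal (F k x) \<partial>lebesgue))"
            by (rule int_w) measurable
          also have "\<dots> \<le> (\<Sum>k. ennreal (b ^ k) * (ennreal (F (Suc k) z) * ?V))"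
          proof (intro suminf_le mult_left_mono)
            fix k
            have "ennreal (F (Suc k) z) = maxop (F k) z" using elim by (simp add: FS)
            then show "(\<integral>\<^sup>+x. indicator (ball c r) x * ennreal (F k x) \<partial>lebesgue) \<le> ennreal (F (Suc k) z) * ?V"
              using nn_integral_ball_le_maxop[OF r z, of "F k"] F_pos by simp
          qed auto
          \<comment> \<open>The maximal operator shifts the index by one, and
            \<open>b ^ k = 2 * N * b ^ Suc k\<close>; this is the source of the
            \<open>A\<^sub>1\<close> constant \<open>2 * N\<close>. The shifted series omits only
            the first term of \<open>w0\<close>.\<close>
          also have "\<dots> = (\<Sum>k. ennreal (2 * N) * ?V * (ennreal (b ^ Suc k) * ennreal (F (Suc k) z)))"
          proof (rule suminf_cong)
            fix k
            have "ennreal (b ^ k) = ennreal (2 * N) * ennreal (b ^ Suc k)"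
              using b N by (simp add: b_def ennreal_mult'[symmetric])
            then show "ennreal (b ^ k) * (ennreal (F (Suc k) z) * ?V) = ennreal (2 * N) * ?V * (ennreal (b ^ Suc k) * ennreal (F (Suc k) z))"
              by (simp only: mult_ac)
          qed
          also have "\<dots> = ennreal (2 * N) * ?V * (\<Sum>k. ennreal (b ^ Suc k) * ennreal (F (Suc k) z))"
            by (rule ennreal_suminf_cmult)
          also have "\<dots> \<le> ennreal (2 * N) * ?V * w0 z"
            unfolding w0_def by (intro mult_left_mono suminf_Suc_le[of "\<lambda>k. ennreal (b ^ k) * ennreal (F k z)"]) auto
          finally show "(\<integral>\<^sup>+x. indicator (ball c r) x * w x \<partial>lborel) \<le> ennreal (2 * N) * w z * ?V"
            using elim by (simp add: mult_ac)
        qed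
      qed
    qed measurable
    show "AE x in lborel. ennreal \<bar>g x\<bar> \<le> w x"
      using ww
    proof eventually_elim
      case (elim x)
      have "ennreal \<bar>g x\<bar> = (\<Sum>k\<in>{0}. ennreal (b ^ k) * ennreal (F k x))" by (simp add: F0)
      also have "\<dots> \<le> w0 x" unfolding w0_def by (rule sum_le_suminf) auto
      finally show ?case using elim by simp
    qed
    fix u :: "'a \<Rightarrow> real" assume [measurable]: "u \<in> borel_measurable lebesgue" and u: "\<And>x. 0 \<le> u x" and Yu: "Y u < top"
    have "(\<integral>\<^sup>+x. ennreal (u x) * w x \<partial>lborel) = (\<Sum>k. ennreal (b ^ k) * (\<integral>\<^sup>+x. ennreal (u x) * ennreal (F k x) \<partial>lebesgue))"
      by (rule int_w) measurable
    also have "\<dots> \<le> (\<Sum>k. ennreal ((1 / 2) ^ k) * Y u)"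
    proof (intro suminf_le)
      fix k
      have "(\<integral>\<^sup>+x. ennreal (u x) * ennreal (F k x) \<partial>lebesgue) = (\<integral>\<^sup>+x. ennreal \<bar>F k x * u x\<bar> \<partial>lebesgue)"
        using u F_pos by (intro nn_integral_cong) (simp add: ennreal_mult'[symmetric] mult.commute)
      also have "\<dots> \<le> Y u * ?Z (F k)" by (rule assoc_Holder[OF Y _ _ Yu]) measurable
      also have "\<dots> \<le> Y u * ennreal (N ^ k)" by (intro mult_left_mono ZF) auto
      finally have "ennreal (b ^ k) * (\<integral>\<^sup>+x. ennreal (u x) * ennreal (F k x) \<partial>lebesgue) \<le> ennreal (b ^ k) * (Y u * ennreal (N ^ k))"
        by (rule mult_left_mono) simp
      also have "\<dots> = ennreal (b ^ k * N ^ k) * Y u"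
        using b N by (simp add: ennreal_mult' mult_ac)
      also have "b ^ k * N ^ k = (1 / 2) ^ k" by (simp add: b(2) flip: power_mult_distrib)
      finally show "ennreal (b ^ k) * (\<integral>\<^sup>+x. ennreal (u x) * ennreal (F k x) \<partial>lebesgue) \<le> ennreal ((1 / 2) ^ k) * Y u" .
    qed auto
    also have "\<dots> = (\<Sum>k. ennreal ((1 / 2) ^ k)) * Y u" by (rule ennreal_suminf_multc)
    also have "(\<Sum>k. ennreal ((1 / 2) ^ k)) = ennreal 2"
      using geometric_sums[of "1/2::real"] by (intro suminf_ennreal_eq) auto
    finally show "(\<integral>\<^sup>+x. ennreal (u x) * w x \<partial>lborel) \<le> 2 * Y u" by simp
  qed
qed

text \<open>A gradient bound \<open>G\<close> makes \<open>f\<close> Lipschitz, so a pair in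
  \<open>Eset\<close> at distance \<open>r\<close> satisfies
  \<open>r powr \<beta> < G / lam\<close>. The section lies in a ball, where the kernel is
  integrable.\<close>

lemma Eset_section_integral_finite:
  fixes f :: "'a :: euclidean_space \<Rightarrow> real"
  assumes der: "\<And>x. (f has_derivative (\<lambda>h. f' x \<bullet> h)) (at x)" and cont: "continuous_on UNIV f'"
    and G: "\<And>x. norm (f' x) \<le> G" and lam: "0 < lam" and \<beta>: "0 < \<beta>" and \<gamma>: "0 < \<gamma>"
  shows "(\<integral>\<^sup>+y. indicator (Eset lam \<beta> f) (x, y) * ennreal (norm (x - y) powr (\<gamma> - real DIM('a))) \<partial>lborel) < top"
proof -
  have G0: "0 \<le> G" using G[of undefined] norm_ge_zero order_trans by blast
  have lip: "\<bar>f x - f y\<bar> \<le> G * norm (x - y)" for x y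
  proof -
    have "ennreal \<bar>f x - f y\<bar> \<le> (\<integral>\<^sup>+t. indicator {0..1} t * ennreal (norm (x - y) * norm (f' (y + t *\<^sub>R (x - y)))) \<partial>lborel)"
      by (rule C1_diff_le_nn_integral[OF der cont])
    also have "\<dots> \<le> (\<integral>\<^sup>+t. ennreal (G * norm (x - y)) * indicator {0..1::real} t \<partial>lborel)"
      using G by (intro nn_integral_mono) (auto simp: indicator_def mult.commute[of G] intro!: ennreal_leI mult_left_mono)
    also have "\<dots> = ennreal (G * norm (x - y))" by (simp add: nn_integral_cmult_indicator)
    finally show ?thesis using G0 by simp
  qed
  define \<rho> where "\<rho> = (G / lam) powr (1 / \<beta>) + 1"
  have \<rho>: "0 < \<rho>" by (simp add: \<rho>_def add_nonneg_pos)
  have near: "y \<in> ball x \<rho>" if "(x, y) \<in> Eset lam \<beta> f" for y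
  proof -
    let ?r = "norm (x - y)"
    from that have r: "0 < ?r" and gt: "lam < \<bar>f x - f y\<bar> / ?r powr (1 + \<beta>)" by (auto simp: Eset_def)
    have "lam * (?r * ?r powr \<beta>) < \<bar>f x - f y\<bar>" using gt r by (simp add: field_simps powr_add)
    also have "\<dots> \<le> G * ?r" by (rule lip)
    finally have "?r powr \<beta> < G / lam" using r lam by (simp add: field_simps)
    then have "(?r powr \<beta>) powr (1 / \<beta>) \<le> (G / lam) powr (1 / \<beta>)"
      using \<beta> by (intro powr_mono2) auto
    then have "?r \<le> (G / lam) powr (1 / \<beta>)" using \<beta> r by (simp add: powr_powr)
    then show ?thesis by (simp add: \<rho>_def dist_norm)
  qed
  have "(\<integral>\<^sup>+y. indicator (Eset lam \<beta> f) (x, y) * ennreal (norm (x - y) powr (\<gamma> - real DIM('a))) \<partial>lborel)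
    \<le> (\<integral>\<^sup>+y. ennreal (norm (y - x) powr (\<gamma> - real DIM('a))) * indicator (ball x \<rho>) y \<partial>lborel)"
    using near by (intro nn_integral_mono) (auto simp: indicator_def norm_minus_commute simp del: mem_ball)
  also have "\<dots> \<le> ennreal (kernel_const DIM('a) \<gamma> * \<rho> powr \<gamma>)"
    by (rule kernel_integral_ball_le[OF \<gamma> \<rho>])
  also have "\<dots> < top" by simp
  finally show ?thesis .
qed

lemma Xpow_powr_inverse:
  assumes "1 \<le> p" "\<And>x. 0 \<le> F x"
  shows "Xpow X (1 / p) (\<lambda>x. F x powr p) = enn_powr (X F) p"
proof -
  have "\<bar>F x powr p\<bar> powr (1 / p) = F x" for x using assms by (simp add: powr_powr)
  then show ?thesis using assms by (simp add: Xpow_def)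
qed

text \<open>Quantifying \<open>Cf\<close> before \<open>X\<close> and \<open>f\<close> expresses
  that the constant depends on the space only through the operator norm. The gradient is the vector
  \<open>f'\<close> representing the derivative by the inner product.\<close>

theorem theorem3p8:
  fixes \<gamma> p q :: real
  assumes "0 < \<gamma>" and "1 \<le> p" and "0 < q"
    and "real DIM('a::euclidean_space) * (1 / p - 1 / q) < 1"
  shows "\<exists>Cf :: real \<Rightarrow> real. (\<forall>t\<ge>0. 0 < Cf t) \<and> continuous_on {0..} Cf \<and> mono_on {0..} Cf \<and>
    (\<forall>X :: ('a \<Rightarrow> real) \<Rightarrow> ennreal.
       ball_Banach_fs X \<longrightarrow> ball_Banach_fs (Xpow X (1 / p)) \<longrightarrow>
       M_bounded (assoc (Xpow X (1 / p))) \<longrightarrow>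
       (\<forall>(f :: 'a \<Rightarrow> real) (f' :: 'a \<Rightarrow> 'a).
          (\<forall>x. (f has_derivative (\<lambda>h. f' x \<bullet> h)) (at x)) \<longrightarrow>
          continuous_on UNIV f' \<longrightarrow>
          compact (closure {x. f' x \<noteq> 0}) \<longrightarrow>
          (SUP lam \<in> {0<..}. ennreal lam *
             Xe X (\<lambda>x. enn_powr
               (\<integral>\<^sup>+ y. indicator (Eset lam (\<gamma> / q) f) (x, y) *
                   ennreal (norm (x - y) powr (\<gamma> - real DIM('a))) \<partial>lebesgue) (1 / q)))
          \<le> ennreal (Cf (M_norm (assoc (Xpow X (1 / p))))) * X (\<lambda>x. norm (f' x))))"
proof (rule weighted_estimate[OF assms])
  note \<gamma> = assms(1) and p = assms(2) and q = assms(3)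
  fix D assume D: "0 < D"
    and est: "\<And>(f :: 'a \<Rightarrow> real) f' G A w lam. (\<And>x. (f has_derivative (\<lambda>h. f' x \<bullet> h)) (at x)) \<Longrightarrow>
      continuous_on UNIV f' \<Longrightarrow> (\<And>x. norm (f' x) \<le> G) \<Longrightarrow> A1_weight A w \<Longrightarrow> 0 \<le> A \<Longrightarrow> 0 < lam \<Longrightarrow>
      (\<integral>\<^sup>+x. enn_powr (\<integral>\<^sup>+y. indicator (Eset lam (\<gamma> / q) f) (x, y) * ennreal (norm (x - y) powr (\<gamma> - real DIM('a))) \<partial>lborel) (p / q) * w x \<partial>lborel)
      \<le> ennreal (D * (1 + A)\<^sup>2 / lam powr p) * (\<integral>\<^sup>+x. ennreal (norm (f' x) powr p) * w x \<partial>lborel)"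
  \<comment> \<open>With \<open>t + 1\<close> as a bound for the maximal operator the weight has
    \<open>A = 2 * (t + 1)\<close>, so \<open>1 + A = 2 * t + 3\<close>. The factor 2 beside
    \<open>D\<close> comes from the norm bound for the weight series.\<close>
  define Cf where "Cf t = (2 * D) powr (1 / p) * (2 * t + 3)\<^sup>2" for t :: real
  have Cf_pos: "0 < Cf t" if "0 \<le> t" for t using that D by (simp add: Cf_def)
  show ?thesis
  proof (intro exI[of _ Cf] conjI allI impI)
    show "continuous_on {0..} Cf" unfolding Cf_def by (intro continuous_intros)
    show "mono_on {0..} Cf"
      unfolding Cf_def by (intro mono_onI mult_left_mono power_mono) auto
    fix X :: "'a fnorm" and f :: "'a \<Rightarrow> real" and f' :: "'a \<Rightarrow> 'a"
    define Y where "Y = Xpow X (1 / p)"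
    define t where "t = M_norm (assoc Y)"
    assume "ball_Banach_fs (Xpow X (1 / p))" and "M_bounded (assoc (Xpow X (1 / p)))"
      and "\<forall>x. (f has_derivative (\<lambda>h. f' x \<bullet> h)) (at x)" and cont: "continuous_on UNIV f'"
      and comp: "compact (closure {x. f' x \<noteq> 0})"
    then have Y: "ball_Banach_fs Y" and bdd: "M_bounded (assoc Y)"
      and der: "\<And>x. (f has_derivative (\<lambda>h. f' x \<bullet> h)) (at x)" by (auto simp: Y_def)
    have t: "0 \<le> t" unfolding t_def by (rule M_norm_nonneg[OF bdd])
    have t1: "0 < t + 1" using t by simp
    have bound: "Xe (assoc Y) (maxop h) \<le> ennreal (t + 1) * assoc Y h"
      if "h \<in> borel_measurable lebesgue" "assoc Y h < top" for h
      unfolding t_def by (rule Xe_maxop_le[OF bdd that])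
    obtain G where G: "\<And>x. norm (f' x) \<le> G"
    proof -
      have "bounded (f' ` closure {x. f' x \<noteq> 0})"
        by (intro compact_imp_bounded compact_continuous_image continuous_on_subset[OF cont] comp) auto
      then obtain B where B: "\<And>x. x \<in> closure {x. f' x \<noteq> 0} \<Longrightarrow> norm (f' x) \<le> B"
        by (auto simp: bounded_iff)
      have "norm (f' x) \<le> max B 0" for x
        using B[of x] closure_subset[of "{x. f' x \<noteq> 0}"] by (cases "f' x = 0") auto
      then show ?thesis using that by blast
    qed
    have [measurable]: "f' \<in> borel_measurable borel"
      using cont by (rule borel_measurable_continuous_onI)
    have "continuous_on UNIV f"
      using der by (meson continuous_at_imp_continuous_on has_derivative_continuous)
    then have [measurable]: "f \<in> borel_measurable borel" by (rule borel_measurable_continuous_onI)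
    define Q where "Q = X (\<lambda>x. norm (f' x))"
    have "(SUP lam \<in> {0<..}. ennreal lam *
             Xe X (\<lambda>x. enn_powr
               (\<integral>\<^sup>+ y. indicator (Eset lam (\<gamma> / q) f) (x, y) *
                   ennreal (norm (x - y) powr (\<gamma> - real DIM('a))) \<partial>lebesgue) (1 / q))) \<le> ennreal (Cf t) * Q"
    proof (cases Q)
      case top
      then show ?thesis using Cf_pos[OF t] by (simp add: ennreal_mult_top)
    next
      case (real Qr)
      show ?thesis
      proof (rule SUP_least)
        fix lam :: real assume "lam \<in> {0<..}"
        then have lam: "0 < lam" by simp
        define H where "H x = (\<integral>\<^sup>+ y. indicator (Eset lam (\<gamma> / q) f) (x, y) * ennreal (norm (x - y) powr (\<gamma> - real DIM('a))) \<partial>lborel)" for x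
        have [measurable]: "H \<in> borel_measurable borel" unfolding H_def by measurable
        have H_fin: "H x < top" for x
          unfolding H_def using \<gamma> q by (intro Eset_section_integral_finite[OF der cont G lam]) auto
        \<comment> \<open>Duality is stated for real functions. The section integrals are finite at
          every point, so nothing is lost and \<open>Xe X\<close> reduces to
          \<open>X F\<close>.\<close>
        define F where "F x = enn2real (enn_powr (H x) (1 / q))" for x
        have [measurable]: "F \<in> borel_measurable lebesgue"
          unfolding F_def by (rule measurable_completion) measurable
        have F: "0 \<le> F x" "ennreal (F x powr p) = enn_powr (H x) (p / q)" for x
          using H_fin[of x] by (cases "H x"; simp add: F_def enn_powr_ennreal powr_powr)+
        have "enn_powr (H x) (1 / q) < top" for x
          using H_fin[of x] by (cases "H x") (auto simp: enn_powr_ennreal)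
        then have Xe_eq: "Xe X (\<lambda>x. enn_powr (H x) (1 / q)) = X F"
          by (simp add: Xe_def F_def[abs_def])
        define C where "C = D * (1 + 2 * (t + 1))\<^sup>2 / lam powr p"
        have C: "0 \<le> C" using D by (simp add: C_def)
        have YQ: "Y (\<lambda>x. norm (f' x) powr p) = ennreal (Qr powr p)"
          unfolding Y_def using p real by (subst Xpow_powr_inverse) (auto simp: enn_powr_ennreal Q_def[symmetric])
        have "Y (\<lambda>x. F x powr p) \<le> ennreal (2 * C * Qr powr p)"
        proof (rule Lorentz_Luxemburg[OF Y])
          fix g :: "'a \<Rightarrow> real" assume g: "g \<in> borel_measurable lebesgue" "assoc Y g \<le> 1"
          show "(\<integral>\<^sup>+x. ennreal (F x powr p * \<bar>g x\<bar>) \<partial>lebesgue) \<le> ennreal (2 * C * Qr powr p)"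
          proof (rule Rubio_de_Francia[OF Y t1 bound g])
            fix w assume w: "A1_weight (2 * (t + 1)) w" and gw: "AE x in lborel. ennreal \<bar>g x\<bar> \<le> w x"
              and wY: "\<And>u. u \<in> borel_measurable lebesgue \<Longrightarrow> (\<And>x. 0 \<le> u x) \<Longrightarrow> Y u < top \<Longrightarrow>
                (\<integral>\<^sup>+x. ennreal (u x) * w x \<partial>lborel) \<le> 2 * Y u"
            have "(\<integral>\<^sup>+x. ennreal (F x powr p * \<bar>g x\<bar>) \<partial>lebesgue) \<le> (\<integral>\<^sup>+x. enn_powr (H x) (p / q) * w x \<partial>lborel)"
              unfolding nn_integral_completion
            proof (rule nn_integral_mono_AE)
              show "AE x in lborel. ennreal (F x powr p * \<bar>g x\<bar>) \<le> enn_powr (H x) (p / q) * w x"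
                using gw by eventually_elim (simp add: ennreal_mult F(2) mult_left_mono)
            qed
            also have "\<dots> \<le> ennreal C * (\<integral>\<^sup>+x. ennreal (norm (f' x) powr p) * w x \<partial>lborel)"
              unfolding H_def C_def using t by (intro est[OF der cont G w _ lam]) auto
            also have "\<dots> \<le> ennreal C * (2 * Y (\<lambda>x. norm (f' x) powr p))"
            proof (intro mult_left_mono wY)
              show "(\<lambda>x. norm (f' x) powr p) \<in> borel_measurable lebesgue"
                by (rule measurable_completion) measurable
            qed (auto simp: YQ)
            also have "\<dots> = ennreal (2 * C * Qr powr p)"
              using C by (simp add: YQ ennreal_mult' mult_ac)
            finally show "(\<integral>\<^sup>+x. ennreal (F x powr p * \<bar>g x\<bar>) \<partial>lebesgue) \<le> ennreal (2 * C * Qr powr p)" .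
          qed
        qed (use C in auto)
        then have "enn_powr (X F) p \<le> ennreal (2 * C * Qr powr p)"
          unfolding Y_def using p F(1) by (subst (asm) Xpow_powr_inverse) auto
        then have "X F \<le> ennreal ((2 * C * Qr powr p) powr (1 / p))"
          using p C by (subst (asm) enn_powr_le_iff) (auto simp: enn_powr_ennreal)
        then have "ennreal lam * X F \<le> ennreal lam * ennreal ((2 * C * Qr powr p) powr (1 / p))"
          by (rule mult_left_mono) simp
        also have "\<dots> = ennreal (lam * (2 * C * Qr powr p) powr (1 / p))"
          using lam by (simp add: ennreal_mult')
        also have "\<dots> \<le> ennreal (Cf t * Qr)"
        proof (rule ennreal_leI)
          have T: "1 \<le> (2 * t + 3)\<^sup>2" using t by (simp add: one_le_power)
          have "2 * C * Qr powr p = (2 * D) * (2 * t + 3)\<^sup>2 * (Qr / lam) powr p"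
            using lam real by (simp add: C_def powr_divide algebra_simps)
          then have "(2 * C * Qr powr p) powr (1 / p) = ((2 * D) * (2 * t + 3)\<^sup>2 * (Qr / lam) powr p) powr (1 / p)"
            by (simp only:)
          also have "\<dots> = (2 * D) powr (1 / p) * ((2 * t + 3)\<^sup>2) powr (1 / p) * (Qr / lam)"
            using D p lam real by (simp add: powr_mult powr_powr)
          finally have "lam * (2 * C * Qr powr p) powr (1 / p) = (2 * D) powr (1 / p) * ((2 * t + 3)\<^sup>2) powr (1 / p) * Qr"
            using lam by simp
          \<comment> \<open>The base is at least 1, so the exponent \<open>1 / p\<close> may be
            raised to 1, which leaves a polynomial in \<open>t\<close>.\<close>
          also have "\<dots> \<le> (2 * D) powr (1 / p) * ((2 * t + 3)\<^sup>2) powr 1 * Qr"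
            using T p real by (intro mult_right_mono mult_left_mono powr_mono) auto
          also have "\<dots> = Cf t * Qr" using t by (simp add: Cf_def)
          finally show "lam * (2 * C * Qr powr p) powr (1 / p) \<le> Cf t * Qr" .
        qed
        also have "\<dots> = ennreal (Cf t) * Q"
          using Cf_pos[OF t] real by (simp add: ennreal_mult')
        finally show "ennreal lam * Xe X (\<lambda>x. enn_powr
               (\<integral>\<^sup>+ y. indicator (Eset lam (\<gamma> / q) f) (x, y) *
                   ennreal (norm (x - y) powr (\<gamma> - real DIM('a))) \<partial>lebesgue) (1 / q)) \<le> ennreal (Cf t) * Q"
          using Xe_eq by (simp add: nn_integral_completion H_def)
      qed
    qed
    then show "(SUP lam \<in> {0<..}. ennreal lam *
             Xe X (\<lambda>x. enn_powr
               (\<integral>\<^sup>+ y. indicator (Eset lam (\<gamma> / q) f) (x, y) *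
                   ennreal (norm (x - y) powr (\<gamma> - real DIM('a))) \<partial>lebesgue) (1 / q)))
          \<le> ennreal (Cf (M_norm (assoc (Xpow X (1 / p))))) * X (\<lambda>x. norm (f' x))"
      by (simp add: t_def Y_def Q_def)
  qed (use Cf_pos in auto)
qed

end
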